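(* Locally, a generic rank-$1$ Bäcklund transformation $(N,\mathcal B)$ relating two hyperbolic Monge-Ampère systems with its $1$-adapted coframing satisfying $\epsilon_1=\epsilon_2=1$ and $A_1=-A_4=1$ can be uniquely determined by specifying $1$ function of $2$ variables.
   Context: A generic rank-$1$ Bäcklund transformation $(N^6,\mathcal B)$ relating two hyperbolic Monge-Ampère systems (generic meaning that the intrinsic torsion of its associated $G$-structure takes values in orbits of the largest possible dimension) locally carries a canonical $1$-adapted coframing, in the following sense, with $\mathcal B=\langle\omega^1,\omega^2,\omega^3\wedge\omega^4,\omega^5\wedge\omega^6\rangle$, and conversely such a coframing determines the Bäcklund transformation. $1$-adapted coframing. A coframing $(\omega^1,\dots,\omega^6)$ on an open subset $U$ of a $6$-manifold $N$ is $1$-adapted if there exist $1$-forms $\alpha_0,\dots,\alpha_3,\beta_0,\dots,\beta_3$ and functions $A_1,A_4,B_1,\dots,B_4,C_1,\dots,C_4$ on $U$ such that $$d\omega^1=-\beta_0\wedge\omega^1+A_1(\omega^3-C_1\omega^1)\wedge(\omega^4-C_2\omega^1)+\omega^5\wedge\omega^6,$$ $$d\omega^2=-\alpha_0\wedge\omega^2+\omega^3\wedge\omega^4+A_4(\omega^5-C_3\omega^2)\wedge(\omega^6-C_4\omega^2),$$ $$d\omega^3=-\alpha_1\wedge\omega^3-\alpha_2\wedge\omega^4+B_1\omega^1\wedge\omega^2+C_1\omega^5\wedge\omega^6,$$ $$d\omega^4=-\alpha_3\wedge\omega^3-(\alpha_0-\alpha_1)\wedge\omega^4+B_2\omega^1\wedge\omega^2+C_2\omega^5\wedge\omega^6,$$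 $$d\omega^5=-\beta_1\wedge\omega^5-\beta_2\wedge\omega^6+B_3\omega^1\wedge\omega^2+C_3\omega^3\wedge\omega^4,$$ $$d\omega^6=-\beta_3\wedge\omega^5-(\beta_0-\beta_1)\wedge\omega^6+B_4\omega^1\wedge\omega^2+C_4\omega^3\wedge\omega^4,$$ and $$\begin{pmatrix} B_1 & C_1 \\ B_2 & C_2 \end{pmatrix}=\begin{pmatrix} \epsilon_1 & 0 \\ 0 & 1 \end{pmatrix},\qquad \begin{pmatrix} B_3 & C_3 \\ B_4 & C_4 \end{pmatrix}=\begin{pmatrix} \epsilon_2 & 0 \\ 0 & 1 \end{pmatrix},\qquad \epsilon_1,\epsilon_2\in\{1,-1\}.$$ Counting functions (Cartan's notion of generality). Consider coframings on $6$-manifolds satisfying structure equations $d\omega^i=-\frac12 C^i_{jk}(a)\,\omega^j\wedge\omega^k$, $da^\alpha=F^\alpha_i(a,b)\,\omega^i$, where $a=(a^\alpha)$ are $\mathbb R^s$-valued invariants, $b=(b^\rho)$ are $\mathbb R^r$-valued "free derivatives", the functions $C^i_{jk}=-C^i_{kj}$, $F^\alpha_i$ are real analytic, and $d^2=0$ is formally compatible with these equations ($d(d\omega^i)=0$ holds identically and $d(da^\alpha)=0$ holds identically after replacing $db^\rho$ by some $G^\rho_j(a,b)\omega^j$). The tableau of free derivatives at $(a,b)$ is the subspace of $\mathrm{Hom}(\mathbb R^6,\mathbb R^s)$ spanned by $(\partial F^\alpha_i/\partial b^\rho)$, $\rho=1,\dots,r$, with Cartan characters $(s_1,\dots,s_6)$;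 it is involutive if its first prolongation has dimension $\sum_j j s_j$. In the involutive case, such coframings are said to be locally uniquely determined (up to diffeomorphism) by specifying $s_k$ functions of $k$ variables, where $s_k$ is the last nonzero Cartan character.
   Formalization: The count of 1 function of 2 variables is for the general family; finitely many further families of strictly lower generality are allowed, since some homogeneous 1-adapted coframings with ε1=ε2=1, A1=-A4=1 depend only on a constant. *)

theory Defs
  imports "HOL-Analysis.Analysis" "HOL-Library.Function_Algebras"
begin

section \<open>Differential forms on open subsets of six-dimensional space\<close>

text \<open>
  Everything is local, so a 6-manifold is replaced by the domain of a chart, an open subset of
  \<^typ>\<open>real^6\<close>.  A 1-form is its field of components with respect to the chart, and a 2-form is its
  field of skew component matrices.  In the index type \<^typ>\<open>6\<close> the numeral 6 denotes the same
  element as 0; the numerals 1, \<dots>, 6 name its six distinct elements.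
\<close>

type_synonym pt = "real^6"
type_synonym form1 = "pt \<Rightarrow> real^6"
type_synonym form2 = "pt \<Rightarrow> real^6^6"
type_synonym coframe = "6 \<Rightarrow> form1"

definition partial :: "6 \<Rightarrow> (pt \<Rightarrow> real) \<Rightarrow> pt \<Rightarrow> real" where
  "partial j f x = frechet_derivative f (at x) (axis j 1)"

primrec Ck_on :: "nat \<Rightarrow> pt set \<Rightarrow> (pt \<Rightarrow> real) \<Rightarrow> bool" where
  "Ck_on 0 U f \<longleftrightarrow> continuous_on U f"
| "Ck_on (Suc n) U f \<longleftrightarrow> (\<forall>x\<in>U. f differentiable (at x)) \<and> (\<forall>j. Ck_on n U (partial j f))"

definition smooth_on :: "pt set \<Rightarrow> (pt \<Rightarrow> real) \<Rightarrow> bool" where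
  "smooth_on U f \<longleftrightarrow> (\<forall>n. Ck_on n U f)"

definition smooth_form :: "pt set \<Rightarrow> form1 \<Rightarrow> bool" where
  "smooth_form U \<theta> \<longleftrightarrow> (\<forall>j. smooth_on U (\<lambda>x. \<theta> x $ j))"

definition wedge :: "real^6 \<Rightarrow> real^6 \<Rightarrow> real^6^6" (infixl \<open>\<^bold>\<and>\<close> 76) where
  "u \<^bold>\<and> v = (\<chi> j k. u $ j * v $ k - u $ k * v $ j)"

definition d0 :: "(pt \<Rightarrow> real) \<Rightarrow> form1" where
  "d0 f x = (\<chi> j. partial j f x)"

definition d1 :: "form1 \<Rightarrow> form2" where
  "d1 \<theta> x = (\<chi> j k. partial j (\<lambda>y. \<theta> y $ k) x - partial k (\<lambda>y. \<theta> y $ j) x)"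

definition coframing :: "pt set \<Rightarrow> coframe \<Rightarrow> bool" where
  "coframing U \<omega> \<longleftrightarrow>
     open U \<and> (\<forall>i. smooth_form U (\<omega> i)) \<and> (\<forall>x\<in>U. det (\<chi> i. \<omega> i x) \<noteq> 0)"


section \<open>Generic rank-1 Baecklund transformations and their 1-adapted coframings\<close>

text \<open>
  The exterior differential system generated by the two 1-forms \<open>\<omega>\<^sup>1, \<omega>\<^sup>2\<close> and the two 2-forms
  \<open>\<omega>\<^sup>3\<and>\<omega>\<^sup>4, \<omega>\<^sup>5\<and>\<omega>\<^sup>6\<close>, recorded by its homogeneous parts of degree 1 and 2 (which
  generate it).  Forms are total functions, constrained on \<open>U\<close> only.
\<close>

type_synonym eds = "form1 set \<times> form2 set"

definition backlund_ideal :: "pt set \<Rightarrow> coframe \<Rightarrow> eds" where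
  "backlund_ideal U \<omega> =
    ({\<theta>. \<exists>f g. smooth_on U f \<and> smooth_on U g \<and>
         (\<forall>x\<in>U. \<theta> x = f x *\<^sub>R \<omega> 1 x + g x *\<^sub>R \<omega> 2 x)},
     {\<Theta>. \<exists>\<phi> \<psi> f g. smooth_form U \<phi> \<and> smooth_form U \<psi> \<and> smooth_on U f \<and> smooth_on U g \<and>
         (\<forall>x\<in>U. \<Theta> x = \<phi> x \<^bold>\<and> \<omega> 1 x + \<psi> x \<^bold>\<and> \<omega> 2 x
                  + f x *\<^sub>R (\<omega> 3 x \<^bold>\<and> \<omega> 4 x) + g x *\<^sub>R (\<omega> 5 x \<^bold>\<and> \<omega> 6 x))})"

definition one_adapted ::
  "pt set \<Rightarrow> coframe \<Rightarrow> real \<Rightarrow> real \<Rightarrow> (pt \<Rightarrow> real) \<Rightarrow> (pt \<Rightarrow> real) \<Rightarrow> bool" where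
  "one_adapted U \<omega> \<epsilon>\<^sub>1 \<epsilon>\<^sub>2 A\<^sub>1 A\<^sub>4 \<longleftrightarrow>
     coframing U \<omega> \<and> \<epsilon>\<^sub>1 \<in> {1, -1} \<and> \<epsilon>\<^sub>2 \<in> {1, -1} \<and> smooth_on U A\<^sub>1 \<and> smooth_on U A\<^sub>4 \<and>
     (\<exists>(\<alpha> :: nat \<Rightarrow> form1) (\<beta> :: nat \<Rightarrow> form1) (B :: nat \<Rightarrow> pt \<Rightarrow> real) (C :: nat \<Rightarrow> pt \<Rightarrow> real).
        (\<forall>i\<in>{0..3}. smooth_form U (\<alpha> i) \<and> smooth_form U (\<beta> i)) \<and>
        (\<forall>i\<in>{1..4}. smooth_on U (B i) \<and> smooth_on U (C i)) \<and>
        (\<forall>x\<in>U.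
          d1 (\<omega> 1) x = - (\<beta> 0 x \<^bold>\<and> \<omega> 1 x)
              + A\<^sub>1 x *\<^sub>R ((\<omega> 3 x - C 1 x *\<^sub>R \<omega> 1 x) \<^bold>\<and> (\<omega> 4 x - C 2 x *\<^sub>R \<omega> 1 x))
              + \<omega> 5 x \<^bold>\<and> \<omega> 6 x \<and>
          d1 (\<omega> 2) x = - (\<alpha> 0 x \<^bold>\<and> \<omega> 2 x) + \<omega> 3 x \<^bold>\<and> \<omega> 4 x
              + A\<^sub>4 x *\<^sub>R ((\<omega> 5 x - C 3 x *\<^sub>R \<omega> 2 x) \<^bold>\<and> (\<omega> 6 x - C 4 x *\<^sub>R \<omega> 2 x)) \<and>
          d1 (\<omega> 3) x = - (\<alpha> 1 x \<^bold>\<and> \<omega> 3 x) - \<alpha> 2 x \<^bold>\<and> \<omega> 4 x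
              + B 1 x *\<^sub>R (\<omega> 1 x \<^bold>\<and> \<omega> 2 x) + C 1 x *\<^sub>R (\<omega> 5 x \<^bold>\<and> \<omega> 6 x) \<and>
          d1 (\<omega> 4) x = - (\<alpha> 3 x \<^bold>\<and> \<omega> 3 x) - (\<alpha> 0 x - \<alpha> 1 x) \<^bold>\<and> \<omega> 4 x
              + B 2 x *\<^sub>R (\<omega> 1 x \<^bold>\<and> \<omega> 2 x) + C 2 x *\<^sub>R (\<omega> 5 x \<^bold>\<and> \<omega> 6 x) \<and>
          d1 (\<omega> 5) x = - (\<beta> 1 x \<^bold>\<and> \<omega> 5 x) - \<beta> 2 x \<^bold>\<and> \<omega> 6 x
              + B 3 x *\<^sub>R (\<omega> 1 x \<^bold>\<and> \<omega> 2 x) + C 3 x *\<^sub>R (\<omega> 3 x \<^bold>\<and> \<omega> 4 x) \<and>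
          d1 (\<omega> 6) x = - (\<beta> 3 x \<^bold>\<and> \<omega> 5 x) - (\<beta> 0 x - \<beta> 1 x) \<^bold>\<and> \<omega> 6 x
              + B 4 x *\<^sub>R (\<omega> 1 x \<^bold>\<and> \<omega> 2 x) + C 4 x *\<^sub>R (\<omega> 3 x \<^bold>\<and> \<omega> 4 x) \<and>
          B 1 x = \<epsilon>\<^sub>1 \<and> C 1 x = 0 \<and> B 2 x = 0 \<and> C 2 x = 1 \<and>
          B 3 x = \<epsilon>\<^sub>2 \<and> C 3 x = 0 \<and> B 4 x = 0 \<and> C 4 x = 1))"

text \<open>
  A generic rank-1 Baecklund transformation \<open>(U, \<B>)\<close> together with its canonical 1-adapted
  coframing \<open>\<omega>\<close>; the coframing determines \<open>\<B>\<close>.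
\<close>

definition generic_backlund ::
  "pt set \<Rightarrow> eds \<Rightarrow> coframe \<Rightarrow> real \<Rightarrow> real \<Rightarrow> (pt \<Rightarrow> real) \<Rightarrow> (pt \<Rightarrow> real) \<Rightarrow> bool" where
  "generic_backlund U \<B> \<omega> \<epsilon>\<^sub>1 \<epsilon>\<^sub>2 A\<^sub>1 A\<^sub>4 \<longleftrightarrow>
     \<B> = backlund_ideal U \<omega> \<and> one_adapted U \<omega> \<epsilon>\<^sub>1 \<epsilon>\<^sub>2 A\<^sub>1 A\<^sub>4"


section \<open>Structure equations with free derivatives\<close>

text \<open>
  The dimensions \<open>s\<close> and \<open>r\<close> of the spaces of invariants and of free derivatives are part of the
  data, so \<open>\<real>\<^sup>n\<close> is realised as the set of sequences vanishing from index \<open>n\<close> on.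
\<close>

definition Rn :: "nat \<Rightarrow> (nat \<Rightarrow> real) set" where
  "Rn n = {z. \<forall>i\<ge>n. z i = 0}"

definition real_analytic :: "nat \<Rightarrow> ((nat \<Rightarrow> real) \<Rightarrow> real) \<Rightarrow> bool" where
  "real_analytic n f \<longleftrightarrow>
     (\<forall>p\<in>Rn n. \<exists>e>0. \<exists>c :: (nat \<Rightarrow> nat) \<Rightarrow> real. \<forall>z\<in>Rn n. (\<forall>i<n. \<bar>z i - p i\<bar> < e) \<longrightarrow>
        ((\<lambda>m. c m * (\<Prod>i<n. (z i - p i) ^ m i)) has_sum f z) {m. \<forall>i\<ge>n. m i = 0})"

definition pderiv_at :: "((nat \<Rightarrow> real) \<Rightarrow> real) \<Rightarrow> nat \<Rightarrow> (nat \<Rightarrow> real) \<Rightarrow> real" where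
  "pderiv_at f i z = deriv (\<lambda>t. f (z(i := t))) (z i)"

text \<open>
  The equations are \<open>d\<omega>\<^sup>i = -1/2 C\<^sup>i\<^sub>j\<^sub>k(a) \<omega>\<^sup>j\<and>\<omega>\<^sup>k\<close> and \<open>da\<^sup>\<alpha> = F\<^sup>\<alpha>\<^sub>i(a,b) \<omega>\<^sup>i\<close>, with
  \<open>C\<^sup>i\<^sub>j\<^sub>k(a)\<close> written \<open>Tor a i j k\<close> and \<open>F\<^sup>\<alpha>\<^sub>i(a,b)\<close> written \<open>Fun a b \<alpha> i\<close>.
\<close>

record str_eqs =
  ninv :: nat
  nfree :: nat
  Tor :: "(nat \<Rightarrow> real) \<Rightarrow> 6 \<Rightarrow> 6 \<Rightarrow> 6 \<Rightarrow> real"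
  Fun :: "(nat \<Rightarrow> real) \<Rightarrow> (nat \<Rightarrow> real) \<Rightarrow> nat \<Rightarrow> 6 \<Rightarrow> real"

definition analytic_eqs :: "str_eqs \<Rightarrow> bool" where
  "analytic_eqs \<Sigma> \<longleftrightarrow>
     (\<forall>i j k. real_analytic (ninv \<Sigma>) (\<lambda>a. Tor \<Sigma> a i j k)) \<and>
     (\<forall>\<alpha><ninv \<Sigma>. \<forall>i. real_analytic (ninv \<Sigma> + nfree \<Sigma>)
        (\<lambda>z. Fun \<Sigma> (\<lambda>n. if n < ninv \<Sigma> then z n else 0) (\<lambda>n. z (ninv \<Sigma> + n)) \<alpha> i))"

definition skew_eqs :: "str_eqs \<Rightarrow> bool" where
  "skew_eqs \<Sigma> \<longleftrightarrow> (\<forall>a\<in>Rn (ninv \<Sigma>). \<forall>i j k. Tor \<Sigma> a i j k = - Tor \<Sigma> a i k j)"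

definition solution ::
  "str_eqs \<Rightarrow> pt set \<Rightarrow> coframe \<Rightarrow> (pt \<Rightarrow> nat \<Rightarrow> real) \<Rightarrow> (pt \<Rightarrow> nat \<Rightarrow> real) \<Rightarrow> bool" where
  "solution \<Sigma> U \<omega> a b \<longleftrightarrow>
     coframing U \<omega> \<and>
     (\<forall>n. smooth_on U (\<lambda>x. a x n) \<and> smooth_on U (\<lambda>x. b x n)) \<and>
     (\<forall>x\<in>U. a x \<in> Rn (ninv \<Sigma>) \<and> b x \<in> Rn (nfree \<Sigma>) \<and>
        (\<forall>i. d1 (\<omega> i) x =
           - ((1/2) *\<^sub>R (\<Sum>j\<in>UNIV. \<Sum>k\<in>UNIV. Tor \<Sigma> (a x) i j k *\<^sub>R (\<omega> j x \<^bold>\<and> \<omega> k x)))) \<and>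
        (\<forall>\<alpha><ninv \<Sigma>. d0 (\<lambda>y. a y \<alpha>) x = (\<Sum>i\<in>UNIV. Fun \<Sigma> (a x) (b x) \<alpha> i *\<^sub>R \<omega> i x)))"

text \<open>
  The functions \<open>a\<close> are invariants, and the functions \<open>b\<close> their derivatives, only if the coframing
  determines them; otherwise redundant parameters could be used to change the count.
\<close>

definition invariants_determined :: "str_eqs \<Rightarrow> bool" where
  "invariants_determined \<Sigma> \<longleftrightarrow>
     (\<forall>U \<omega> a b a' b'. solution \<Sigma> U \<omega> a b \<longrightarrow> solution \<Sigma> U \<omega> a' b' \<longrightarrow>
        (\<forall>x\<in>U. a x = a' x \<and> b x = b' x))"

text \<open>
  Expanding \<open>d(C\<^sup>i\<^sub>j\<^sub>k \<omega>\<^sup>j\<and>\<omega>\<^sup>k)\<close> and replacing \<open>da\<close> and \<open>d\<omega>\<close> by the structure equations gives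
  \<open>(\<partial>\<^sub>\<alpha>C\<^sup>i\<^sub>j\<^sub>k F\<^sup>\<alpha>\<^sub>l - C\<^sup>i\<^sub>m\<^sub>k C\<^sup>m\<^sub>l\<^sub>j) \<omega>\<^sup>l\<and>\<omega>\<^sup>j\<and>\<omega>\<^sup>k\<close>.
  As \<open>C\<close> is skew in its lower indices, this vanishes iff the cyclic sums of the bracket do.
\<close>

definition ddomega_term ::
  "str_eqs \<Rightarrow> (nat \<Rightarrow> real) \<Rightarrow> (nat \<Rightarrow> real) \<Rightarrow> 6 \<Rightarrow> 6 \<Rightarrow> 6 \<Rightarrow> 6 \<Rightarrow> real" where
  "ddomega_term \<Sigma> a b i l j k =
     (\<Sum>\<alpha><ninv \<Sigma>. pderiv_at (\<lambda>a. Tor \<Sigma> a i j k) \<alpha> a * Fun \<Sigma> a b \<alpha> l)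
     - (\<Sum>m\<in>UNIV. Tor \<Sigma> a i m k * Tor \<Sigma> a m l j)"

definition ddomega_vanishes :: "str_eqs \<Rightarrow> bool" where
  "ddomega_vanishes \<Sigma> \<longleftrightarrow>
     (\<forall>a\<in>Rn (ninv \<Sigma>). \<forall>b\<in>Rn (nfree \<Sigma>). \<forall>i l j k.
        ddomega_term \<Sigma> a b i l j k + ddomega_term \<Sigma> a b i j k l + ddomega_term \<Sigma> a b i k l j = 0)"

text \<open>
  The coefficient of \<open>\<omega>\<^sup>j\<close> in \<open>d(F\<^sup>\<alpha>\<^sub>k(a,b))\<close> after replacing \<open>da\<^sup>\<gamma>\<close> by \<open>F\<^sup>\<gamma>\<^sub>j \<omega>\<^sup>j\<close> and \<open>db\<^sup>\<rho>\<close> by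
  \<open>g\<^sup>\<rho>\<^sub>j \<omega>\<^sup>j\<close>.
\<close>

definition total_deriv ::
  "str_eqs \<Rightarrow> (nat \<Rightarrow> 6 \<Rightarrow> real) \<Rightarrow> (nat \<Rightarrow> real) \<Rightarrow> (nat \<Rightarrow> real) \<Rightarrow> nat \<Rightarrow> 6 \<Rightarrow> 6 \<Rightarrow> real" where
  "total_deriv \<Sigma> g a b \<alpha> k j =
     (\<Sum>\<gamma><ninv \<Sigma>. pderiv_at (\<lambda>a. Fun \<Sigma> a b \<alpha> k) \<gamma> a * Fun \<Sigma> a b \<gamma> j)
     + (\<Sum>\<rho><nfree \<Sigma>. pderiv_at (\<lambda>b. Fun \<Sigma> a b \<alpha> k) \<rho> b * g \<rho> j)"

definition dda_vanishes :: "str_eqs \<Rightarrow> bool" where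
  "dda_vanishes \<Sigma> \<longleftrightarrow>
     (\<exists>G. \<forall>a\<in>Rn (ninv \<Sigma>). \<forall>b\<in>Rn (nfree \<Sigma>). \<forall>\<alpha><ninv \<Sigma>. \<forall>j k.
        total_deriv \<Sigma> (G a b) a b \<alpha> k j - total_deriv \<Sigma> (G a b) a b \<alpha> j k
        - (\<Sum>m\<in>UNIV. Fun \<Sigma> a b \<alpha> m * Tor \<Sigma> a m j k) = 0)"

definition cartan_eqs :: "str_eqs \<Rightarrow> bool" where
  "cartan_eqs \<Sigma> \<longleftrightarrow> analytic_eqs \<Sigma> \<and> skew_eqs \<Sigma> \<and> ddomega_vanishes \<Sigma> \<and> dda_vanishes \<Sigma> \<and>
     invariants_determined \<Sigma>"


section \<open>The tableau of free derivatives and its Cartan characters\<close>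

global_interpretation fun_space: vector_space "\<lambda>(c::real) (f :: 'i \<Rightarrow> real) i. c * f i"
  by standard (auto simp: fun_eq_iff algebra_simps)

text \<open>An element of \<open>Hom(\<real>\<^sup>6, \<real>\<^sup>s)\<close> is given by its matrix entries, indexed by \<open>(\<alpha>, i)\<close>.\<close>

definition tableau ::
  "str_eqs \<Rightarrow> (nat \<Rightarrow> real) \<Rightarrow> (nat \<Rightarrow> real) \<Rightarrow> (nat \<times> 6 \<Rightarrow> real) set" where
  "tableau \<Sigma> a b = fun_space.span
     {(\<lambda>(\<alpha>, i). if \<alpha> < ninv \<Sigma> then pderiv_at (\<lambda>b. Fun \<Sigma> a b \<alpha> i) \<rho> b else 0) | \<rho>. \<rho> < nfree \<Sigma>}"

text \<open>Restriction of a homomorphism to the span of \<open>v 0, \<dots>, v (k-1)\<close>.\<close>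

definition restrict_hom ::
  "nat \<Rightarrow> (nat \<Rightarrow> real^6) \<Rightarrow> (nat \<times> 6 \<Rightarrow> real) \<Rightarrow> (nat \<times> nat \<Rightarrow> real)" where
  "restrict_hom k v \<pi> = (\<lambda>(\<alpha>, m). if m < k then \<Sum>i\<in>UNIV. \<pi> (\<alpha>, i) * v m $ i else 0)"

text \<open>
  The dimension \<open>s\<^sub>1 + \<dots> + s\<^sub>k\<close> of the restriction of the tableau to the \<open>k\<close>-th member of a
  generic flag is the largest one occurring for \<open>k\<close> vectors.
\<close>

definition char_sum :: "(nat \<times> 6 \<Rightarrow> real) set \<Rightarrow> nat \<Rightarrow> nat" where
  "char_sum T k = Max {fun_space.dim (restrict_hom k v ` T) | v. True}"

definition cartan_char :: "(nat \<times> 6 \<Rightarrow> real) set \<Rightarrow> nat \<Rightarrow> nat" where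
  "cartan_char T k = char_sum T k - char_sum T (k - 1)"

definition prolongation :: "(nat \<times> 6 \<Rightarrow> real) set \<Rightarrow> (nat \<times> 6 \<times> 6 \<Rightarrow> real) set" where
  "prolongation T =
     {P. (\<forall>\<alpha> i j. P (\<alpha>, i, j) = P (\<alpha>, j, i)) \<and> (\<forall>j. (\<lambda>(\<alpha>, i). P (\<alpha>, i, j)) \<in> T)}"

definition involutive :: "(nat \<times> 6 \<Rightarrow> real) set \<Rightarrow> bool" where
  "involutive T \<longleftrightarrow> fun_space.dim (prolongation T) = (\<Sum>j=1..6. j * cartan_char T j)"

definition involutive_eqs :: "str_eqs \<Rightarrow> bool" where
  "involutive_eqs \<Sigma> \<longleftrightarrow> cartan_eqs \<Sigma> \<and>
     (\<forall>a\<in>Rn (ninv \<Sigma>). \<forall>b\<in>Rn (nfree \<Sigma>). involutive (tableau \<Sigma> a b))"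

text \<open>The last nonzero character is \<open>s\<^sub>k = q\<close>: the solutions depend on \<open>q\<close> functions of \<open>k\<close> variables.\<close>

definition generality :: "str_eqs \<Rightarrow> nat \<Rightarrow> nat \<Rightarrow> bool" where
  "generality \<Sigma> q k \<longleftrightarrow> 1 \<le> k \<and> k \<le> 6 \<and> 0 < q \<and>
     (\<forall>a\<in>Rn (ninv \<Sigma>). \<forall>b\<in>Rn (nfree \<Sigma>).
        cartan_char (tableau \<Sigma> a b) k = q \<and> (\<forall>j\<in>{k<..6}. cartan_char (tableau \<Sigma> a b) j = 0))"

text \<open>
  The solutions depend on fewer than \<open>q\<close> functions of \<open>k\<close> variables, or only on functions of fewer
  variables, or (all characters zero) only on constants.
\<close>

definition lower_generality :: "str_eqs \<Rightarrow> nat \<Rightarrow> nat \<Rightarrow> bool" where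
  "lower_generality \<Sigma> q k \<longleftrightarrow>
     (\<forall>a\<in>Rn (ninv \<Sigma>). \<forall>b\<in>Rn (nfree \<Sigma>).
        cartan_char (tableau \<Sigma> a b) k < q \<and> (\<forall>j\<in>{k<..6}. cartan_char (tableau \<Sigma> a b) j = 0))"

text \<open>
  A class \<open>K\<close> of coframings is locally determined by \<open>q\<close> functions of \<open>k\<close> variables if its members
  are exactly the coframings that locally satisfy one of finitely many involutive systems of structure
  equations, one of which, \<open>\<Sigma>\<close>, has \<open>s\<^sub>k = q\<close> as last nonzero character.  The remaining systems \<open>E\<close>
  account for exceptional members: imposing \<open>d\<^sup>2 = 0\<close> on a class can lead to algebraic alternatives,
  i.e. to several components.  They are required to be of strictly lower generality, so that they
  do not contribute to the count.
\<close>

definition locally_determined_by :: "(pt set \<Rightarrow> coframe \<Rightarrow> bool) \<Rightarrow> nat \<Rightarrow> nat \<Rightarrow> bool" where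
  "locally_determined_by K q k \<longleftrightarrow>
     (\<exists>\<Sigma> E. involutive_eqs \<Sigma> \<and> generality \<Sigma> q k \<and>
        finite E \<and> (\<forall>\<Sigma>'\<in>E. involutive_eqs \<Sigma>' \<and> lower_generality \<Sigma>' q k) \<and>
        (\<forall>U \<omega>. K U \<omega> \<longleftrightarrow>
           (\<forall>x\<in>U. \<exists>V. open V \<and> x \<in> V \<and> V \<subseteq> U \<and>
              (\<exists>\<Sigma>'\<in>insert \<Sigma> E. \<exists>a b. solution \<Sigma>' V \<omega> a b))))"

end

theory Submission
  imports Defs
begin

text \<open>
  Let \<open>X\<close> be the frame dual to an adapted coframing \<open>\<omega>\<close> of the class.  Everything is expressed by the
  structure functions \<open>d\<omega>\<^sup>i(X\<^sub>j, X\<^sub>k)\<close> and by derivatives along \<open>X\<close>.  The identity \<open>d\<^sup>2\<omega>\<^sup>i = 0\<close> is the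
  Jacobi identity for \<open>X\<close> (lemma \<open>bianchi\<close>).  It gives 120 equations, which are linear in the
  derivatives of the components of the forms \<open>\<alpha>\<^sub>i, \<beta>\<^sub>i\<close> and quadratic in the components.

  Combinations in which the derivatives cancel are conditions on the components themselves.  Those
  that are found in this way are differentiated and used to find more of them (\<open>first_reduction\<close>,
  \<open>second_reduction\<close>, \<open>tau_vanishes\<close>, \<open>a_eq_b\<close>).  After the indeterminacy of the forms has been
  normalised away (\<open>gauge\<close>), only four functions \<open>p, q, r, s\<close> are left:

    \<^item> \<open>\<alpha>\<^sub>0 = - (p+q)/2 \<omega>\<^sup>1 + (p-q)/2 \<omega>\<^sup>2 - \<omega>\<^sup>3 + p/2 \<omega>\<^sup>4 + q/2 \<omega>\<^sup>6\<close> and \<open>\<beta>\<^sub>0 = \<alpha>\<^sub>0 + \<omega>\<^sup>3 + \<omega>\<^sup>5\<close>,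
    \<^item> \<open>\<alpha>\<^sub>1 = q \<omega>\<^sup>6\<close>, \<open>\<alpha>\<^sub>2 = - \<omega>\<^sup>1 - \<omega>\<^sup>2 + p \<omega>\<^sup>5 + r \<omega>\<^sup>6\<close>, \<open>\<alpha>\<^sub>3 = s (\<omega>\<^sup>1 + \<omega>\<^sup>2) - \<omega>\<^sup>4 - \<omega>\<^sup>6\<close>,
    \<^item> \<open>\<beta>\<^sub>1 = p \<omega>\<^sup>4\<close>, \<open>\<beta>\<^sub>2 = \<omega>\<^sup>1 - \<omega>\<^sup>2 + q \<omega>\<^sup>3 + r \<omega>\<^sup>4\<close>, \<open>\<beta>\<^sub>3 = - s (\<omega>\<^sup>1 - \<omega>\<^sup>2) - \<omega>\<^sup>4 + \<omega>\<^sup>6\<close>.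

  The remaining equations (\<open>invariants_derivatives\<close>) are \<open>s p = s q = 0\<close>, \<open>ds = 0\<close>, formulas for \<open>dp\<close>
  and \<open>dq\<close>, and a formula for \<open>dr\<close> in which only the coefficients \<open>u, v\<close> of \<open>\<omega>\<^sup>4, \<omega>\<^sup>6\<close> are free.  Since
  \<open>s\<close> is locally constant, the alternative \<open>s = 0\<close> or \<open>s \<noteq> 0\<close> is decided near each point.

  If \<open>s = 0\<close>, then \<open>p, q, r\<close> are invariants with free derivatives \<open>u, v\<close>, and the equations are
  compatible with \<open>d\<^sup>2 = 0\<close> (\<open>integrability\<close>, \<open>gen_dda\<close>).  The tableau consists of the homomorphisms
  into the line of \<open>r\<close> that factor through \<open>(\<omega>\<^sup>4, \<omega>\<^sup>6)\<close>.  One vector detects one parameter and two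
  vectors detect both, so \<open>s\<^sub>1 = s\<^sub>2 = 1\<close>; the first prolongation is the space of quadratic forms in two
  variables, and its dimension is \<open>3 = s\<^sub>1 + 2 s\<^sub>2\<close>.  This is the one function of two variables.

  If \<open>s \<noteq> 0\<close>, then \<open>p = q = 0\<close> and \<open>r s = 1\<close>, so that all structure functions are constant.  Writing
  \<open>s = \<plusminus> e\<^sup>a\<close> yields two systems with one constant invariant \<open>a\<close> and no free derivatives; they contribute
  the exceptional coframings, which depend on a constant only.

  Conversely, the structure functions of a solution of any of these systems have the form above, and
  \<open>p, q, r, s\<close> are among them (\<open>redc_entries\<close>).  Hence the invariants are determined by the
  coframing, and the local connection forms fit together to smooth forms on the whole domain
  (\<open>solution_imp_adapted\<close>).
\<close>

section \<open>Smooth functions on open sets\<close>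

lemma partial_eqI:
  assumes "(f has_derivative f') (at x)"
  shows "partial j f x = f' (axis j 1)"
  using frechet_derivative_at[OF assms] by (simp add: partial_def)

lemma has_derivative_local_cong:
  fixes f g :: "pt \<Rightarrow> real"
  assumes "open U" "x \<in> U" "\<And>y. y \<in> U \<Longrightarrow> f y = g y"
  shows "(f has_derivative f') (at x) \<longleftrightarrow> (g has_derivative f') (at x)"
  using has_derivative_transform_within_open[of f f' x UNIV U g]
    has_derivative_transform_within_open[of g f' x UNIV U f] assms by auto

lemma differentiable_local_cong:
  fixes f g :: "pt \<Rightarrow> real"
  assumes "open U" "x \<in> U" "\<And>y. y \<in> U \<Longrightarrow> f y = g y"
  shows "f differentiable (at x) \<longleftrightarrow> g differentiable (at x)"
  using has_derivative_local_cong[OF assms] by (simp add: differentiable_def)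

lemma partial_local_cong:
  fixes f g :: "pt \<Rightarrow> real"
  assumes "open U" "x \<in> U" "\<And>y. y \<in> U \<Longrightarrow> f y = g y"
  shows "partial j f x = partial j g x"
  using has_derivative_local_cong[OF assms] by (simp add: partial_def frechet_derivative_def)

lemma Ck_on_cong:
  assumes "open U" "\<And>y. y \<in> U \<Longrightarrow> f y = g y"
  shows "Ck_on n U f \<longleftrightarrow> Ck_on n U g"
  using assms
proof (induction n arbitrary: f g)
  case 0
  then show ?case using continuous_on_cong by force
next
  case (Suc n)
  have "Ck_on n U (partial j f) \<longleftrightarrow> Ck_on n U (partial j g)" for j
    using Suc.IH[of "partial j f" "partial j g"] Suc.prems partial_local_cong[of U _ f g j] by auto
  moreover have "f differentiable (at x) \<longleftrightarrow> g differentiable (at x)" if "x \<in> U" for x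
    using differentiable_local_cong[of U x f g] Suc.prems that by auto
  ultimately show ?case by auto
qed

lemma smooth_on_cong:
  assumes "open U" "\<And>y. y \<in> U \<Longrightarrow> f y = g y"
  shows "smooth_on U f \<longleftrightarrow> smooth_on U g"
  using Ck_on_cong[OF assms] by (simp add: smooth_on_def)

lemma Ck_on_SucD: "Ck_on (Suc n) U f \<Longrightarrow> Ck_on n U f"
proof (induction n arbitrary: f)
  case 0
  then have "f differentiable (at x)" if "x \<in> U" for x using that by simp
  then show ?case
    by (auto intro!: continuous_at_imp_continuous_on differentiable_imp_continuous_within)
next
  case (Suc n)
  then show ?case by (metis Ck_on.simps(2))
qed

lemma Ck_on_const: "Ck_on n U (\<lambda>x. c)"
proof (induction n arbitrary: c)
  case (Suc n)
  have "partial j (\<lambda>x. c) = (\<lambda>x. 0)" for j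
    by (rule ext) (simp add: partial_eqI[OF has_derivative_const])
  then show ?case using Suc[of 0] by auto
qed simp

lemma has_derivative_frechet:
  "f differentiable (at x) \<Longrightarrow> (f has_derivative frechet_derivative f (at x)) (at x)"
  by (simp add: frechet_derivative_works)

lemma partial_const: "partial j (\<lambda>x. c) x = 0"
  by (simp add: partial_eqI[OF has_derivative_const])

lemma partial_add:
  assumes "f differentiable (at x)" "g differentiable (at x)"
  shows "partial j (\<lambda>x. f x + g x) x = partial j f x + partial j g x"
  using partial_eqI[OF has_derivative_add[OF has_derivative_frechet[OF assms(1)]
        has_derivative_frechet[OF assms(2)]]] by (simp add: partial_def)

lemma partial_mult:
  fixes f g :: "pt \<Rightarrow> real"
  assumes "f differentiable (at x)" "g differentiable (at x)"
  shows "partial j (\<lambda>x. f x * g x) x = partial j f x * g x + f x * partial j g x"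
  using partial_eqI[OF has_derivative_mult[OF has_derivative_frechet[OF assms(1)]
        has_derivative_frechet[OF assms(2)]]] by (simp add: partial_def)

lemma partial_inverse:
  fixes f :: "pt \<Rightarrow> real"
  assumes "f differentiable (at x)" "f x \<noteq> 0"
  shows "partial j (\<lambda>x. inverse (f x)) x = - 1 * (partial j f x * (inverse (f x) * inverse (f x)))"
  using partial_eqI[OF Deriv.has_derivative_inverse[OF assms(2) has_derivative_frechet[OF assms(1)]]]
  by (simp add: partial_def)

lemma Ck_on_add:
  assumes "open U" "Ck_on n U f" "Ck_on n U g"
  shows "Ck_on n U (\<lambda>x. f x + g x)"
  using assms(2-)
proof (induction n arbitrary: f g)
  case 0 then show ?case by (auto intro: continuous_on_add)
next
  case (Suc n)
  have "Ck_on n U (partial j (\<lambda>x. f x + g x))" for j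
  proof (subst Ck_on_cong[OF assms(1)])
    show "partial j (\<lambda>x. f x + g x) y = partial j f y + partial j g y" if "y \<in> U" for y
      using Suc.prems that by (intro partial_add) auto
  qed (use Suc in auto)
  then show ?case using Suc.prems by (auto intro: differentiable_add)
qed

lemma Ck_on_mult:
  assumes "open U" "Ck_on n U f" "Ck_on n U g"
  shows "Ck_on n U (\<lambda>x. f x * g x)"
  using assms(2-)
proof (induction n arbitrary: f g)
  case 0 then show ?case by (auto intro: continuous_on_mult)
next
  case (Suc n)
  have "Ck_on n U (partial j (\<lambda>x. f x * g x))" for j
  proof (subst Ck_on_cong[OF assms(1)])
    show "partial j (\<lambda>x. f x * g x) y = partial j f y * g y + f y * partial j g y" if "y \<in> U" for y
      using Suc.prems that by (intro partial_mult) auto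
    have "Ck_on n U (\<lambda>x. partial j f x * g x)" "Ck_on n U (\<lambda>x. f x * partial j g x)"
      using Suc.prems Ck_on_SucD[OF Suc.prems(1)] Ck_on_SucD[OF Suc.prems(2)]
      by (auto intro!: Suc.IH)
    then show "Ck_on n U (\<lambda>y. partial j f y * g y + f y * partial j g y)"
      by (rule Ck_on_add[OF assms(1)])
  qed
  then show ?case using Suc.prems by (auto intro: differentiable_mult)
qed

lemma Ck_on_inverse:
  assumes "open U" "Ck_on n U f" "\<And>x. x \<in> U \<Longrightarrow> f x \<noteq> 0"
  shows "Ck_on n U (\<lambda>x. inverse (f x))"
  using assms(2)
proof (induction n)
  case 0 then show ?case using assms(3) by (auto intro: continuous_on_inverse)
next
  case (Suc n)
  have "Ck_on n U (partial j (\<lambda>x. inverse (f x)))" for j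
  proof (subst Ck_on_cong[OF assms(1)])
    show "partial j (\<lambda>x. inverse (f x)) y = - 1 * (partial j f y * (inverse (f y) * inverse (f y)))"
      if "y \<in> U" for y
      using Suc.prems that assms(3) by (intro partial_inverse) auto
    have "Ck_on n U (\<lambda>x. inverse (f x))"
      by (rule Suc.IH[OF Ck_on_SucD[OF Suc.prems]])
    then show "Ck_on n U (\<lambda>y. - 1 * (partial j f y * (inverse (f y) * inverse (f y))))"
      using Suc.prems by (intro Ck_on_mult[OF assms(1)] Ck_on_const) auto
  qed
  then show ?case using Suc.prems assms(3) by (auto intro: differentiable_inverse)
qed

lemma smooth_on_const: "smooth_on U (\<lambda>x. c)"
  by (simp add: smooth_on_def Ck_on_const)

lemma smooth_on_add: "open U \<Longrightarrow> smooth_on U f \<Longrightarrow> smooth_on U g \<Longrightarrow> smooth_on U (\<lambda>x. f x + g x)"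
  by (simp add: smooth_on_def Ck_on_add)

lemma smooth_on_mult: "open U \<Longrightarrow> smooth_on U f \<Longrightarrow> smooth_on U g \<Longrightarrow> smooth_on U (\<lambda>x. f x * g x)"
  by (simp add: smooth_on_def Ck_on_mult)

lemma smooth_on_minus: "open U \<Longrightarrow> smooth_on U f \<Longrightarrow> smooth_on U (\<lambda>x. - f x)"
  using smooth_on_mult[OF _ smooth_on_const[of U "-1"]] by simp

lemma smooth_on_diff:
  "open U \<Longrightarrow> smooth_on U f \<Longrightarrow> smooth_on U g \<Longrightarrow> smooth_on U (\<lambda>x. f x - g x)"
  using smooth_on_add[OF _ _ smooth_on_minus] by simp

lemma smooth_on_divide:
  "open U \<Longrightarrow> smooth_on U f \<Longrightarrow> smooth_on U g \<Longrightarrow> (\<And>x. x \<in> U \<Longrightarrow> g x \<noteq> 0)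
    \<Longrightarrow> smooth_on U (\<lambda>x. f x / g x)"
  unfolding divide_inverse by (rule smooth_on_mult) (auto simp: smooth_on_def Ck_on_inverse)

lemma smooth_on_sum:
  "open U \<Longrightarrow> (\<And>i. i \<in> I \<Longrightarrow> smooth_on U (f i)) \<Longrightarrow> smooth_on U (\<lambda>x. \<Sum>i\<in>I. f i x)"
  by (induction I rule: infinite_finite_induct) (auto simp: smooth_on_const smooth_on_add)

lemma smooth_on_prod:
  "open U \<Longrightarrow> (\<And>i. i \<in> I \<Longrightarrow> smooth_on U (f i)) \<Longrightarrow> smooth_on U (\<lambda>x. \<Prod>i\<in>I. f i x)"
  by (induction I rule: infinite_finite_induct) (auto simp: smooth_on_const smooth_on_mult)

lemmas smooth_on_intros =
  smooth_on_const smooth_on_add smooth_on_mult smooth_on_minus smooth_on_diff smooth_on_sum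
  smooth_on_prod

lemma smooth_on_partial: "smooth_on U f \<Longrightarrow> smooth_on U (partial j f)"
  unfolding smooth_on_def by (metis Ck_on.simps(2))

lemma smooth_on_differentiable: "smooth_on U f \<Longrightarrow> x \<in> U \<Longrightarrow> f differentiable (at x)"
  unfolding smooth_on_def by (metis Ck_on.simps(2))

lemma smooth_on_continuous: "smooth_on U f \<Longrightarrow> continuous_on U f"
  unfolding smooth_on_def by (metis Ck_on.simps(1))

lemma smooth_on_subset:
  assumes "V \<subseteq> U" "smooth_on U f"
  shows "smooth_on V f"
proof -
  have "Ck_on n V g" if "Ck_on n U g" for n g
    using that
    by (induction n arbitrary: g) (use assms(1) in \<open>auto intro: continuous_on_subset\<close>)
  then show ?thesis using assms(2) by (simp add: smooth_on_def)
qed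

lemma smooth_on_locally:
  assumes "\<And>x. x \<in> U \<Longrightarrow> \<exists>V. open V \<and> x \<in> V \<and> smooth_on V f"
  shows "smooth_on U f"
proof -
  \<comment> \<open>With the order fixed and the neighbourhoods arbitrary, the claim passes to partial derivatives.\<close>
  have "Ck_on n U g" if "\<And>x. x \<in> U \<Longrightarrow> \<exists>V. open V \<and> x \<in> V \<and> Ck_on n V g" for n g
    using that
  proof (induction n arbitrary: g)
    case 0
    have "isCont g x" if "x \<in> U" for x
      using 0[OF that] by (auto simp: continuous_on_eq_continuous_at)
    then show ?case by (simp add: continuous_at_imp_continuous_on)
  next
    case (Suc n)
    have "Ck_on n U (partial j g)" for j
      by (rule Suc.IH) (use Suc.prems in fastforce)
    then show ?case using Suc.prems by fastforce
  qed
  moreover have "\<exists>V. open V \<and> x \<in> V \<and> Ck_on n V f" if "x \<in> U" for n x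
    using assms[OF that] by (auto simp: smooth_on_def)
  ultimately show ?thesis unfolding smooth_on_def by blast
qed

lemma DERIV_along_axis:
  fixes f :: "pt \<Rightarrow> real"
  assumes "f differentiable (at (y + t *\<^sub>R axis i 1))"
  shows "((\<lambda>s. f (y + s *\<^sub>R axis i 1)) has_real_derivative partial i f (y + t *\<^sub>R axis i 1)) (at t)"
proof -
  let ?f' = "frechet_derivative f (at (y + t *\<^sub>R axis i 1))"
  have 1: "((\<lambda>s. y + s *\<^sub>R axis i 1) has_derivative (\<lambda>s. s *\<^sub>R axis i 1)) (at t)"
    by (auto intro!: derivative_eq_intros)
  have 2: "(f has_derivative ?f') (at (y + t *\<^sub>R axis i 1))"
    using has_derivative_frechet[OF assms] .
  have "((\<lambda>s. f (y + s *\<^sub>R axis i 1)) has_derivative (\<lambda>s. ?f' (s *\<^sub>R axis i 1))) (at t)"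
    by (rule has_derivative_compose[OF 1 2])
  moreover have "?f' (s *\<^sub>R axis i 1) = s * partial i f (y + t *\<^sub>R axis i 1)" for s
    using linear_scale[OF has_derivative_linear[OF 2]] by (simp add: partial_def)
  moreover have "(\<lambda>s. s * partial i f (y + t *\<^sub>R axis i 1)) = (*) (partial i f (y + t *\<^sub>R axis i 1))"
    by (simp add: fun_eq_iff)
  ultimately show ?thesis by (simp add: has_field_derivative_def)
qed

text \<open>
  Two applications of the mean value theorem express the second difference quotient of \<open>f\<close> on a
  small square by \<open>\<partial>\<^sub>j\<partial>\<^sub>i f\<close> at a point of the square.  The quotient is symmetric in the two
  directions, so the two mixed derivatives take equal values at points arbitrarily close to \<open>x\<close>.
\<close>

lemma second_difference_mvt:
  fixes f :: "pt \<Rightarrow> real"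
  assumes "0 < h" "ball x (2 * h + e) \<subseteq> U" "0 < e" "smooth_on U f"
  shows "\<exists>y\<in>ball x (2 * h + e).
    f (x + h *\<^sub>R axis i 1 + h *\<^sub>R axis j 1) - f (x + h *\<^sub>R axis i 1)
      - f (x + h *\<^sub>R axis j 1) + f x = h * h * partial j (partial i f) y"
proof -
  have inU: "x + s *\<^sub>R axis i 1 + t *\<^sub>R axis j 1 \<in> ball x (2 * h + e)"
    if "0 \<le> s" "s \<le> h" "0 \<le> t" "t \<le> h" for s t
  proof -
    have "norm (s *\<^sub>R axis i 1 + t *\<^sub>R axis j 1 :: pt) \<le> s + t"
      using norm_triangle_ineq[of "s *\<^sub>R axis i 1 :: pt" "t *\<^sub>R axis j 1"] that by simp
    then have "norm (s *\<^sub>R axis i 1 + t *\<^sub>R axis j 1 :: pt) < 2 * h + e"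
      using that assms by linarith
    then have "dist (x + (s *\<^sub>R axis i 1 + t *\<^sub>R axis j 1)) x < 2 * h + e"
      unfolding dist_norm by (metis add_diff_cancel_left')
    then show ?thesis by (simp add: dist_commute add.assoc)
  qed
  define \<phi> where "\<phi> s = f (x + h *\<^sub>R axis j 1 + s *\<^sub>R axis i 1) - f (x + s *\<^sub>R axis i 1)" for s
  have "(\<phi> has_real_derivative partial i f (x + h *\<^sub>R axis j 1 + s *\<^sub>R axis i 1)
      - partial i f (x + s *\<^sub>R axis i 1)) (at s)" if "0 \<le> s" "s \<le> h" for s
    unfolding \<phi>_def
  proof (intro DERIV_diff DERIV_along_axis smooth_on_differentiable[OF assms(4)])
    show "x + h *\<^sub>R axis j 1 + s *\<^sub>R axis i 1 \<in> U" "x + s *\<^sub>R axis i 1 \<in> U"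
      using inU[OF that, of h] inU[OF that, of 0] assms by (auto simp: add_ac)
  qed
  from MVT2[OF assms(1) this] obtain \<xi> where \<xi>: "0 < \<xi>" "\<xi> < h"
    "\<phi> h - \<phi> 0 = h * (partial i f (x + h *\<^sub>R axis j 1 + \<xi> *\<^sub>R axis i 1)
      - partial i f (x + \<xi> *\<^sub>R axis i 1))" by auto
  have "((\<lambda>t. partial i f (x + \<xi> *\<^sub>R axis i 1 + t *\<^sub>R axis j 1)) has_real_derivative
      partial j (partial i f) (x + \<xi> *\<^sub>R axis i 1 + t *\<^sub>R axis j 1)) (at t)"
    if "0 \<le> t" "t \<le> h" for t
  proof (intro DERIV_along_axis smooth_on_differentiable[OF smooth_on_partial[OF assms(4)]])
    show "x + \<xi> *\<^sub>R axis i 1 + t *\<^sub>R axis j 1 \<in> U"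
      using inU[of \<xi> t] \<xi> that assms by auto
  qed
  from MVT2[OF assms(1) this] obtain \<eta> where \<eta>: "0 < \<eta>" "\<eta> < h"
    "partial i f (x + \<xi> *\<^sub>R axis i 1 + h *\<^sub>R axis j 1) - partial i f (x + \<xi> *\<^sub>R axis i 1)
      = h * partial j (partial i f) (x + \<xi> *\<^sub>R axis i 1 + \<eta> *\<^sub>R axis j 1)" by auto
  show ?thesis
  proof
    show "x + \<xi> *\<^sub>R axis i 1 + \<eta> *\<^sub>R axis j 1 \<in> ball x (2 * h + e)"
      using inU \<xi> \<eta> by auto
    show "f (x + h *\<^sub>R axis i 1 + h *\<^sub>R axis j 1) - f (x + h *\<^sub>R axis i 1)
      - f (x + h *\<^sub>R axis j 1) + f x
      = h * h * partial j (partial i f) (x + \<xi> *\<^sub>R axis i 1 + \<eta> *\<^sub>R axis j 1)"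
      using \<xi>(3) \<eta>(3) by (simp add: \<phi>_def add_ac)
  qed
qed

lemma partial_commute:
  assumes "open U" "smooth_on U f" "x \<in> U"
  shows "partial i (partial j f) x = partial j (partial i f) x"
proof (rule ccontr)
  let ?F = "partial i (partial j f)" and ?G = "partial j (partial i f)"
  assume "?F x \<noteq> ?G x"
  define \<epsilon> where "\<epsilon> = \<bar>?F x - ?G x\<bar> / 2"
  have \<epsilon>: "0 < \<epsilon>" using \<open>?F x \<noteq> ?G x\<close> by (simp add: \<epsilon>_def)
  have "isCont ?F x" "isCont ?G x"
    using assms smooth_on_continuous[OF smooth_on_partial[OF smooth_on_partial[OF assms(2)]]]
    by (auto simp: continuous_on_eq_continuous_at)
  then obtain d1 d2 where d: "0 < d1" "\<And>y. dist y x < d1 \<Longrightarrow> dist (?F y) (?F x) < \<epsilon>"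
      "0 < d2" "\<And>y. dist y x < d2 \<Longrightarrow> dist (?G y) (?G x) < \<epsilon>"
    using \<epsilon> unfolding continuous_at_eps_delta by (metis dist_norm real_norm_def)
  obtain d3 where d3: "0 < d3" "ball x d3 \<subseteq> U" using assms openE by blast
  define h where "h = min d1 (min d2 d3) / 3"
  have h: "0 < h" "2 * h + h \<le> d1" "2 * h + h \<le> d2" "2 * h + h \<le> d3"
    using d d3 by (auto simp: h_def)
  then have b: "ball x (2 * h + h) \<subseteq> U" using d3 subset_ball by (meson order_trans)
  obtain y where y: "y \<in> ball x (2 * h + h)" "f (x + h *\<^sub>R axis j 1 + h *\<^sub>R axis i 1)
      - f (x + h *\<^sub>R axis j 1) - f (x + h *\<^sub>R axis i 1) + f x = h * h * ?F y"
    using second_difference_mvt[OF h(1) b h(1) assms(2), of j i] by auto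
  obtain z where z: "z \<in> ball x (2 * h + h)" "f (x + h *\<^sub>R axis i 1 + h *\<^sub>R axis j 1)
      - f (x + h *\<^sub>R axis i 1) - f (x + h *\<^sub>R axis j 1) + f x = h * h * ?G z"
    using second_difference_mvt[OF h(1) b h(1) assms(2), of i j] by auto
  have eq: "x + h *\<^sub>R axis j 1 + h *\<^sub>R axis i 1 = x + h *\<^sub>R axis i 1 + h *\<^sub>R axis j 1"
    by (simp add: add_ac)
  have "h * h * ?F y = h * h * ?G z" using y(2) z(2) unfolding eq by linarith
  then have "?F y = ?G z" using h(1) by simp
  moreover have "dist y x < d1" "dist z x < d2"
    using y(1) z(1) h(2,3) by (auto simp: dist_commute)
  then have "dist (?F y) (?F x) < \<epsilon>" "dist (?G z) (?G x) < \<epsilon>"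
    using d by auto
  moreover have "\<bar>?F x - ?G x\<bar> = 2 * \<epsilon>" by (simp add: \<epsilon>_def)
  ultimately show False unfolding dist_real_def by (simp add: abs_if split: if_splits)
qed

section \<open>The dual frame\<close>

definition dual :: "coframe \<Rightarrow> 6 \<Rightarrow> pt \<Rightarrow> real^6" where
  "dual \<omega> k x = (\<chi> m. matrix_inv (\<chi> i. \<omega> i x) $ m $ k)"

definition fder :: "coframe \<Rightarrow> 6 \<Rightarrow> (pt \<Rightarrow> real) \<Rightarrow> pt \<Rightarrow> real" where
  "fder \<omega> l f x = (\<Sum>m\<in>UNIV. partial m f x * dual \<omega> l x $ m)"

definition ev2 :: "real^6^6 \<Rightarrow> real^6 \<Rightarrow> real^6 \<Rightarrow> real" where
  "ev2 \<Theta> u v = (\<Sum>m\<in>UNIV. \<Sum>n\<in>UNIV. \<Theta> $ m $ n * u $ m * v $ n)"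

text \<open>
  The structure functions \<open>d\<omega>\<^sup>i(X\<^sub>j, X\<^sub>k)\<close> of a coframing with dual frame \<open>X\<close>.  They equal
  \<open>- C\<^sup>i\<^sub>j\<^sub>k\<close> in the convention \<open>d\<omega>\<^sup>i = -1/2 C\<^sup>i\<^sub>j\<^sub>k \<omega>\<^sup>j\<and>\<omega>\<^sup>k\<close>.
\<close>

definition strf :: "coframe \<Rightarrow> 6 \<Rightarrow> 6 \<Rightarrow> 6 \<Rightarrow> pt \<Rightarrow> real" where
  "strf \<omega> i j k x = ev2 (d1 (\<omega> i) x) (dual \<omega> j x) (dual \<omega> k x)"

lemma coframing_open: "coframing U \<omega> \<Longrightarrow> open U"
  and coframing_smooth: "coframing U \<omega> \<Longrightarrow> smooth_on U (\<lambda>x. \<omega> i x $ j)"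
  and coframing_det: "coframing U \<omega> \<Longrightarrow> x \<in> U \<Longrightarrow> det (\<chi> i. \<omega> i x) \<noteq> 0"
  by (auto simp: coframing_def smooth_form_def)

lemma coframe_matrix_inv:
  assumes "coframing U \<omega>" "x \<in> U"
  shows "(\<chi> i. \<omega> i x) ** matrix_inv (\<chi> i. \<omega> i x) = mat 1"
    and "matrix_inv (\<chi> i. \<omega> i x) ** (\<chi> i. \<omega> i x) = mat 1"
proof -
  have "\<exists>B. (\<chi> i. \<omega> i x) ** B = mat 1 \<and> B ** (\<chi> i. \<omega> i x) = mat 1"
    using coframing_det[OF assms] unfolding invertible_det_nz[symmetric] invertible_def .
  then have "(\<chi> i. \<omega> i x) ** matrix_inv (\<chi> i. \<omega> i x) = mat 1
      \<and> matrix_inv (\<chi> i. \<omega> i x) ** (\<chi> i. \<omega> i x) = mat 1"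
    unfolding matrix_inv_def by (rule someI_ex)
  then show "(\<chi> i. \<omega> i x) ** matrix_inv (\<chi> i. \<omega> i x) = mat 1"
    "matrix_inv (\<chi> i. \<omega> i x) ** (\<chi> i. \<omega> i x) = mat 1" by auto
qed

lemma coframe_dual:
  assumes "coframing U \<omega>" "x \<in> U"
  shows "(\<Sum>m\<in>UNIV. \<omega> i x $ m * dual \<omega> k x $ m) = (if i = k then 1 else 0)"
  using arg_cong[OF coframe_matrix_inv(1)[OF assms], of "\<lambda>A. A $ i $ k"]
  by (simp add: matrix_matrix_mult_def mat_def dual_def)

lemma dual_coframe:
  assumes "coframing U \<omega>" "x \<in> U"
  shows "(\<Sum>k\<in>UNIV. dual \<omega> k x $ m * \<omega> k x $ n) = (if m = n then 1 else 0)"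
  using arg_cong[OF coframe_matrix_inv(2)[OF assms], of "\<lambda>A. A $ m $ n"]
  by (simp add: matrix_matrix_mult_def mat_def dual_def)

text \<open>
  By Cramer's rule the dual frame is a quotient of determinants of coframe components.
\<close>

lemma smooth_on_dual:
  assumes "coframing U \<omega>"
  shows "smooth_on U (\<lambda>x. dual \<omega> k x $ m)"
proof -
  note U = coframing_open[OF assms]
  let ?A = "\<lambda>x. (\<chi> i. \<omega> i x) :: real^6^6"
  let ?B = "\<lambda>x. (\<chi> i j. if j = m then axis k 1 $ i else \<omega> i x $ j) :: real^6^6"
  have eq: "dual \<omega> k x $ m = det (?B x) / det (?A x)" if "x \<in> U" for x
  proof -
    have "?A x *v dual \<omega> k x = axis k 1"
      using coframe_dual[OF assms that]
      by (auto simp: vec_eq_iff matrix_vector_mult_def axis_def)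
    then have "dual \<omega> k x
        = (\<chi> n. det (\<chi> i j. if j = n then axis k 1 $ i else ?A x $ i $ j) / det (?A x))"
      using cramer[OF coframing_det[OF assms that]] by blast
    then have "dual \<omega> k x $ m
        = det (\<chi> i j. if j = m then axis k 1 $ i else ?A x $ i $ j) / det (?A x)" by simp
    also have "(\<chi> i j. if j = m then axis k 1 $ i else ?A x $ i $ j) = ?B x"
      by (simp add: vec_eq_iff)
    finally show ?thesis .
  qed
  have "smooth_on U (\<lambda>x. if j = m then axis k (1::real) $ i else \<omega> i x $ j)" for i j
    using coframing_smooth[OF assms] by (cases "j = m") (auto intro: smooth_on_const)
  then have "smooth_on U (\<lambda>x. det (?B x))" "smooth_on U (\<lambda>x. det (?A x))"
    unfolding det_def using coframing_smooth[OF assms]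
    by (auto intro!: smooth_on_intros U)
  then have "smooth_on U (\<lambda>x. det (?B x) / det (?A x))"
    using coframing_det[OF assms] by (intro smooth_on_divide U) auto
  then show ?thesis using smooth_on_cong[OF U eq] by simp
qed

lemma smooth_on_fder:
  assumes "coframing U \<omega>" "smooth_on U f"
  shows "smooth_on U (fder \<omega> l f)"
  unfolding fder_def
  by (intro smooth_on_intros coframing_open[OF assms(1)] smooth_on_partial assms smooth_on_dual)

lemma smooth_on_strf:
  assumes "coframing U \<omega>"
  shows "smooth_on U (strf \<omega> i j k)"
  unfolding strf_def ev2_def d1_def
  using coframing_smooth[OF assms] smooth_on_dual[OF assms]
  by (auto intro!: smooth_on_intros coframing_open[OF assms] smooth_on_partial)

lemma smooth_on_component:
  assumes "coframing U \<omega>" "smooth_form U \<theta>"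
  shows "smooth_on U (\<lambda>x. \<theta> x \<bullet> dual \<omega> j x)"
  unfolding inner_vec_def inner_real_def using assms(2) smooth_on_dual[OF assms(1)]
  by (auto intro!: smooth_on_intros coframing_open[OF assms(1)] simp: smooth_form_def)

lemma coframe_inner_dual:
  assumes "coframing U \<omega>" "x \<in> U"
  shows "\<omega> i x \<bullet> dual \<omega> k x = (if i = k then 1 else 0)"
  using coframe_dual[OF assms] by (simp add: inner_vec_def)

lemma covector_expansion:
  assumes "coframing U \<omega>" "x \<in> U"
  shows "v = (\<Sum>k\<in>UNIV. (v \<bullet> dual \<omega> k x) *\<^sub>R \<omega> k x)"
proof (subst vec_eq_iff, intro allI)
  fix n
  have "(\<Sum>k\<in>UNIV. (v \<bullet> dual \<omega> k x) *\<^sub>R \<omega> k x) $ n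
      = (\<Sum>k\<in>UNIV. \<Sum>m\<in>UNIV. v $ m * (dual \<omega> k x $ m * \<omega> k x $ n))"
    by (simp add: inner_vec_def sum_distrib_right mult.assoc)
  also have "\<dots> = (\<Sum>m\<in>UNIV. v $ m * (\<Sum>k\<in>UNIV. dual \<omega> k x $ m * \<omega> k x $ n))"
    by (subst sum.swap) (simp add: sum_distrib_left)
  also have "\<dots> = v $ n"
    unfolding dual_coframe[OF assms] by (simp add: if_distrib cong: if_cong)
  finally show "v $ n = (\<Sum>k\<in>UNIV. (v \<bullet> dual \<omega> k x) *\<^sub>R \<omega> k x) $ n" by simp
qed

lemma covector_eqI:
  assumes "coframing U \<omega>" "x \<in> U"
    "\<And>k. v \<bullet> dual \<omega> k x = w \<bullet> dual \<omega> k x"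
  shows "v = w"
  using covector_expansion[OF assms(1,2), of v] covector_expansion[OF assms(1,2), of w] assms(3)
  by simp

lemma ev2_linear:
  "ev2 (\<Theta> + \<Theta>') u v = ev2 \<Theta> u v + ev2 \<Theta>' u v"
  "ev2 (\<Theta> - \<Theta>') u v = ev2 \<Theta> u v - ev2 \<Theta>' u v"
  "ev2 (- \<Theta>) u v = - ev2 \<Theta> u v"
  "ev2 (c *\<^sub>R \<Theta>) u v = c * ev2 \<Theta> u v"
  by (simp_all add: ev2_def sum.distrib sum_subtractf sum_negf sum_distrib_left algebra_simps)

lemma ev2_sum: "ev2 (\<Sum>a\<in>A. \<Theta> a) u v = (\<Sum>a\<in>A. ev2 (\<Theta> a) u v)"
proof (induction A rule: infinite_finite_induct)
  case (insert a A)
  then show ?case by (simp add: ev2_linear)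
qed (simp_all add: ev2_def)

lemma ev2_wedge: "ev2 (\<theta> \<^bold>\<and> \<phi>) u v = (\<theta> \<bullet> u) * (\<phi> \<bullet> v) - (\<theta> \<bullet> v) * (\<phi> \<bullet> u)"
proof -
  have "ev2 (\<theta> \<^bold>\<and> \<phi>) u v = (\<Sum>m\<in>UNIV. \<Sum>n\<in>UNIV. (\<theta> $ m * u $ m) * (\<phi> $ n * v $ n))
      - (\<Sum>m\<in>UNIV. \<Sum>n\<in>UNIV. (\<phi> $ m * u $ m) * (\<theta> $ n * v $ n))"
    by (simp add: ev2_def wedge_def sum_subtractf algebra_simps)
  then show ?thesis by (simp add: inner_vec_def flip: sum_product)
qed

text \<open>
  The vectors of the dual frame span the tangent space, so a 2-form is known from its values on
  them.
\<close>

lemma ev2_eqI: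
  assumes "coframing U \<omega>" "x \<in> U"
    and eq: "\<And>j k. ev2 \<Theta> (dual \<omega> j x) (dual \<omega> k x) = ev2 \<Theta>' (dual \<omega> j x) (dual \<omega> k x)"
  shows "\<Theta> = \<Theta>'"
proof -
  have expand: "\<Theta> $ a $ b
      = (\<Sum>j\<in>UNIV. \<Sum>k\<in>UNIV. ev2 \<Theta> (dual \<omega> j x) (dual \<omega> k x) * \<omega> j x $ a * \<omega> k x $ b)"
    for \<Theta> :: "real^6^6" and a b
  proof -
    have "(\<Sum>j\<in>UNIV. \<Sum>k\<in>UNIV. ev2 \<Theta> (dual \<omega> j x) (dual \<omega> k x) * \<omega> j x $ a * \<omega> k x $ b)
      = (\<Sum>j\<in>UNIV. \<Sum>k\<in>UNIV. \<Sum>m\<in>UNIV. \<Sum>n\<in>UNIV.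
          \<Theta> $ m $ n * (dual \<omega> j x $ m * \<omega> j x $ a) * (dual \<omega> k x $ n * \<omega> k x $ b))"
      by (simp add: ev2_def sum_distrib_left sum_distrib_right mult_ac)
    also have "\<dots> = (\<Sum>j\<in>UNIV. \<Sum>m\<in>UNIV. \<Sum>n\<in>UNIV. \<Sum>k\<in>UNIV.
          \<Theta> $ m $ n * (dual \<omega> j x $ m * \<omega> j x $ a) * (dual \<omega> k x $ n * \<omega> k x $ b))"
      by (subst (2) sum.swap, subst (3) sum.swap) simp
    also have "\<dots> = (\<Sum>j\<in>UNIV. \<Sum>m\<in>UNIV. \<Sum>n\<in>UNIV.
          \<Theta> $ m $ n * (dual \<omega> j x $ m * \<omega> j x $ a) * (if n = b then 1 else 0))"
      using dual_coframe[OF assms(1,2)] by (simp flip: sum_distrib_left)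
    also have "\<dots> = (\<Sum>j\<in>UNIV. \<Sum>m\<in>UNIV. \<Theta> $ m $ b * (dual \<omega> j x $ m * \<omega> j x $ a))"
      by (simp add: if_distrib cong: if_cong)
    also have "\<dots> = (\<Sum>m\<in>UNIV. \<Theta> $ m $ b * (if m = a then 1 else 0))"
      using dual_coframe[OF assms(1,2)] by (subst sum.swap) (simp flip: sum_distrib_left)
    also have "\<dots> = \<Theta> $ a $ b"
      by (simp add: if_distrib cong: if_cong)
    finally show ?thesis by simp
  qed
  show ?thesis
    unfolding vec_eq_iff by (intro allI) (subst (1 2) expand, simp add: eq)
qed

lemma fder_local_cong:
  assumes "open U" "x \<in> U" "\<And>y. y \<in> U \<Longrightarrow> f y = g y"
  shows "fder \<omega> l f x = fder \<omega> l g x"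
  unfolding fder_def using partial_local_cong[OF assms] by simp

lemma fder_const: "fder \<omega> l (\<lambda>x. c) x = 0"
  by (simp add: fder_def partial_const)

lemma fder_add:
  assumes "smooth_on U f" "smooth_on U g" "x \<in> U"
  shows "fder \<omega> l (\<lambda>x. f x + g x) x = fder \<omega> l f x + fder \<omega> l g x"
  using assms smooth_on_differentiable
  by (simp add: fder_def partial_add sum.distrib distrib_right)

lemma fder_mult:
  assumes "smooth_on U f" "smooth_on U g" "x \<in> U"
  shows "fder \<omega> l (\<lambda>x. f x * g x) x = fder \<omega> l f x * g x + f x * fder \<omega> l g x"
proof -
  have "fder \<omega> l (\<lambda>x. f x * g x) x
      = (\<Sum>m\<in>UNIV. (partial m f x * g x + f x * partial m g x) * dual \<omega> l x $ m)"
    using assms smooth_on_differentiable by (simp add: fder_def partial_mult)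
  then show ?thesis
    by (simp add: fder_def sum.distrib sum_distrib_left sum_distrib_right algebra_simps)
qed

lemma fder_cmult: "smooth_on U f \<Longrightarrow> x \<in> U \<Longrightarrow> fder \<omega> l (\<lambda>x. c * f x) x = c * fder \<omega> l f x"
  using fder_mult[OF smooth_on_const, of U f x \<omega> l c] by (simp add: fder_const)

lemma fder_sum:
  assumes "open U" "\<And>i. i \<in> I \<Longrightarrow> smooth_on U (f i)" "x \<in> U"
  shows "fder \<omega> l (\<lambda>x. \<Sum>i\<in>I. f i x) x = (\<Sum>i\<in>I. fder \<omega> l (f i) x)"
  using assms(2)
proof (induction I rule: infinite_finite_induct)
  case (insert i I)
  have "fder \<omega> l (\<lambda>x. f i x + (\<Sum>i\<in>I. f i x)) x = fder \<omega> l (f i) x + fder \<omega> l (\<lambda>x. \<Sum>i\<in>I. f i x) x"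
    using insert.prems by (intro fder_add[of U] smooth_on_sum assms(1,3)) auto
  then show ?case using insert by simp
qed (simp_all add: fder_const)

lemma fder_eq_inner: "fder \<omega> l f x = d0 f x \<bullet> dual \<omega> l x"
  by (simp add: fder_def d0_def inner_vec_def)

lemma partial_eq_fder:
  assumes "coframing U \<omega>" "x \<in> U"
  shows "partial m f x = (\<Sum>l\<in>UNIV. fder \<omega> l f x * \<omega> l x $ m)"
  using arg_cong[OF covector_expansion[OF assms, of "d0 f x"], of "\<lambda>v. v $ m"]
  by (simp add: fder_eq_inner d0_def)

section \<open>Brackets of the dual frame and the Bianchi identity\<close>

lemma vector_expansion:
  assumes "coframing U \<omega>" "x \<in> U"
  shows "w n = (\<Sum>i\<in>UNIV. (\<Sum>m\<in>UNIV. \<omega> i x $ m * w m) * dual \<omega> i x $ n)"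
proof -
  have "(\<Sum>i\<in>UNIV. (\<Sum>m\<in>UNIV. \<omega> i x $ m * w m) * dual \<omega> i x $ n)
      = (\<Sum>m\<in>UNIV. w m * (\<Sum>i\<in>UNIV. dual \<omega> i x $ n * \<omega> i x $ m))"
    by (simp add: sum_distrib_left sum_distrib_right mult_ac) (rule sum.swap)
  then show ?thesis
    unfolding dual_coframe[OF assms] by (simp add: if_distrib cong: if_cong)
qed

lemma dual_independent:
  assumes "coframing U \<omega>" "x \<in> U" "\<And>n. (\<Sum>i\<in>UNIV. c i * dual \<omega> i x $ n) = 0"
  shows "c k = 0"
proof -
  have "0 = (\<Sum>n\<in>UNIV. \<omega> k x $ n * (\<Sum>i\<in>UNIV. c i * dual \<omega> i x $ n))"
    using assms(3) by simp
  also have "\<dots> = (\<Sum>i\<in>UNIV. c i * (\<Sum>n\<in>UNIV. \<omega> k x $ n * dual \<omega> i x $ n))"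
    by (simp add: sum_distrib_left mult_ac) (rule sum.swap)
  also have "\<dots> = c k"
    unfolding coframe_dual[OF assms(1,2)] by (simp add: if_distrib cong: if_cong)
  finally show ?thesis by simp
qed

lemma strf_eq_fder:
  "strf \<omega> i j k x = (\<Sum>n\<in>UNIV. fder \<omega> j (\<lambda>x. \<omega> i x $ n) x * dual \<omega> k x $ n)
     - (\<Sum>n\<in>UNIV. fder \<omega> k (\<lambda>x. \<omega> i x $ n) x * dual \<omega> j x $ n)"
proof -
  have "strf \<omega> i j k x
    = (\<Sum>m\<in>UNIV. \<Sum>n\<in>UNIV. partial m (\<lambda>x. \<omega> i x $ n) x * dual \<omega> j x $ m * dual \<omega> k x $ n)
      - (\<Sum>m\<in>UNIV. \<Sum>n\<in>UNIV. partial n (\<lambda>x. \<omega> i x $ m) x * dual \<omega> j x $ m * dual \<omega> k x $ n)"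
    by (simp add: strf_def ev2_def d1_def left_diff_distrib sum_subtractf)
  also have "(\<Sum>m\<in>UNIV. \<Sum>n\<in>UNIV. partial m (\<lambda>x. \<omega> i x $ n) x * dual \<omega> j x $ m * dual \<omega> k x $ n)
    = (\<Sum>n\<in>UNIV. fder \<omega> j (\<lambda>x. \<omega> i x $ n) x * dual \<omega> k x $ n)"
    by (subst sum.swap) (simp add: fder_def sum_distrib_right)
  also have "(\<Sum>m\<in>UNIV. \<Sum>n\<in>UNIV. partial n (\<lambda>x. \<omega> i x $ m) x * dual \<omega> j x $ m * dual \<omega> k x $ n)
    = (\<Sum>n\<in>UNIV. fder \<omega> k (\<lambda>x. \<omega> i x $ n) x * dual \<omega> j x $ n)"
    by (simp add: fder_def sum_distrib_left sum_distrib_right mult_ac)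
  finally show ?thesis .
qed

text \<open>
  The structure functions are the bracket coefficients of the dual frame: differentiate
  \<open>\<omega>\<^sup>i(X\<^sub>k) = \<delta>\<^sub>i\<^sub>k\<close> along \<open>X\<^sub>j\<close> and antisymmetrise.
\<close>

lemma dual_bracket:
  assumes "coframing U \<omega>" "x \<in> U"
  shows "fder \<omega> j (\<lambda>x. dual \<omega> k x $ n) x - fder \<omega> k (\<lambda>x. dual \<omega> j x $ n) x
    = - (\<Sum>i\<in>UNIV. strf \<omega> i j k x * dual \<omega> i x $ n)"
proof -
  note U = coframing_open[OF assms(1)]
  have leibniz: "(\<Sum>n\<in>UNIV. \<omega> i x $ n * fder \<omega> j (\<lambda>x. dual \<omega> k x $ n) x)
      = - (\<Sum>n\<in>UNIV. fder \<omega> j (\<lambda>x. \<omega> i x $ n) x * dual \<omega> k x $ n)" for i j k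
  proof -
    have "0 = fder \<omega> j (\<lambda>x. if i = k then 1 else 0) x" by (simp add: fder_const)
    also have "\<dots> = fder \<omega> j (\<lambda>x. \<Sum>n\<in>UNIV. \<omega> i x $ n * dual \<omega> k x $ n) x"
      by (rule fder_local_cong[OF U assms(2)]) (use coframe_dual[OF assms(1)] in auto)
    also have "\<dots> = (\<Sum>n\<in>UNIV. fder \<omega> j (\<lambda>x. \<omega> i x $ n * dual \<omega> k x $ n) x)"
      by (intro fder_sum[OF U] assms smooth_on_mult U coframing_smooth[OF assms(1)]
          smooth_on_dual[OF assms(1)])
    also have "\<dots> = (\<Sum>n\<in>UNIV. fder \<omega> j (\<lambda>x. \<omega> i x $ n) x * dual \<omega> k x $ n
        + \<omega> i x $ n * fder \<omega> j (\<lambda>x. dual \<omega> k x $ n) x)"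
      by (intro sum.cong refl fder_mult[of U] coframing_smooth[OF assms(1)]
          smooth_on_dual[OF assms(1)] assms)
    finally show ?thesis by (simp add: sum.distrib)
  qed
  have "(\<Sum>n\<in>UNIV. \<omega> i x $ n * (fder \<omega> j (\<lambda>x. dual \<omega> k x $ n) x - fder \<omega> k (\<lambda>x. dual \<omega> j x $ n) x))
      = - strf \<omega> i j k x" for i
    by (simp add: right_diff_distrib sum_subtractf leibniz strf_eq_fder)
  then show ?thesis
    by (subst vector_expansion[OF assms,
          of "\<lambda>n. fder \<omega> j (\<lambda>x. dual \<omega> k x $ n) x - fder \<omega> k (\<lambda>x. dual \<omega> j x $ n) x"])
      (simp add: sum_negf)
qed

text \<open>
  The symmetric second partial derivatives of \<open>f\<close> cancel in the commutator; what is left is the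
  first derivative of \<open>f\<close> along the brackets.
\<close>

lemma fder_commutator:
  assumes "coframing U \<omega>" "smooth_on U f" "x \<in> U"
  shows "fder \<omega> j (fder \<omega> k f) x - fder \<omega> k (fder \<omega> j f) x
    = - (\<Sum>i\<in>UNIV. strf \<omega> i j k x * fder \<omega> i f x)"
proof -
  note U = coframing_open[OF assms(1)]
  have expand: "fder \<omega> j (fder \<omega> k f) x
      = (\<Sum>n\<in>UNIV. \<Sum>m\<in>UNIV. partial m (partial n f) x * dual \<omega> j x $ m * dual \<omega> k x $ n)
        + (\<Sum>n\<in>UNIV. partial n f x * fder \<omega> j (\<lambda>x. dual \<omega> k x $ n) x)" for j k
  proof -
    have "fder \<omega> j (fder \<omega> k f) x = fder \<omega> j (\<lambda>x. \<Sum>n\<in>UNIV. partial n f x * dual \<omega> k x $ n) x"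
      by (rule arg_cong[where f = "\<lambda>g. fder \<omega> j g x"]) (simp add: fun_eq_iff fder_def)
    also have "\<dots> = (\<Sum>n\<in>UNIV. fder \<omega> j (\<lambda>x. partial n f x * dual \<omega> k x $ n) x)"
      by (intro fder_sum[OF U] assms smooth_on_mult U smooth_on_partial smooth_on_dual[OF assms(1)])
    also have "\<dots> = (\<Sum>n\<in>UNIV. fder \<omega> j (partial n f) x * dual \<omega> k x $ n
        + partial n f x * fder \<omega> j (\<lambda>x. dual \<omega> k x $ n) x)"
      by (intro sum.cong refl fder_mult[of U] smooth_on_partial smooth_on_dual[OF assms(1)] assms)
    also have "\<dots> = (\<Sum>n\<in>UNIV. fder \<omega> j (partial n f) x * dual \<omega> k x $ n)
        + (\<Sum>n\<in>UNIV. partial n f x * fder \<omega> j (\<lambda>x. dual \<omega> k x $ n) x)"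
      by (rule sum.distrib)
    finally show ?thesis by (simp add: fder_def sum_distrib_right)
  qed
  have "(\<Sum>n\<in>UNIV. \<Sum>m\<in>UNIV. partial m (partial n f) x * dual \<omega> k x $ m * dual \<omega> j x $ n)
      = (\<Sum>n\<in>UNIV. \<Sum>m\<in>UNIV. partial m (partial n f) x * dual \<omega> j x $ m * dual \<omega> k x $ n)"
    using partial_commute[OF U assms(2,3)] by (subst sum.swap) (simp add: mult_ac)
  then have "fder \<omega> j (fder \<omega> k f) x - fder \<omega> k (fder \<omega> j f) x
      = (\<Sum>n\<in>UNIV. partial n f x
          * (fder \<omega> j (\<lambda>x. dual \<omega> k x $ n) x - fder \<omega> k (\<lambda>x. dual \<omega> j x $ n) x))"
    by (simp add: expand[of j k] expand[of k j] right_diff_distrib sum_subtractf)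
  also have "\<dots> = - (\<Sum>n\<in>UNIV. \<Sum>i\<in>UNIV. strf \<omega> i j k x * (partial n f x * dual \<omega> i x $ n))"
    unfolding dual_bracket[OF assms(1,3)] by (simp add: sum_distrib_left sum_negf mult_ac)
  also have "\<dots> = - (\<Sum>i\<in>UNIV. strf \<omega> i j k x * fder \<omega> i f x)"
    by (subst sum.swap) (simp add: fder_def sum_distrib_left)
  finally show ?thesis .
qed

text \<open>
  The identity \<open>d\<^sup>2\<omega>\<^sup>i = 0\<close> in terms of structure functions.  It is the Jacobi identity for the dual
  frame, obtained by applying the commutator formula to the components of the dual frame itself:
  the cyclic sum of the double commutators is evaluated once by commutators of derivations and once
  by differentiating the bracket coefficients.
\<close>

lemma bianchi:
  assumes "coframing U \<omega>" "x \<in> U"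
  defines "J \<equiv> \<lambda>i l j k. fder \<omega> l (strf \<omega> i j k) x
      + (\<Sum>m\<in>UNIV. strf \<omega> m l j x * strf \<omega> i m k x)"
  shows "J i l j k + J i j k l + J i k l j = 0"
proof -
  note U = coframing_open[OF assms(1)]
  have "(\<Sum>i\<in>UNIV. (J i l j k + J i j k l + J i k l j) * dual \<omega> i x $ n) = 0" for n
  proof -
    \<comment> \<open>A fixed component of the dual frame, to which the frame derivatives are applied.\<close>
    define X where "X k = (\<lambda>x. dual \<omega> k x $ n)" for k
    define D where "D m k = fder \<omega> m (X k) x" for m k
    define DD where "DD l j k = fder \<omega> l (fder \<omega> j (X k)) x" for l j k
    have sX: "smooth_on U (X k)" for k
      unfolding X_def by (rule smooth_on_dual[OF assms(1)])
    have comm: "DD l j k - DD j l k = - (\<Sum>m\<in>UNIV. strf \<omega> m l j x * D m k)" for l j k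
      unfolding DD_def D_def by (rule fder_commutator[OF assms(1) sX assms(2)])
    have brk: "fder \<omega> j (X k) y - fder \<omega> k (X j) y
        = - (\<Sum>i\<in>UNIV. strf \<omega> i j k y * X i y)" if "y \<in> U" for j k y
      unfolding X_def by (rule dual_bracket[OF assms(1) that])
    have dbrk: "DD l j k - DD l k j
        = - (\<Sum>i\<in>UNIV. fder \<omega> l (strf \<omega> i j k) x * X i x) - (\<Sum>i\<in>UNIV. strf \<omega> i j k x * D l i)"
      for l j k
    proof -
      have sm: "smooth_on U (\<lambda>y. strf \<omega> i j k y * X i y)" for i
        by (intro smooth_on_mult U smooth_on_strf assms sX)
      have "DD l j k + fder \<omega> l (\<lambda>y. \<Sum>i\<in>UNIV. strf \<omega> i j k y * X i y) x
          = fder \<omega> l (\<lambda>y. fder \<omega> j (X k) y + (\<Sum>i\<in>UNIV. strf \<omega> i j k y * X i y)) x"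
        unfolding DD_def
        by (intro fder_add[symmetric, of U] smooth_on_fder assms sX smooth_on_sum U sm)
      also have "\<dots> = DD l k j"
        unfolding DD_def
      proof (rule fder_local_cong[OF U assms(2)])
        show "fder \<omega> j (X k) y + (\<Sum>i\<in>UNIV. strf \<omega> i j k y * X i y) = fder \<omega> k (X j) y"
          if "y \<in> U" for y
          using brk[OF that, of j k] by linarith
      qed
      finally have "DD l j k - DD l k j = - fder \<omega> l (\<lambda>y. \<Sum>i\<in>UNIV. strf \<omega> i j k y * X i y) x"
        by simp
      also have "fder \<omega> l (\<lambda>y. \<Sum>i\<in>UNIV. strf \<omega> i j k y * X i y) x
          = (\<Sum>i\<in>UNIV. fder \<omega> l (\<lambda>y. strf \<omega> i j k y * X i y) x)"
        by (intro fder_sum[OF U] sm assms)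
      also have "\<dots> = (\<Sum>i\<in>UNIV. fder \<omega> l (strf \<omega> i j k) x * X i x + strf \<omega> i j k x * D l i)"
        unfolding D_def
        by (intro sum.cong refl fder_mult[of U] smooth_on_strf assms sX)
      finally show ?thesis by (simp add: sum.distrib)
    qed
    have quad: "(\<Sum>i\<in>UNIV. (\<Sum>m\<in>UNIV. strf \<omega> m l j x * strf \<omega> i m k x) * X i x)
        = (\<Sum>m\<in>UNIV. strf \<omega> m l j x * D k m) - (\<Sum>m\<in>UNIV. strf \<omega> m l j x * D m k)" for l j k
    proof -
      have "(\<Sum>i\<in>UNIV. (\<Sum>m\<in>UNIV. strf \<omega> m l j x * strf \<omega> i m k x) * X i x)
          = (\<Sum>m\<in>UNIV. strf \<omega> m l j x * (\<Sum>i\<in>UNIV. strf \<omega> i m k x * X i x))"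
        unfolding sum_distrib_left sum_distrib_right by (subst sum.swap) (simp only: mult.assoc)
      also have "\<dots> = (\<Sum>m\<in>UNIV. strf \<omega> m l j x * (D k m - D m k))"
        unfolding D_def
      proof (intro sum.cong refl)
        show "strf \<omega> m l j x * (\<Sum>i\<in>UNIV. strf \<omega> i m k x * X i x)
            = strf \<omega> m l j x * (fder \<omega> k (X m) x - fder \<omega> m (X k) x)" for m
          using brk[OF assms(2), of m k] by simp
      qed
      finally show ?thesis by (simp add: right_diff_distrib sum_subtractf)
    qed
    have J: "(\<Sum>i\<in>UNIV. J i l j k * X i x) = (\<Sum>i\<in>UNIV. fder \<omega> l (strf \<omega> i j k) x * X i x)
        + (\<Sum>m\<in>UNIV. strf \<omega> m l j x * D k m) - (\<Sum>m\<in>UNIV. strf \<omega> m l j x * D m k)" for l j k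
      unfolding J_def distrib_right sum.distrib quad by simp
    have "(\<Sum>i\<in>UNIV. (J i l j k + J i j k l + J i k l j) * X i x) = 0"
      unfolding distrib_right sum.distrib J
      using comm[of l j k] comm[of j k l] comm[of k l j] dbrk[of l j k] dbrk[of j k l] dbrk[of k l j]
      by linarith
    then show ?thesis by (simp add: X_def)
  qed
  from dual_independent[OF assms(1,2) this] show ?thesis .
qed

section \<open>Structure functions of an adapted coframing\<close>

text \<open>
  A covector is given by its components in the coframe, so \<open>cov i\<close> is \<open>\<omega>\<^sup>i\<close>, and \<open>wdg u v j k\<close> is
  the value of \<open>u \<and> v\<close> on \<open>X\<^sub>j, X\<^sub>k\<close>.
\<close>

definition cov :: "6 \<Rightarrow> 6 \<Rightarrow> real" where
  "cov i j = (if i = j then 1 else 0)"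

definition wdg :: "(6 \<Rightarrow> real) \<Rightarrow> (6 \<Rightarrow> real) \<Rightarrow> 6 \<Rightarrow> 6 \<Rightarrow> real" where
  "wdg u v j k = u j * v k - u k * v j"

text \<open>
  The equations of an adapted coframing with \<open>A\<^sub>1 = 1\<close>, \<open>A\<^sub>4 = -1\<close>, \<open>\<epsilon>\<^sub>1 = \<epsilon>\<^sub>2 = 1\<close> say that
  \<open>d\<omega>\<^sup>i = tors i - conn \<alpha> \<beta> i\<close>: the second summand collects the terms with
  \<open>\<alpha>\<^sub>0, \<dots>, \<alpha>\<^sub>3, \<beta>\<^sub>0, \<dots>, \<beta>\<^sub>3\<close>, and the first one those without.
\<close>

definition conn :: "(nat \<Rightarrow> 6 \<Rightarrow> real) \<Rightarrow> (nat \<Rightarrow> 6 \<Rightarrow> real) \<Rightarrow> 6 \<Rightarrow> 6 \<Rightarrow> 6 \<Rightarrow> real" where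
  "conn \<alpha> \<beta> i j k =
     (if i = 1 then wdg (\<beta> 0) (cov 1) j k
      else if i = 2 then wdg (\<alpha> 0) (cov 2) j k
      else if i = 3 then wdg (\<alpha> 1) (cov 3) j k + wdg (\<alpha> 2) (cov 4) j k
      else if i = 4 then wdg (\<alpha> 3) (cov 3) j k + wdg (\<alpha> 0) (cov 4) j k - wdg (\<alpha> 1) (cov 4) j k
      else if i = 5 then wdg (\<beta> 1) (cov 5) j k + wdg (\<beta> 2) (cov 6) j k
      else wdg (\<beta> 3) (cov 5) j k + wdg (\<beta> 0) (cov 6) j k - wdg (\<beta> 1) (cov 6) j k)"

definition tors :: "6 \<Rightarrow> 6 \<Rightarrow> 6 \<Rightarrow> real" where
  "tors i j k =
     (if i = 1 then wdg (cov 3) (cov 4) j k - wdg (cov 3) (cov 1) j k + wdg (cov 5) (cov 6) j k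
      else if i = 2 then wdg (cov 3) (cov 4) j k - wdg (cov 5) (cov 6) j k + wdg (cov 5) (cov 2) j k
      else if i = 3 then wdg (cov 1) (cov 2) j k
      else if i = 4 then wdg (cov 5) (cov 6) j k
      else if i = 5 then wdg (cov 1) (cov 2) j k
      else wdg (cov 3) (cov 4) j k)"

text \<open>
  With \<open>\<epsilon> = 1\<close> these are the structure functions. Differentiation along a frame vector annihilates
  the constant part, so with \<open>\<epsilon> = 0\<close>, and with the derivatives of the components as arguments,
  these are the derivatives of the structure functions.
\<close>

definition struct ::
    "real \<Rightarrow> (nat \<Rightarrow> 6 \<Rightarrow> real) \<Rightarrow> (nat \<Rightarrow> 6 \<Rightarrow> real) \<Rightarrow> 6 \<Rightarrow> 6 \<Rightarrow> 6 \<Rightarrow> real" where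
  "struct \<epsilon> \<alpha> \<beta> i j k = \<epsilon> * tors i j k - conn \<alpha> \<beta> i j k"

text \<open>
  The Bianchi identity at a point for structure functions \<open>c\<close>, where \<open>c' l i j k\<close> is the value of
  \<open>X\<^sub>l c\<^sup>i\<^sub>j\<^sub>k\<close>.
\<close>

definition bianchi_at :: "(6 \<Rightarrow> 6 \<Rightarrow> 6 \<Rightarrow> real) \<Rightarrow> (6 \<Rightarrow> 6 \<Rightarrow> 6 \<Rightarrow> 6 \<Rightarrow> real) \<Rightarrow> 6 \<Rightarrow> 6 \<Rightarrow> 6 \<Rightarrow> 6 \<Rightarrow> bool" where
  "bianchi_at c c' i l j k \<longleftrightarrow>
     c' l i j k + c' j i k l + c' k i l j
     + (\<Sum>m\<in>UNIV. c m l j * c i m k + c m j k * c i m l + c m k l * c i m j) = 0"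

lemma UNIV_6: "(UNIV :: 6 set) = {1, 2, 3, 4, 5, 6}"
proof -
  have "x \<in> {1, 2, 3, 4, 5, 6}" for x :: 6
  proof (cases x)
    case (of_int z)
    then have "z = 0 \<or> z = 1 \<or> z = 2 \<or> z = 3 \<or> z = 4 \<or> z = 5" by (simp, presburger)
    then show ?thesis unfolding of_int by (elim disjE) simp_all
  qed
  then show ?thesis by blast
qed

lemma sum_6: "(\<Sum>m\<in>UNIV. f m) = f 1 + f 2 + f 3 + f 4 + f 5 + f (6::6)" for f :: "6 \<Rightarrow> real"
  unfolding UNIV_6 by (simp add: ac_simps)

lemma cov_table:
  "cov 1 1 = 1" "cov 1 2 = 0" "cov 1 3 = 0" "cov 1 4 = 0" "cov 1 5 = 0" "cov 1 6 = 0"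
  "cov 2 1 = 0" "cov 2 2 = 1" "cov 2 3 = 0" "cov 2 4 = 0" "cov 2 5 = 0" "cov 2 6 = 0"
  "cov 3 1 = 0" "cov 3 2 = 0" "cov 3 3 = 1" "cov 3 4 = 0" "cov 3 5 = 0" "cov 3 6 = 0"
  "cov 4 1 = 0" "cov 4 2 = 0" "cov 4 3 = 0" "cov 4 4 = 1" "cov 4 5 = 0" "cov 4 6 = 0"
  "cov 5 1 = 0" "cov 5 2 = 0" "cov 5 3 = 0" "cov 5 4 = 0" "cov 5 5 = 1" "cov 5 6 = 0"
  "cov 6 1 = 0" "cov 6 2 = 0" "cov 6 3 = 0" "cov 6 4 = 0" "cov 6 5 = 0" "cov 6 6 = 1"
  by (simp_all add: cov_def)

lemma struct_rows:
  "struct \<epsilon> \<alpha> \<beta> 1 j k = \<epsilon> * (wdg (cov 3) (cov 4) j k - wdg (cov 3) (cov 1) j k + wdg (cov 5) (cov 6) j k)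
     - wdg (\<beta> 0) (cov 1) j k"
  "struct \<epsilon> \<alpha> \<beta> 2 j k = \<epsilon> * (wdg (cov 3) (cov 4) j k - wdg (cov 5) (cov 6) j k + wdg (cov 5) (cov 2) j k)
     - wdg (\<alpha> 0) (cov 2) j k"
  "struct \<epsilon> \<alpha> \<beta> 3 j k = \<epsilon> * wdg (cov 1) (cov 2) j k - wdg (\<alpha> 1) (cov 3) j k - wdg (\<alpha> 2) (cov 4) j k"
  "struct \<epsilon> \<alpha> \<beta> 4 j k = \<epsilon> * wdg (cov 5) (cov 6) j k - wdg (\<alpha> 3) (cov 3) j k
     - wdg (\<alpha> 0) (cov 4) j k + wdg (\<alpha> 1) (cov 4) j k"
  "struct \<epsilon> \<alpha> \<beta> 5 j k = \<epsilon> * wdg (cov 1) (cov 2) j k - wdg (\<beta> 1) (cov 5) j k - wdg (\<beta> 2) (cov 6) j k"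
  "struct \<epsilon> \<alpha> \<beta> 6 j k = \<epsilon> * wdg (cov 3) (cov 4) j k - wdg (\<beta> 3) (cov 5) j k
     - wdg (\<beta> 0) (cov 6) j k + wdg (\<beta> 1) (cov 6) j k"
  by (simp_all add: struct_def conn_def tors_def)

section \<open>Consequences of the Bianchi identity\<close>

text \<open>
  The instances of the Bianchi identity used here are free of derivatives, except for the last two
  triples. In each of those triples the derivatives of the three instances add up to zero. The
  assumptions \<open>norm\<close> fix the indeterminacy of the forms.
\<close>

lemma first_reduction:
  assumes bi: "\<And>i l j k. bianchi_at (struct 1 \<alpha> \<beta>) (\<lambda>l. struct 0 (\<alpha>' l) (\<beta>' l)) i l j k"
    and norm: "\<alpha> 1 3 = 0" "\<alpha> 1 4 = 0" "\<alpha> 2 4 = 0" "\<alpha> 3 3 = 0"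
      "\<beta> 1 5 = 0" "\<beta> 1 6 = 0" "\<beta> 2 6 = 0" "\<beta> 3 5 = 0"
      "\<And>l. \<alpha>' l 1 3 = 0" "\<And>l. \<alpha>' l 1 4 = 0" "\<And>l. \<alpha>' l 2 4 = 0"
      "\<And>l. \<alpha>' l 3 3 = 0"
      "\<And>l. \<beta>' l 1 5 = 0" "\<And>l. \<beta>' l 1 6 = 0" "\<And>l. \<beta>' l 2 6 = 0"
      "\<And>l. \<beta>' l 3 5 = 0"
  shows "\<beta> 0 1 = \<alpha> 0 1" "\<beta> 0 2 = \<alpha> 0 2" "\<beta> 0 3 = \<alpha> 0 3 + 1"
      "\<beta> 0 4 = \<alpha> 0 4" "\<beta> 0 5 = \<alpha> 0 5 + 1" "\<beta> 0 6 = \<alpha> 0 6"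
    and "\<alpha> 1 1 = 0" "\<alpha> 1 2 = 0" "\<alpha> 2 1 = -1" "\<alpha> 2 2 = -1"
      "\<alpha> 3 5 = 0" "\<alpha> 3 6 = -1"
      "\<beta> 1 1 = 0" "\<beta> 1 2 = 0" "\<beta> 2 1 = 1" "\<beta> 2 2 = -1" "\<beta> 3 3 = 0"
      "\<beta> 3 4 = -1"
    and "\<alpha> 1 6 = 2 * \<alpha> 0 6" "\<alpha> 1 5 = 2 * \<alpha> 0 5"
      "\<beta> 1 4 = 2 * \<alpha> 0 4" "\<beta> 1 3 = 2 * \<alpha> 0 3 + 2"
    and "\<alpha> 2 3 = 0" "\<beta> 2 5 = 0"
proof -
  note simps = bianchi_at_def struct_rows wdg_def cov_table sum_6 norm
  show b1: "\<beta> 0 1 = \<alpha> 0 1"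
    using bi[of 2 1 5 6] by (simp add: simps del: One_nat_def)
  show b2: "\<beta> 0 2 = \<alpha> 0 2"
    using bi[of 1 2 3 4] by (simp add: simps del: One_nat_def)
  show b3: "\<beta> 0 3 = \<alpha> 0 3 + 1"
    using bi[of 2 3 5 6] by (simp add: simps del: One_nat_def)
  show b4: "\<beta> 0 4 = \<alpha> 0 4"
    using bi[of 2 4 5 6] by (simp add: simps del: One_nat_def)
  show b5: "\<beta> 0 5 = \<alpha> 0 5 + 1"
    using bi[of 1 3 4 5] by (simp add: simps del: One_nat_def)
  show b6: "\<beta> 0 6 = \<alpha> 0 6"
    using bi[of 1 3 4 6] by (simp add: simps del: One_nat_def)
  note b = b1 b2 b3 b4 b5 b6
  show c1: "\<alpha> 1 1 = 0"
    using bi[of 4 1 5 6] by (simp add: simps b del: One_nat_def)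
  show c2: "\<alpha> 1 2 = 0"
    using bi[of 4 2 5 6] by (simp add: simps b del: One_nat_def)
  show c3: "\<alpha> 2 1 = -1"
    using bi[of 3 1 5 6] by (simp add: simps b del: One_nat_def)
  show c4: "\<alpha> 2 2 = -1"
    using bi[of 3 2 5 6] by (simp add: simps b del: One_nat_def)
  show c5: "\<alpha> 3 5 = 0"
    using bi[of 4 1 2 5] by (simp add: simps b del: One_nat_def)
  show c6: "\<alpha> 3 6 = -1"
    using bi[of 4 1 2 6] by (simp add: simps b del: One_nat_def)
  show c7: "\<beta> 1 1 = 0"
    using bi[of 6 1 3 4] by (simp add: simps b del: One_nat_def)
  show c8: "\<beta> 1 2 = 0"
    using bi[of 6 2 3 4] by (simp add: simps b del: One_nat_def)
  show c9: "\<beta> 2 1 = 1"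
    using bi[of 5 1 3 4] by (simp add: simps b del: One_nat_def)
  show c10: "\<beta> 2 2 = -1"
    using bi[of 5 2 3 4] by (simp add: simps b del: One_nat_def)
  show c11: "\<beta> 3 3 = 0"
    using bi[of 6 1 2 3] by (simp add: simps b del: One_nat_def)
  show c12: "\<beta> 3 4 = -1"
    using bi[of 6 1 2 4] by (simp add: simps b del: One_nat_def)
  note c = c1 c2 c3 c4 c5 c6 c7 c8 c9 c10 c11 c12
  show d1: "\<alpha> 1 6 = 2 * \<alpha> 0 6"
    using bi[of 3 1 2 6] by (simp add: simps b c del: One_nat_def)
  show d2: "\<alpha> 1 5 = 2 * \<alpha> 0 5"
    using bi[of 3 1 2 5] by (simp add: simps b c del: One_nat_def)
  show d3: "\<beta> 1 4 = 2 * \<alpha> 0 4"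
    using bi[of 5 1 2 4] by (simp add: simps b c del: One_nat_def)
  show d4: "\<beta> 1 3 = 2 * \<alpha> 0 3 + 2"
    using bi[of 5 1 2 3] by (simp add: simps b c del: One_nat_def)
  note d = d1 d2 d3 d4
  have "\<alpha> 2 3 - \<beta> 2 5 = 0"
    using bi[of 1 1 3 4] bi[of 6 3 4 6] bi[of 5 3 4 5]
    by (simp add: simps b c d algebra_simps del: One_nat_def)
  moreover have "\<alpha> 2 3 + \<beta> 2 5 = 0"
    using bi[of 2 2 5 6] bi[of 4 4 5 6] bi[of 3 3 5 6]
    by (simp add: simps b c d algebra_simps del: One_nat_def)
  ultimately show "\<alpha> 2 3 = 0" "\<beta> 2 5 = 0" by simp_all
qed

text \<open>
  The relations of the first reduction hold on an open set and can be differentiated (\<open>red'\<close>).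
  This removes the derivatives from further instances, or makes them cancel between the equations
  for \<open>\<omega>\<^sup>1\<close> and \<open>\<omega>\<^sup>2\<close>, in which they enter through \<open>\<beta>\<^sub>0\<close> and \<open>\<alpha>\<^sub>0\<close>.
\<close>

lemma second_reduction:
  assumes bi: "\<And>i l j k. bianchi_at (struct 1 \<alpha> \<beta>) (\<lambda>l. struct 0 (\<alpha>' l) (\<beta>' l)) i l j k"
    and norm: "\<alpha> 1 3 = 0" "\<alpha> 1 4 = 0" "\<alpha> 2 4 = 0" "\<alpha> 3 3 = 0"
      "\<beta> 1 5 = 0" "\<beta> 1 6 = 0" "\<beta> 2 6 = 0" "\<beta> 3 5 = 0"
      "\<And>l. \<alpha>' l 1 3 = 0" "\<And>l. \<alpha>' l 1 4 = 0" "\<And>l. \<alpha>' l 2 4 = 0"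
      "\<And>l. \<alpha>' l 3 3 = 0" "\<And>l. \<beta>' l 1 5 = 0" "\<And>l. \<beta>' l 1 6 = 0"
      "\<And>l. \<beta>' l 2 6 = 0" "\<And>l. \<beta>' l 3 5 = 0"
    and red: "\<beta> 0 1 = \<alpha> 0 1" "\<beta> 0 2 = \<alpha> 0 2" "\<beta> 0 3 = \<alpha> 0 3 + 1"
      "\<beta> 0 4 = \<alpha> 0 4" "\<beta> 0 5 = \<alpha> 0 5 + 1" "\<beta> 0 6 = \<alpha> 0 6"
      "\<alpha> 1 1 = 0" "\<alpha> 1 2 = 0" "\<alpha> 2 1 = -1" "\<alpha> 2 2 = -1" "\<alpha> 2 3 = 0"
      "\<alpha> 3 5 = 0" "\<alpha> 3 6 = -1" "\<beta> 1 1 = 0" "\<beta> 1 2 = 0" "\<beta> 2 1 = 1"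
      "\<beta> 2 2 = -1" "\<beta> 2 5 = 0" "\<beta> 3 3 = 0" "\<beta> 3 4 = -1"
      "\<alpha> 1 6 = 2 * \<alpha> 0 6" "\<alpha> 1 5 = 2 * \<alpha> 0 5"
      "\<beta> 1 4 = 2 * \<alpha> 0 4" "\<beta> 1 3 = 2 * \<alpha> 0 3 + 2"
    and red': "\<And>l. \<alpha>' l 1 1 = 0" "\<And>l. \<alpha>' l 1 2 = 0"
      "\<And>l. \<alpha>' l 2 1 = 0" "\<And>l. \<alpha>' l 2 2 = 0" "\<And>l. \<alpha>' l 2 3 = 0"
      "\<And>l. \<alpha>' l 3 5 = 0" "\<And>l. \<alpha>' l 3 6 = 0" "\<And>l. \<beta>' l 1 1 = 0"
      "\<And>l. \<beta>' l 1 2 = 0" "\<And>l. \<beta>' l 2 1 = 0" "\<And>l. \<beta>' l 2 2 = 0"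
      "\<And>l. \<beta>' l 2 5 = 0" "\<And>l. \<beta>' l 3 3 = 0" "\<And>l. \<beta>' l 3 4 = 0"
      "\<And>l j. \<beta>' l 0 j = \<alpha>' l 0 j"
  shows "\<beta> 1 3 = \<alpha> 1 5" "\<alpha> 2 6 = \<beta> 2 4" "\<alpha> 1 6 = \<beta> 2 3"
    "\<alpha> 2 5 = \<beta> 1 4"
    "\<alpha> 3 4 = \<beta> 1 3 - 1" "\<beta> 3 6 = 1 + \<alpha> 1 5"
    "\<alpha> 3 1 = \<alpha> 3 2 - \<alpha> 1 5 - \<beta> 1 3"
    "\<beta> 3 1 = - \<beta> 3 2 - \<alpha> 1 5 - \<beta> 1 3"
    "\<alpha> 0 1 = - (\<beta> 1 4 + \<beta> 2 3) / 2" "\<alpha> 0 2 = (\<beta> 1 4 - \<beta> 2 3) / 2"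
proof -
  note simps = bianchi_at_def struct_rows wdg_def cov_table sum_6 norm red red'
  show e1: "\<beta> 1 3 = \<alpha> 1 5"
    using bi[of 1 1 3 5] bi[of 2 2 3 5]
    by (simp_all add: simps algebra_simps del: One_nat_def)
  show e2: "\<alpha> 2 6 = \<beta> 2 4"
    using bi[of 1 1 4 6] bi[of 2 2 4 6]
    by (simp_all add: simps algebra_simps del: One_nat_def)
  show e3: "\<alpha> 1 6 = \<beta> 2 3"
    using bi[of 1 1 3 6] bi[of 2 2 3 6]
    by (simp_all add: simps algebra_simps del: One_nat_def)
  show e4: "\<alpha> 2 5 = \<beta> 1 4"
    using bi[of 1 1 4 5] bi[of 2 2 4 5]
    by (simp_all add: simps algebra_simps del: One_nat_def)
  show e5: "\<alpha> 3 4 = \<beta> 1 3 - 1"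
    using bi[of 3 1 3 4]
    by (simp_all add: simps algebra_simps del: One_nat_def)
  show e6: "\<beta> 3 6 = 1 + \<alpha> 1 5"
    using bi[of 5 1 5 6]
    by (simp_all add: simps algebra_simps del: One_nat_def)
  show e7: "\<alpha> 3 1 = \<alpha> 3 2 - \<alpha> 1 5 - \<beta> 1 3"
    using bi[of 3 1 2 3]
    by (simp_all add: simps algebra_simps del: One_nat_def)
  show e8: "\<beta> 3 1 = - \<beta> 3 2 - \<alpha> 1 5 - \<beta> 1 3"
    using bi[of 5 1 2 5]
    by (simp_all add: simps algebra_simps del: One_nat_def)
  have m1: "2 * \<alpha> 0 2 - 2 * \<alpha> 0 1 = \<alpha> 2 5 + \<beta> 1 4"
    using bi[of 3 1 2 4] by (simp add: simps algebra_simps del: One_nat_def)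
  have m2: "2 * \<alpha> 0 1 + 2 * \<alpha> 0 2 = - \<alpha> 1 6 - \<beta> 2 3"
    using bi[of 5 1 2 6] by (simp add: simps algebra_simps del: One_nat_def)
  have solve: "x = - (u + v) / 2 \<and> y = (u - v) / 2"
    if "2 * y - 2 * x = u + u" "2 * x + 2 * y = - v - v" for x y u v :: real
    using that by (simp add: field_simps)
  show "\<alpha> 0 1 = - (\<beta> 1 4 + \<beta> 2 3) / 2" "\<alpha> 0 2 = (\<beta> 1 4 - \<beta> 2 3) / 2"
    using solve[OF m1[unfolded e3 e4] m2[unfolded e3 e4]] by simp_all
qed

definition vec6 :: "real \<Rightarrow> real \<Rightarrow> real \<Rightarrow> real \<Rightarrow> real \<Rightarrow> real \<Rightarrow> 6 \<Rightarrow> real" where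
  "vec6 a b c d e f j = a * cov 1 j + b * cov 2 j + c * cov 3 j + d * cov 4 j + e * cov 5 j + f * cov 6 j"

text \<open>
  The forms \<open>\<alpha>\<^sub>n\<close> after both reductions, with six functions left. They are homogeneous linear in
  \<open>\<epsilon>\<close> and the six functions together, so that, as in \<open>struct\<close>, the value \<open>\<epsilon> = 0\<close> gives
  derivatives.
\<close>

definition red\<alpha> where
  "red\<alpha> \<epsilon> p q r \<tau> a b n =
    (if n = (0::nat) then vec6 (- p / 2 - q / 2) (p / 2 - q / 2) (\<tau> / 2 - \<epsilon>) (p / 2) (\<tau> / 2) (q / 2)
     else if n = 1 then vec6 0 0 0 0 \<tau> q
     else if n = 2 then vec6 (- \<epsilon>) (- \<epsilon>) 0 0 p r
     else vec6 (a - 2 * \<tau>) a 0 (\<tau> - \<epsilon>) 0 (- \<epsilon>))"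

definition red\<beta> where
  "red\<beta> \<epsilon> p q r \<tau> a b n =
    (if n = (0::nat) then vec6 (- p / 2 - q / 2) (p / 2 - q / 2) (\<tau> / 2) (p / 2) (\<tau> / 2 + \<epsilon>) (q / 2)
     else if n = 1 then vec6 0 0 \<tau> p 0 0
     else if n = 2 then vec6 \<epsilon> (- \<epsilon>) q r 0 0
     else vec6 (- b - 2 * \<tau>) b 0 (- \<epsilon>) 0 (\<epsilon> + \<tau>))"

lemma vec6_simps [simp]:
  "vec6 a b c d e f 1 = a" "vec6 a b c d e f 2 = b" "vec6 a b c d e f 3 = c"
  "vec6 a b c d e f 4 = d" "vec6 a b c d e f 5 = e" "vec6 a b c d e f 6 = f"
  by (simp_all add: vec6_def cov_table)

definition redc :: "real \<Rightarrow> real \<Rightarrow> real \<Rightarrow> real \<Rightarrow> real \<Rightarrow> real \<Rightarrow> real \<Rightarrow> 6 \<Rightarrow> 6 \<Rightarrow> 6 \<Rightarrow> real" where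
  "redc \<epsilon> p q r \<tau> a b = struct \<epsilon> (red\<alpha> \<epsilon> p q r \<tau> a b) (red\<beta> \<epsilon> p q r \<tau> a b)"

lemma exhaust_6:
  fixes i :: 6
  obtains "i = 1" | "i = 2" | "i = 3" | "i = 4" | "i = 5" | "i = 6"
  using UNIV_6 by blast

lemma struct_cong:
  assumes "\<And>n j. n \<in> {0, 1, 2, 3} \<Longrightarrow> \<alpha> n j = \<alpha>' n j" "\<And>n j. n \<in> {0, 1, 2, 3} \<Longrightarrow> \<beta> n j = \<beta>' n j"
  shows "struct \<epsilon> \<alpha> \<beta> = struct \<epsilon> \<alpha>' \<beta>'"
  unfolding struct_def conn_def wdg_def fun_eq_iff using assms by simp

lemmas expand_simps = algebra_simps add_divide_distrib diff_divide_distrib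

text \<open>
  Linearity reduces the derivatives of the structure functions to derivatives of the six
  functions, and it makes analyticity and partial derivatives with respect to the invariants
  evident.
\<close>

lemma redc_linear:
  "redc \<epsilon> p q r \<tau> a b i j k = \<epsilon> * redc 1 0 0 0 0 0 0 i j k + (p * redc 0 1 0 0 0 0 0 i j k
     + (q * redc 0 0 1 0 0 0 0 i j k + (r * redc 0 0 0 1 0 0 0 i j k + (\<tau> * redc 0 0 0 0 1 0 0 i j k
     + (a * redc 0 0 0 0 0 1 0 i j k + b * redc 0 0 0 0 0 0 1 i j k)))))"
  unfolding redc_def struct_def conn_def wdg_def red\<alpha>_def red\<beta>_def vec6_def
  by (simp add: expand_simps)

lemmas redc_simps = bianchi_at_def redc_def struct_rows wdg_def cov_table sum_6 red\<alpha>_def red\<beta>_def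

text \<open>
  Four instances give the derivatives of \<open>p\<close> and \<open>q\<close> along \<open>X\<^sub>1\<close> and \<open>X\<^sub>2\<close>. Inserted into a fifth
  one, all quadratic terms cancel.
\<close>

lemma tau_vanishes:
  assumes bi: "\<And>i l j k. bianchi_at (redc 1 p q r \<tau> a b)
    (\<lambda>l. redc 0 (p' l) (q' l) (r' l) (\<tau>' l) (a' l) (b' l)) i l j k"
  shows "\<tau> = 0"
proof -
  have "p' 1 = 1 - \<tau> - 2 * (r * \<tau>) - p * q / 2 - p * p / 2 - r * b"
    using bi[of 3 1 4 5] by (simp add: redc_simps) (simp add: expand_simps)
  moreover have "p' 2 = - 1 - \<tau> - p * q / 2 + p * p / 2 + r * b"
    using bi[of 3 2 4 5] by (simp add: redc_simps) (simp add: expand_simps)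
  moreover have "q' 1 = - 1 + \<tau> - 2 * (r * \<tau>) + r * a - p * q / 2 - q * q / 2"
    using bi[of 3 1 3 6] by (simp add: redc_simps) (simp add: expand_simps)
  moreover have "q' 2 = - 1 - \<tau> + r * a + p * q / 2 - q * q / 2"
    using bi[of 3 2 3 6] by (simp add: redc_simps) (simp add: expand_simps)
  moreover have "p' 1 + p' 2 - q' 1 + q' 2 + 2 * \<tau> = 0"
    using bi[of 4 1 2 4] by (simp add: redc_simps) (simp add: expand_simps)
  ultimately show ?thesis by linarith
qed

text \<open>
  The derivative of \<open>a\<close> along \<open>X\<^sub>5\<close> is found in two ways.
\<close>

lemma a_eq_b:
  assumes bi: "\<And>i l j k. bianchi_at (redc 1 p q r 0 a b)
    (\<lambda>l. redc 0 (p' l) (q' l) (r' l) 0 (a' l) (b' l)) i l j k"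
  shows "a = b"
proof -
  have "a' 5 = a - b"
    using bi[of 4 1 3 5] by (simp add: redc_simps) (simp add: expand_simps)?
  moreover have "a' 5 = b - a"
    using bi[of 4 2 3 5] by (simp add: redc_simps) (simp add: expand_simps)?
  ultimately show ?thesis by linarith
qed

text \<open>
  All 24 frame derivatives of \<open>p, q, r, s\<close> except \<open>X\<^sub>4 r\<close> and \<open>X\<^sub>6 r\<close> are determined, and two
  algebraic conditions remain.
\<close>

lemma invariants_derivatives:
  assumes bi: "\<And>i l j k. bianchi_at (redc 1 p q r 0 s s)
    (\<lambda>l. redc 0 (p' l) (q' l) (r' l) 0 (s' l) (s' l)) i l j k"
  shows "s * p = 0" "s * q = 0"
    and "p' 1 = 1 - p * q / 2 - p * p / 2 - r * s" "p' 2 = - 1 - p * q / 2 + p * p / 2 + r * s"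
      "p' 3 = q" "p' 4 = p * p / 2 - 1 + r * s" "p' 5 = q" "p' 6 = p * q / 2"
    and "q' 1 = - 1 - p * q / 2 - q * q / 2 + r * s" "q' 2 = - 1 + p * q / 2 - q * q / 2 + r * s"
      "q' 3 = p" "q' 4 = p * q / 2" "q' 5 = p" "q' 6 = 1 + q * q / 2 - r * s"
    and "r' 1 = p - q - p * r - q * r" "r' 2 = - p - q + p * r - q * r"
      "r' 3 = 2 * (p * q)" "r' 5 = 2 * (p * q)"
    and "s' 1 = 0" "s' 2 = 0" "s' 3 = 0" "s' 4 = 0" "s' 5 = 0" "s' 6 = 0"
proof -
  have sp: "s * p + s * q = 0"
    using bi[of 3 2 3 5] by (simp add: redc_simps) (simp add: expand_simps)?
  have sq: "s * q - s * p = 0"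
    using bi[of 3 1 3 5] by (simp add: redc_simps) (simp add: expand_simps)?
  show sp0: "s * p = 0" and sq0: "s * q = 0" using sp sq by linarith+
  show p1: "p' 1 = 1 - p * q / 2 - p * p / 2 - r * s"
    using bi[of 3 1 4 5] by (simp add: redc_simps) (simp add: expand_simps)?
  show p2: "p' 2 = - 1 - p * q / 2 + p * p / 2 + r * s"
    using bi[of 3 2 4 5] by (simp add: redc_simps) (simp add: expand_simps)?
  show q1: "q' 1 = - 1 - p * q / 2 - q * q / 2 + r * s"
    using bi[of 3 1 3 6] by (simp add: redc_simps) (simp add: expand_simps)?
  show q2: "q' 2 = - 1 + p * q / 2 - q * q / 2 + r * s"
    using bi[of 3 2 3 6] by (simp add: redc_simps) (simp add: expand_simps)?
  show p3: "p' 3 = q"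
    using bi[of 1 1 3 4] by (simp add: redc_simps) (simp add: expand_simps)?
  show p5: "p' 5 = q"
    using bi[of 1 1 4 5] by (simp add: redc_simps) (simp add: expand_simps)?
  show q5: "q' 5 = p"
    using bi[of 1 1 5 6] by (simp add: redc_simps) (simp add: expand_simps)?
  show q3: "q' 3 = p"
    using q5 bi[of 1 1 3 6] by (simp add: redc_simps) (simp add: expand_simps)?
  have pq46: "p' 6 = q' 4"
    using bi[of 1 1 4 6] by (simp add: redc_simps) (simp add: expand_simps)?
  have pq24: "p' 4 = p' 2 + q' 4"
    using bi[of 1 1 2 4] by (simp add: redc_simps) (simp add: expand_simps)?
  have pq26: "p' 6 = q' 2 + q' 6"
    using bi[of 1 1 2 6] by (simp add: redc_simps) (simp add: expand_simps)?
  have pq416: "p' 6 - q' 1 + q' 6 - 2 + 2 * (r * s) - p * q - q * q = 0"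
    using bi[of 4 1 4 6] by (simp add: redc_simps) (simp add: expand_simps)?
  show p6: "p' 6 = p * q / 2" using pq416 pq26 q1 q2 by linarith
  show q4: "q' 4 = p * q / 2" using pq46 p6 by simp
  show "q' 6 = 1 + q * q / 2 - r * s" using pq26 p6 q2 by linarith
  show "p' 4 = p * p / 2 - 1 + r * s" using pq24 p2 q4 by linarith
  show "r' 1 = p - q - p * r - q * r"
    using bi[of 3 1 4 6] by (simp add: redc_simps) (simp add: expand_simps)?
  show "r' 2 = - p - q + p * r - q * r"
    using bi[of 3 2 4 6] by (simp add: redc_simps) (simp add: expand_simps)?
  show "r' 3 = 2 * (p * q)"
    using q4 bi[of 3 3 4 6] by (simp add: redc_simps) (simp add: expand_simps)?
  show "r' 5 = 2 * (p * q)"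
    using p6 bi[of 3 4 5 6] by (simp add: redc_simps) (simp add: expand_simps)?
  have s12: "s' 1 = s' 2"
    using bi[of 4 1 2 3] by (simp add: redc_simps) (simp add: expand_simps)?
  have s21: "s' 1 = - s' 2"
    using bi[of 6 1 2 5] by (simp add: redc_simps) (simp add: expand_simps)?
  show "s' 1 = 0" "s' 2 = 0" using s12 s21 by linarith+
  show "s' 3 = 0"
    using bi[of 6 2 3 5] by (simp add: redc_simps) (simp add: expand_simps)?
  show "s' 4 = 0"
    using sp0 bi[of 6 2 4 5] by (simp add: redc_simps) (auto simp: algebra_simps)
  show "s' 5 = 0"
    using bi[of 4 2 3 5] by (simp add: redc_simps) (simp add: expand_simps)?
  show "s' 6 = 0"
    using sq0 bi[of 4 2 3 6] by (simp add: redc_simps) (auto simp: algebra_simps)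
qed

section \<open>Reduction of adapted coframings\<close>

lemma all_6: "(\<forall>i. P i) \<longleftrightarrow> P 1 \<and> P 2 \<and> P 3 \<and> P 4 \<and> P 5 \<and> P (6::6)"
proof (intro iffI allI)
  show "P i" if "P 1 \<and> P 2 \<and> P 3 \<and> P 4 \<and> P 5 \<and> P 6" for i
    using that by (cases i rule: exhaust_6) simp_all
qed simp

text \<open>
  Both sides of each equation are compared on pairs of vectors of the dual frame.
\<close>

lemma one_adapted_equations:
  assumes cof: "coframing U \<omega>" and x: "x \<in> U"
    and C: "C 1 = (0::real)" "C 2 = 1" "C 3 = 0" "C 4 = 1" and B: "B 1 = (1::real)" "B 2 = 0" "B 3 = 1"
      "B 4 = 0"
  shows "(d1 (\<omega> 1) x = - (\<beta> 0 \<^bold>\<and> \<omega> 1 x)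
              + 1 *\<^sub>R ((\<omega> 3 x - C 1 *\<^sub>R \<omega> 1 x) \<^bold>\<and> (\<omega> 4 x - C 2 *\<^sub>R \<omega> 1 x))
              + \<omega> 5 x \<^bold>\<and> \<omega> 6 x \<and>
          d1 (\<omega> 2) x = - (\<alpha> 0 \<^bold>\<and> \<omega> 2 x) + \<omega> 3 x \<^bold>\<and> \<omega> 4 x
              + (-1) *\<^sub>R ((\<omega> 5 x - C 3 *\<^sub>R \<omega> 2 x) \<^bold>\<and> (\<omega> 6 x - C 4 *\<^sub>R \<omega> 2 x)) \<and>
          d1 (\<omega> 3) x = - (\<alpha> 1 \<^bold>\<and> \<omega> 3 x) - \<alpha> 2 \<^bold>\<and> \<omega> 4 x
              + B 1 *\<^sub>R (\<omega> 1 x \<^bold>\<and> \<omega> 2 x) + C 1 *\<^sub>R (\<omega> 5 x \<^bold>\<and> \<omega> 6 x) \<and>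
          d1 (\<omega> 4) x = - (\<alpha> 3 \<^bold>\<and> \<omega> 3 x) - (\<alpha> 0 - \<alpha> 1) \<^bold>\<and> \<omega> 4 x
              + B 2 *\<^sub>R (\<omega> 1 x \<^bold>\<and> \<omega> 2 x) + C 2 *\<^sub>R (\<omega> 5 x \<^bold>\<and> \<omega> 6 x) \<and>
          d1 (\<omega> 5) x = - (\<beta> 1 \<^bold>\<and> \<omega> 5 x) - \<beta> 2 \<^bold>\<and> \<omega> 6 x
              + B 3 *\<^sub>R (\<omega> 1 x \<^bold>\<and> \<omega> 2 x) + C 3 *\<^sub>R (\<omega> 3 x \<^bold>\<and> \<omega> 4 x) \<and>
          d1 (\<omega> 6) x = - (\<beta> 3 \<^bold>\<and> \<omega> 5 x) - (\<beta> 0 - \<beta> 1) \<^bold>\<and> \<omega> 6 x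
              + B 4 *\<^sub>R (\<omega> 1 x \<^bold>\<and> \<omega> 2 x) + C 4 *\<^sub>R (\<omega> 3 x \<^bold>\<and> \<omega> 4 x))
    \<longleftrightarrow> (\<forall>i j k. strf \<omega> i j k x
          = struct 1 (\<lambda>n j. \<alpha> n \<bullet> dual \<omega> j x) (\<lambda>n j. \<beta> n \<bullet> dual \<omega> j x) i j k)"
    (is "(?E1 \<and> ?E2 \<and> ?E3 \<and> ?E4 \<and> ?E5 \<and> ?E6) \<longleftrightarrow> (\<forall>i. ?S i)")
proof -
  have inn: "\<omega> i x \<bullet> dual \<omega> k x = cov i k" for i k
    using coframe_inner_dual[OF cof x] by (simp add: cov_def)
  have eq: "d1 (\<omega> i) x = R \<longleftrightarrow>
      (\<forall>j k. strf \<omega> i j k x = ev2 R (dual \<omega> j x) (dual \<omega> k x))" for i R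
    using ev2_eqI[OF cof x, of "d1 (\<omega> i) x" R] by (auto simp: strf_def)
  note simps = ev2_linear ev2_wedge inn inner_diff_left struct_rows B C
  have "?E1 \<longleftrightarrow> ?S 1" unfolding eq by (simp add: simps) (simp add: wdg_def algebra_simps)
  moreover have "?E2 \<longleftrightarrow> ?S 2" unfolding eq by (simp add: simps) (simp add: wdg_def algebra_simps)
  moreover have "?E3 \<longleftrightarrow> ?S 3" unfolding eq by (simp add: simps) (simp add: wdg_def algebra_simps)
  moreover have "?E4 \<longleftrightarrow> ?S 4" unfolding eq by (simp add: simps) (simp add: wdg_def algebra_simps)
  moreover have "?E5 \<longleftrightarrow> ?S 5" unfolding eq by (simp add: simps) (simp add: wdg_def algebra_simps)
  moreover have "?E6 \<longleftrightarrow> ?S 6" unfolding eq by (simp add: simps) (simp add: wdg_def algebra_simps)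
  moreover have "(\<forall>i. ?S i) \<longleftrightarrow> ?S 1 \<and> ?S 2 \<and> ?S 3 \<and> ?S 4 \<and> ?S 5 \<and> ?S 6"
    by (rule all_6)
  ultimately show ?thesis by blast
qed

text \<open>
  By Cartan's lemma the equations for \<open>\<omega>\<^sup>3, \<omega>\<^sup>4\<close> determine \<open>\<alpha>\<^sub>1, \<alpha>\<^sub>2, \<alpha>\<^sub>3\<close> only up to combinations
  of \<open>\<omega>\<^sup>3, \<omega>\<^sup>4\<close> with four parameters, and similarly for \<open>\<beta>\<^sub>1, \<beta>\<^sub>2, \<beta>\<^sub>3\<close> and \<open>\<omega>\<^sup>5, \<omega>\<^sup>6\<close>. The
  parameters are chosen such that four components vanish.
\<close>

definition gauge :: "6 \<Rightarrow> 6 \<Rightarrow> (nat \<Rightarrow> 6 \<Rightarrow> real) \<Rightarrow> nat \<Rightarrow> 6 \<Rightarrow> real" where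
  "gauge a b A n j = A n j +
     (if n = 1 then - A 1 a * cov a j - A 1 b * cov b j
      else if n = 2 then - A 1 b * cov a j - A 2 b * cov b j
      else if n = 3 then - A 3 a * cov a j + A 1 a * cov b j
      else 0)"

lemma struct_gauge: "struct \<epsilon> (gauge 3 4 \<alpha>) (gauge 5 6 \<beta>) = struct \<epsilon> \<alpha> \<beta>"
proof (intro ext)
  fix i j k
  show "struct \<epsilon> (gauge 3 4 \<alpha>) (gauge 5 6 \<beta>) i j k = struct \<epsilon> \<alpha> \<beta> i j k"
    unfolding struct_def conn_def wdg_def gauge_def by (simp add: algebra_simps)
qed

lemma smooth_on_gauge:
  assumes "open U"
    "\<And>n j. n \<in> {0, 1, 2, 3} \<Longrightarrow> smooth_on U (\<lambda>x. A x n j)"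
    "n \<in> {0, 1, 2, 3}"
  shows "smooth_on U (\<lambda>x. gauge a b (A x) n j)"
proof -
  have s: "smooth_on U (\<lambda>x. A x 1 j)" "smooth_on U (\<lambda>x. A x 2 j)"
    "smooth_on U (\<lambda>x. A x 3 j)"
    "smooth_on U (\<lambda>x. A x n j)" for j
    using assms(2,3) by auto
  show ?thesis
    unfolding gauge_def
    by (cases "n = 1"; cases "n = 2"; cases "n = 3")
      (auto intro!: smooth_on_intros assms(1) s simp del: One_nat_def)
qed

lemma fder_diff:
  assumes "open U" "smooth_on U f" "smooth_on U g" "x \<in> U"
  shows "fder \<omega> l (\<lambda>x. f x - g x) x = fder \<omega> l f x - fder \<omega> l g x"
  using fder_add[OF assms(2) smooth_on_mult[OF assms(1) smooth_on_const[of U "-1"] assms(3)] assms(4)]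
  by (simp add: fder_cmult[OF assms(3,4), of _ _ "-1", simplified])

lemma fder_struct:
  assumes U: "open U" and x: "x \<in> U"
    and A: "\<And>n j. n \<in> {0, 1, 2, 3} \<Longrightarrow> smooth_on U (\<lambda>x. A x n j)"
    and B: "\<And>n j. n \<in> {0, 1, 2, 3} \<Longrightarrow> smooth_on U (\<lambda>x. B x n j)"
  shows "fder \<omega> l (\<lambda>x. struct 1 (A x) (B x) i j k) x
    = struct 0 (\<lambda>n j. fder \<omega> l (\<lambda>x. A x n j) x) (\<lambda>n j. fder \<omega> l (\<lambda>x. B x n j) x) i j k"
proof -
  have sw: "smooth_on U (\<lambda>x. wdg (F x n) (cov m) j k)"
    if "\<And>n j. n \<in> {0, 1, 2, 3} \<Longrightarrow> smooth_on U (\<lambda>x. F x n j)" "n \<in> {0, 1, 2, 3}"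
    for F :: "pt \<Rightarrow> nat \<Rightarrow> 6 \<Rightarrow> real" and n m
    unfolding wdg_def by (intro smooth_on_intros U that)
  have fw: "fder \<omega> l (\<lambda>x. wdg (F x n) (cov m) j k) x
      = wdg (\<lambda>j. fder \<omega> l (\<lambda>x. F x n j) x) (cov m) j k"
    if "\<And>n j. n \<in> {0, 1, 2, 3} \<Longrightarrow> smooth_on U (\<lambda>x. F x n j)" "n \<in> {0, 1, 2, 3}"
    for F :: "pt \<Rightarrow> nat \<Rightarrow> 6 \<Rightarrow> real" and n m
    unfolding wdg_def using that(1)[OF that(2)]
    by (simp add: fder_diff[OF U _ _ x] smooth_on_mult U smooth_on_const mult.commute[of _ "cov m _"]
        fder_cmult[OF _ x])
  have swAB: "smooth_on U (\<lambda>x. wdg (A x n) (cov m) j k)" "smooth_on U (\<lambda>x. wdg (B x n) (cov m) j k)"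
    if "n \<in> {0, 1, 2, 3}" for n m
    using sw[of A n m] sw[of B n m] A B that by blast+
  have fwAB: "fder \<omega> l (\<lambda>x. wdg (A x n) (cov m) j k) x
        = wdg (\<lambda>j. fder \<omega> l (\<lambda>x. A x n j) x) (cov m) j k"
      "fder \<omega> l (\<lambda>x. wdg (B x n) (cov m) j k) x
        = wdg (\<lambda>j. fder \<omega> l (\<lambda>x. B x n j) x) (cov m) j k"
    if "n \<in> {0, 1, 2, 3}" for n m
    using fw[of A n m] fw[of B n m] A B that by blast+
  note simps = struct_rows fder_diff[OF U _ _ x] fder_add[OF _ _ x] fder_const
    swAB fwAB smooth_on_diff[OF U] smooth_on_add[OF U] smooth_on_const
  show ?thesis
    by (rule exhaust_6[of i]) (simp_all add: simps del: One_nat_def)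
qed

lemma fder_redc:
  assumes U: "open U" and x: "x \<in> U" and sm: "smooth_on U p" "smooth_on U q" "smooth_on U r"
    "smooth_on U \<tau>" "smooth_on U a" "smooth_on U b"
  shows "fder \<omega> l (\<lambda>x. redc 1 (p x) (q x) (r x) (\<tau> x) (a x) (b x) i j k) x
    = redc 0 (fder \<omega> l p x) (fder \<omega> l q x) (fder \<omega> l r x) (fder \<omega> l \<tau> x) (fder \<omega> l a x) (fder \<omega> l b x) i j k"
proof -
  have m: "smooth_on U (\<lambda>x. f x * c)" if "smooth_on U f" for f and c :: real
    by (intro smooth_on_intros U that)
  have d: "fder \<omega> l (\<lambda>x. f x * c) x = fder \<omega> l f x * c" if "smooth_on U f" for f and c :: real
    using fder_cmult[OF that x] by (simp add: mult.commute)
  show ?thesis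
    by (subst (1 2) redc_linear)
      (simp add: m d sm fder_add[OF _ _ x] smooth_on_add[OF U] smooth_on_const fder_const)
qed

text \<open>
  This turns the Bianchi identity into algebra: the structure functions are replaced by a formula
  for them on the whole open set, and their derivatives by the derivatives of the formula.
\<close>

lemma bianchi_at_strf:
  assumes "coframing U \<omega>" "x \<in> U"
    "\<And>y i j k. y \<in> U \<Longrightarrow> strf \<omega> i j k y = c y i j k"
    "\<And>l i j k. fder \<omega> l (\<lambda>y. c y i j k) x = c' l i j k"
  shows "bianchi_at (c x) c' i l j k"
proof -
  have "fder \<omega> l (strf \<omega> i j k) x = c' l i j k" for i j k l
    using fder_local_cong[OF coframing_open[OF assms(1)] assms(2), of "strf \<omega> i j k" "\<lambda>y. c y i j k"]
      assms(3,4) by simp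
  then show ?thesis
    using bianchi[OF assms(1,2), of l i j k] assms(3)[OF assms(2)]
    unfolding bianchi_at_def sum.distrib by simp
qed

lemma gauge_normal:
  "gauge 3 4 A 1 3 = 0" "gauge 3 4 A 1 4 = 0" "gauge 3 4 A 2 4 = 0" "gauge 3 4 A 3 3 = 0"
  "gauge 5 6 A 1 5 = 0" "gauge 5 6 A 1 6 = 0" "gauge 5 6 A 2 6 = 0" "gauge 5 6 A 3 5 = 0"
  by (simp_all add: gauge_def cov_table)

text \<open>
  The connection forms enter through their components in the coframe, normalised by \<open>gauge\<close>.
\<close>

lemma adapted_connection:
  assumes ad: "one_adapted U \<omega> 1 1 (\<lambda>_. 1) (\<lambda>_. -1)"
  obtains A B where
    "\<And>n j. n \<in> {0, 1, 2, 3} \<Longrightarrow> smooth_on U (\<lambda>x. A x n j)"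
    "\<And>n j. n \<in> {0, 1, 2, 3} \<Longrightarrow> smooth_on U (\<lambda>x. B x n j)"
    "\<And>x. A x 1 3 = 0" "\<And>x. A x 1 4 = 0" "\<And>x. A x 2 4 = 0" "\<And>x. A x 3 3 = 0"
    "\<And>x. B x 1 5 = 0" "\<And>x. B x 1 6 = 0" "\<And>x. B x 2 6 = 0" "\<And>x. B x 3 5 = 0"
    "\<And>x i j k. x \<in> U \<Longrightarrow> strf \<omega> i j k x = struct 1 (A x) (B x) i j k"
proof -
  have cof: "coframing U \<omega>" using ad by (simp add: one_adapted_def)
  note U = coframing_open[OF cof]
  from ad obtain \<alpha> \<beta> :: "nat \<Rightarrow> form1" and B C :: "nat \<Rightarrow> pt \<Rightarrow> real" where
    sm: "\<And>n. n \<in> {0..3} \<Longrightarrow> smooth_form U (\<alpha> n)" "\<And>n. n \<in> {0..3} \<Longrightarrow> smooth_form U (\<beta> n)"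
    and eqs: "\<And>x. x \<in> U \<Longrightarrow>
          d1 (\<omega> 1) x = - (\<beta> 0 x \<^bold>\<and> \<omega> 1 x)
              + 1 *\<^sub>R ((\<omega> 3 x - C 1 x *\<^sub>R \<omega> 1 x) \<^bold>\<and> (\<omega> 4 x - C 2 x *\<^sub>R \<omega> 1 x))
              + \<omega> 5 x \<^bold>\<and> \<omega> 6 x \<and>
          d1 (\<omega> 2) x = - (\<alpha> 0 x \<^bold>\<and> \<omega> 2 x) + \<omega> 3 x \<^bold>\<and> \<omega> 4 x
              + (-1) *\<^sub>R ((\<omega> 5 x - C 3 x *\<^sub>R \<omega> 2 x) \<^bold>\<and> (\<omega> 6 x - C 4 x *\<^sub>R \<omega> 2 x)) \<and>
          d1 (\<omega> 3) x = - (\<alpha> 1 x \<^bold>\<and> \<omega> 3 x) - \<alpha> 2 x \<^bold>\<and> \<omega> 4 x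
              + B 1 x *\<^sub>R (\<omega> 1 x \<^bold>\<and> \<omega> 2 x) + C 1 x *\<^sub>R (\<omega> 5 x \<^bold>\<and> \<omega> 6 x) \<and>
          d1 (\<omega> 4) x = - (\<alpha> 3 x \<^bold>\<and> \<omega> 3 x) - (\<alpha> 0 x - \<alpha> 1 x) \<^bold>\<and> \<omega> 4 x
              + B 2 x *\<^sub>R (\<omega> 1 x \<^bold>\<and> \<omega> 2 x) + C 2 x *\<^sub>R (\<omega> 5 x \<^bold>\<and> \<omega> 6 x) \<and>
          d1 (\<omega> 5) x = - (\<beta> 1 x \<^bold>\<and> \<omega> 5 x) - \<beta> 2 x \<^bold>\<and> \<omega> 6 x
              + B 3 x *\<^sub>R (\<omega> 1 x \<^bold>\<and> \<omega> 2 x) + C 3 x *\<^sub>R (\<omega> 3 x \<^bold>\<and> \<omega> 4 x) \<and>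
          d1 (\<omega> 6) x = - (\<beta> 3 x \<^bold>\<and> \<omega> 5 x) - (\<beta> 0 x - \<beta> 1 x) \<^bold>\<and> \<omega> 6 x
              + B 4 x *\<^sub>R (\<omega> 1 x \<^bold>\<and> \<omega> 2 x) + C 4 x *\<^sub>R (\<omega> 3 x \<^bold>\<and> \<omega> 4 x) \<and>
          B 1 x = 1 \<and> C 1 x = 0 \<and> B 2 x = 0 \<and> C 2 x = 1 \<and>
          B 3 x = 1 \<and> C 3 x = 0 \<and> B 4 x = 0 \<and> C 4 x = 1"
    unfolding one_adapted_def by (elim conjE exE) blast
  define a where "a x n j = \<alpha> n x \<bullet> dual \<omega> j x" for x n j
  define b where "b x n j = \<beta> n x \<bullet> dual \<omega> j x" for x n j
  have S: "strf \<omega> i j k x = struct 1 (a x) (b x) i j k" if "x \<in> U" for x i j k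
    using one_adapted_equations[OF cof that, of "\<lambda>n. C n x" "\<lambda>n. B n x" "\<lambda>n. \<beta> n x" "\<lambda>n. \<alpha> n x"] eqs[OF that]
    unfolding a_def b_def by blast
  have sab: "smooth_on U (\<lambda>x. a x n j)" "smooth_on U (\<lambda>x. b x n j)" if
    "n \<in> {0, 1, 2, 3}" for n j
    unfolding a_def b_def using that by (auto intro!: smooth_on_component[OF cof] sm)
  show ?thesis
  proof (rule that[of "\<lambda>x. gauge 3 4 (a x)" "\<lambda>x. gauge 5 6 (b x)"])
    show "smooth_on U (\<lambda>x. gauge 3 4 (a x) n j)" "smooth_on U (\<lambda>x. gauge 5 6 (b x) n j)"
      if "n \<in> {0, 1, 2, 3}" for n j
      by (rule smooth_on_gauge[OF U _ that], rule sab, assumption)+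
    show "strf \<omega> i j k x = struct 1 (gauge 3 4 (a x)) (gauge 5 6 (b x)) i j k" if "x \<in> U" for x i j k
      unfolding struct_gauge by (rule S[OF that])
  qed (rule gauge_normal)+
qed

text \<open>
  The reductions hold at every point of \<open>U\<close>, hence each of them can be differentiated before the
  next one is applied. The resulting instance of the Bianchi identity is kept in the conclusion,
  as it contains all remaining information on \<open>p, q, r, s\<close>.
\<close>

lemma adapted_structure:
  assumes ad: "one_adapted U \<omega> 1 1 (\<lambda>_. 1) (\<lambda>_. -1)"
  obtains p q r s where "smooth_on U p" "smooth_on U q" "smooth_on U r" "smooth_on U s"
    "\<And>x i j k. x \<in> U \<Longrightarrow> strf \<omega> i j k x = redc 1 (p x) (q x) (r x) 0 (s x) (s x) i j k"
    "\<And>x i l j k. x \<in> U \<Longrightarrow> bianchi_at (redc 1 (p x) (q x) (r x) 0 (s x) (s x))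
       (\<lambda>l. redc 0 (fder \<omega> l p x) (fder \<omega> l q x) (fder \<omega> l r x) 0 (fder \<omega> l s x) (fder \<omega> l s x)) i l j k"
proof -
  have cof: "coframing U \<omega>" using ad by (simp add: one_adapted_def)
  note U = coframing_open[OF cof]
  from adapted_connection[OF ad] obtain A B where
    sA: "\<And>n j. n \<in> {0, 1, 2, 3} \<Longrightarrow> smooth_on U (\<lambda>x. A x n j)" and
    sB: "\<And>n j. n \<in> {0, 1, 2, 3} \<Longrightarrow> smooth_on U (\<lambda>x. B x n j)" and
    norm: "\<And>x. A x 1 3 = 0" "\<And>x. A x 1 4 = 0" "\<And>x. A x 2 4 = 0" "\<And>x. A x 3 3 = 0"
      "\<And>x. B x 1 5 = 0" "\<And>x. B x 1 6 = 0" "\<And>x. B x 2 6 = 0" "\<And>x. B x 3 5 = 0" and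
    S: "\<And>x i j k. x \<in> U \<Longrightarrow> strf \<omega> i j k x = struct 1 (A x) (B x) i j k"
    by blast
  define A' where "A' x l n j = fder \<omega> l (\<lambda>x. A x n j) x" for x l n j
  define B' where "B' x l n j = fder \<omega> l (\<lambda>x. B x n j) x" for x l n j
  have bi: "bianchi_at (struct 1 (A x) (B x)) (\<lambda>l. struct 0 (A' x l) (B' x l)) i l j k" if "x \<in> U" for x i l j k
  proof (rule bianchi_at_strf[OF cof that S])
    show "fder \<omega> l (\<lambda>y. struct 1 (A y) (B y) i j k) x = struct 0 (A' x l) (B' x l) i j k" for l i j k
      unfolding A'_def B'_def by (rule fder_struct[OF U that sA sB])
  qed
  have norm': "\<And>x l. A' x l 1 3 = 0" "\<And>x l. A' x l 1 4 = 0" "\<And>x l. A' x l 2 4 = 0"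
    "\<And>x l. A' x l 3 3 = 0"
      "\<And>x l. B' x l 1 5 = 0" "\<And>x l. B' x l 1 6 = 0" "\<And>x l. B' x l 2 6 = 0"
      "\<And>x l. B' x l 3 5 = 0"
    unfolding A'_def B'_def norm by (rule fder_const)+
  have first: "B x 0 1 = A x 0 1" "B x 0 2 = A x 0 2" "B x 0 3 = A x 0 3 + 1" "B x 0 4 = A x 0 4"
    "B x 0 5 = A x 0 5 + 1" "B x 0 6 = A x 0 6"
      "A x 1 1 = 0" "A x 1 2 = 0" "A x 2 1 = -1" "A x 2 2 = -1" "A x 2 3 = 0" "A x 3 5 = 0"
      "A x 3 6 = -1" "B x 1 1 = 0" "B x 1 2 = 0" "B x 2 1 = 1" "B x 2 2 = -1" "B x 2 5 = 0"
      "B x 3 3 = 0" "B x 3 4 = -1"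
      "A x 1 6 = 2 * A x 0 6" "A x 1 5 = 2 * A x 0 5" "B x 1 4 = 2 * A x 0 4" "B x 1 3 = 2 * A x 0 3 + 2"
    if "x \<in> U" for x
    by (rule first_reduction[OF bi[OF that] norm norm'])+
  have const: "fder \<omega> l f x = 0" if "x \<in> U" "\<And>y. y \<in> U \<Longrightarrow> f y = c"
    for f x c l
    using fder_local_cong[OF U that(1), of f "\<lambda>_. c"] that(2) by (simp add: fder_const)
  have const': "A' x l 1 1 = 0" "A' x l 1 2 = 0" "A' x l 2 1 = 0" "A' x l 2 2 = 0" "A' x l 2 3 = 0"
      "A' x l 3 5 = 0" "A' x l 3 6 = 0" "B' x l 1 1 = 0" "B' x l 1 2 = 0" "B' x l 2 1 = 0"
      "B' x l 2 2 = 0" "B' x l 2 5 = 0" "B' x l 3 3 = 0" "B' x l 3 4 = 0" if "x \<in> U" for x l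
    unfolding A'_def B'_def by (rule const[OF that], rule first, assumption)+
  \<comment> \<open>The difference \<open>\<beta>\<^sub>0 - \<alpha>\<^sub>0 = \<omega>\<^sup>3 + \<omega>\<^sup>5\<close> has constant components.\<close>
  have diff': "B' x l 0 j = A' x l 0 j" if x: "x \<in> U" for x l j
  proof -
    define c :: real where "c = (if j = 3 \<or> j = 5 then 1 else 0)"
    have "B y 0 j = A y 0 j + c" if "y \<in> U" for y
      using first(1-6)[OF that] by (cases j rule: exhaust_6) (simp_all add: c_def)
    then have "fder \<omega> l (\<lambda>y. B y 0 j) x = fder \<omega> l (\<lambda>y. A y 0 j + c) x"
      by (intro fder_local_cong[OF U x])
    also have "\<dots> = fder \<omega> l (\<lambda>y. A y 0 j) x"
      by (subst fder_add[OF _ smooth_on_const x]) (simp_all add: sA fder_const)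
    finally show ?thesis by (simp add: A'_def B'_def)
  qed
  \<comment> \<open>The six functions in terms of which the second reduction expresses all components.\<close>
  define p where "p x = B x 1 4" for x
  define q where "q x = B x 2 3" for x
  define r where "r x = B x 2 4" for x
  define \<tau> where "\<tau> x = A x 1 5" for x
  define a where "a x = A x 3 2" for x
  define b where "b x = B x 3 2" for x
  have sm: "smooth_on U p" "smooth_on U q" "smooth_on U r" "smooth_on U \<tau>" "smooth_on U a"
    "smooth_on U b"
    unfolding p_def q_def r_def \<tau>_def a_def b_def by (simp_all add: sA sB del: One_nat_def)
  have R: "strf \<omega> i j k x = redc 1 (p x) (q x) (r x) (\<tau> x) (a x) (b x) i j k" if x: "x \<in> U" for x i j k
  proof -
    note second = second_reduction[OF bi[OF x] norm norm' first[OF x] const'[OF x] diff'[OF x]]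
    have "A x 0 4 = B x 1 4 / 2" "A x 0 6 = B x 2 3 / 2" "A x 0 5 = A x 1 5 / 2" "A x 0 3 = A x 1 5 / 2 - 1"
      using first(21-24)[OF x] second(1,3) by linarith+
    note f = first(1-20)[OF x] norm second this
    note d = p_def q_def r_def \<tau>_def a_def b_def
    have "struct 1 (A x) (B x) = redc 1 (p x) (q x) (r x) (\<tau> x) (a x) (b x)"
      unfolding redc_def
    proof (rule struct_cong)
      show "A x n j = red\<alpha> 1 (p x) (q x) (r x) (\<tau> x) (a x) (b x) n j" if "n \<in> {0, 1, 2, 3}" for n j
        using that by (elim insertE emptyE; cases j rule: exhaust_6)
          (simp_all add: f red\<alpha>_def d add_divide_distrib diff_divide_distrib del: One_nat_def)
      show "B x n j = red\<beta> 1 (p x) (q x) (r x) (\<tau> x) (a x) (b x) n j" if "n \<in> {0, 1, 2, 3}" for n j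
        using that by (elim insertE emptyE; cases j rule: exhaust_6)
          (simp_all add: f red\<beta>_def d add_divide_distrib diff_divide_distrib del: One_nat_def)
    qed
    then show ?thesis using S[OF x] by simp
  qed
  have bi2: "bianchi_at (redc 1 (p x) (q x) (r x) (\<tau> x) (a x) (b x))
       (\<lambda>l. redc 0 (fder \<omega> l p x) (fder \<omega> l q x) (fder \<omega> l r x) (fder \<omega> l \<tau> x) (fder \<omega> l a x) (fder \<omega> l b x)) i l j k"
    if "x \<in> U" for x i l j k
    by (rule bianchi_at_strf[OF cof that R]) (simp_all add: fder_redc[OF U that sm])
  have \<tau>: "\<tau> x = 0" if "x \<in> U" for x
    using tau_vanishes[OF bi2[OF that]] .
  then have \<tau>': "fder \<omega> l \<tau> x = 0" if "x \<in> U" for x l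
    using const[OF that] by blast
  have ab: "a x = b x" if x: "x \<in> U" for x
    by (rule a_eq_b) (rule bi2[OF x, unfolded \<tau>[OF x] \<tau>'[OF x]])
  then have ab': "fder \<omega> l a x = fder \<omega> l b x" if x: "x \<in> U" for x l
    by (rule fder_local_cong[OF U x])
  show ?thesis
  proof (rule that[OF sm(1,2,3,5)])
    show "strf \<omega> i j k x = redc 1 (p x) (q x) (r x) 0 (a x) (a x) i j k" if x: "x \<in> U" for x i j k
      using R[OF x] \<tau>[OF x] ab[OF x] by simp
    show "bianchi_at (redc 1 (p x) (q x) (r x) 0 (a x) (a x))
       (\<lambda>l. redc 0 (fder \<omega> l p x) (fder \<omega> l q x) (fder \<omega> l r x) 0 (fder \<omega> l a x) (fder \<omega> l a x)) i l j k"
      if x: "x \<in> U" for x i l j k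
      using bi2[OF x] \<tau>[OF x] \<tau>'[OF x] ab[OF x] ab'[OF x] by simp
  qed
qed

text \<open>
  The formulas for the reduced forms define connection forms on all of \<open>U\<close>.
\<close>

lemma adapted_from_structure:
  assumes cof: "coframing U \<omega>" and sm: "smooth_on U p" "smooth_on U q" "smooth_on U r" "smooth_on U s"
    and S: "\<And>x i j k. x \<in> U \<Longrightarrow> strf \<omega> i j k x = redc 1 (p x) (q x) (r x) 0 (s x) (s x) i j k"
  shows "one_adapted U \<omega> 1 1 (\<lambda>_. 1) (\<lambda>_. -1)"
proof -
  note U = coframing_open[OF cof]
  define \<alpha> where "\<alpha> n x = (\<Sum>j\<in>UNIV. red\<alpha> 1 (p x) (q x) (r x) 0 (s x) (s x) n j *\<^sub>R \<omega> j x)" for n x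
  define \<beta> where "\<beta> n x = (\<Sum>j\<in>UNIV. red\<beta> 1 (p x) (q x) (r x) 0 (s x) (s x) n j *\<^sub>R \<omega> j x)" for n x
  have half: "smooth_on U (\<lambda>x. f x / 2)" if "smooth_on U f" for f
    using smooth_on_mult[OF U that smooth_on_const[of U "1/2"]] by simp
  have "smooth_on U (\<lambda>x. red\<alpha> 1 (p x) (q x) (r x) 0 (s x) (s x) n j)"
       "smooth_on U (\<lambda>x. red\<beta> 1 (p x) (q x) (r x) 0 (s x) (s x) n j)" for n j
    unfolding red\<alpha>_def red\<beta>_def vec6_def
    by (cases "n = 0"; cases "n = 1"; cases "n = 2";
        simp del: One_nat_def; intro smooth_on_intros half U sm)+
  then have smooth: "smooth_form U (\<alpha> n)" "smooth_form U (\<beta> n)" for n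
    unfolding smooth_form_def \<alpha>_def \<beta>_def
    by (auto intro!: smooth_on_sum smooth_on_mult U coframing_smooth[OF cof])
  have comp: "(\<Sum>k\<in>UNIV. c k *\<^sub>R \<omega> k x) \<bullet> dual \<omega> j x = c j" if "x \<in> U" for c x j
    unfolding inner_sum_left inner_scaleR_left coframe_inner_dual[OF cof that]
    by (simp add: if_distrib cong: if_cong)
  define B :: "nat \<Rightarrow> pt \<Rightarrow> real" where "B n = (\<lambda>x. if n = 1 \<or> n = 3 then 1 else 0)" for n
  define C :: "nat \<Rightarrow> pt \<Rightarrow> real" where "C n = (\<lambda>x. if n = 2 \<or> n = 4 then 1 else 0)" for n
  show ?thesis
    unfolding one_adapted_def
  proof (intro conjI cof; (rule exI[of _ \<alpha>], rule exI[of _ \<beta>], rule exI[of _ B], rule exI[of _ C], intro conjI ballI)?)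
    fix x assume x: "x \<in> U"
    have "strf \<omega> i j k x = struct 1 (\<lambda>n j. \<alpha> n x \<bullet> dual \<omega> j x) (\<lambda>n j. \<beta> n x \<bullet> dual \<omega> j x) i j k" for i j k
      using S[OF x, of i j k] unfolding \<alpha>_def \<beta>_def comp[OF x] redc_def .
    then have eqs: "\<forall>i j k. strf \<omega> i j k x = struct 1 (\<lambda>n j. \<alpha> n x \<bullet> dual \<omega> j x) (\<lambda>n j. \<beta> n x \<bullet> dual \<omega> j x) i j k"
      by blast
    note E = one_adapted_equations[OF cof x, of "\<lambda>n. C n x" "\<lambda>n. B n x" "\<lambda>n. \<beta> n x" "\<lambda>n. \<alpha> n x", THEN iffD2, OF _ _ _ _ _ _ _ _ eqs]
    have BC: "B 1 x = 1" "C 1 x = 0" "B 2 x = 0" "C 2 x = 1" "B 3 x = 1" "C 3 x = 0" "B 4 x = 0" "C 4 x = 1"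
      by (simp_all add: B_def C_def)
    note E = E[OF BC(2,4,6,8,1,3,5,7)]
    show "d1 (\<omega> 1) x = - (\<beta> 0 x \<^bold>\<and> \<omega> 1 x)
              + 1 *\<^sub>R ((\<omega> 3 x - C 1 x *\<^sub>R \<omega> 1 x) \<^bold>\<and> (\<omega> 4 x - C 2 x *\<^sub>R \<omega> 1 x))
              + \<omega> 5 x \<^bold>\<and> \<omega> 6 x"
      and "d1 (\<omega> 2) x = - (\<alpha> 0 x \<^bold>\<and> \<omega> 2 x) + \<omega> 3 x \<^bold>\<and> \<omega> 4 x
              + (-1) *\<^sub>R ((\<omega> 5 x - C 3 x *\<^sub>R \<omega> 2 x) \<^bold>\<and> (\<omega> 6 x - C 4 x *\<^sub>R \<omega> 2 x))"
      and "d1 (\<omega> 3) x = - (\<alpha> 1 x \<^bold>\<and> \<omega> 3 x) - \<alpha> 2 x \<^bold>\<and> \<omega> 4 x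
              + B 1 x *\<^sub>R (\<omega> 1 x \<^bold>\<and> \<omega> 2 x) + C 1 x *\<^sub>R (\<omega> 5 x \<^bold>\<and> \<omega> 6 x)"
      and "d1 (\<omega> 4) x = - (\<alpha> 3 x \<^bold>\<and> \<omega> 3 x) - (\<alpha> 0 x - \<alpha> 1 x) \<^bold>\<and> \<omega> 4 x
              + B 2 x *\<^sub>R (\<omega> 1 x \<^bold>\<and> \<omega> 2 x) + C 2 x *\<^sub>R (\<omega> 5 x \<^bold>\<and> \<omega> 6 x)"
      and "d1 (\<omega> 5) x = - (\<beta> 1 x \<^bold>\<and> \<omega> 5 x) - \<beta> 2 x \<^bold>\<and> \<omega> 6 x
              + B 3 x *\<^sub>R (\<omega> 1 x \<^bold>\<and> \<omega> 2 x) + C 3 x *\<^sub>R (\<omega> 3 x \<^bold>\<and> \<omega> 4 x)"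
      and "d1 (\<omega> 6) x = - (\<beta> 3 x \<^bold>\<and> \<omega> 5 x) - (\<beta> 0 x - \<beta> 1 x) \<^bold>\<and> \<omega> 6 x
              + B 4 x *\<^sub>R (\<omega> 1 x \<^bold>\<and> \<omega> 2 x) + C 4 x *\<^sub>R (\<omega> 3 x \<^bold>\<and> \<omega> 4 x)"
      using E by blast+
  qed (auto simp: smooth smooth_on_const B_def C_def)
qed

section \<open>Entire functions of several variables\<close>

definition monom_at :: "nat \<Rightarrow> (nat \<Rightarrow> real) \<Rightarrow> (nat \<Rightarrow> nat) \<Rightarrow> (nat \<Rightarrow> real) \<Rightarrow> real" where
  "monom_at n p m z = (\<Prod>i<n. (z i - p i) ^ m i)"

definition multi_index :: "nat \<Rightarrow> (nat \<Rightarrow> nat) set" where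
  "multi_index n = {m. \<forall>i\<ge>n. m i = 0}"

text \<open>
  Functions with an everywhere convergent expansion about every point.  In contrast to
  \<^const>\<open>real_analytic\<close>, no radius has to be carried along in the closure properties, and the
  functions needed below (polynomials and exponentials) are of this kind.
\<close>

definition entire :: "nat \<Rightarrow> ((nat \<Rightarrow> real) \<Rightarrow> real) \<Rightarrow> bool" where
  "entire n f \<longleftrightarrow>
     (\<forall>p\<in>Rn n. \<exists>c. \<forall>z\<in>Rn n. ((\<lambda>m. c m * monom_at n p m z) has_sum f z) (multi_index n))"

lemma entire_imp_real_analytic: "entire n f \<Longrightarrow> real_analytic n f"
  unfolding entire_def real_analytic_def monom_at_def multi_index_def
  by (meson zero_less_one)

lemma entire_const: "entire n (\<lambda>z. a)"
  unfolding entire_def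
proof (intro ballI exI)
  fix p z
  let ?c = "\<lambda>m. if m = (\<lambda>_. 0) then a else 0"
  have "((\<lambda>m. ?c m * monom_at n p m z) has_sum a) {\<lambda>_. 0}"
    by (rule has_sum_finiteI) (simp_all add: monom_at_def)
  then show "((\<lambda>m. ?c m * monom_at n p m z) has_sum a) (multi_index n)"
    by (rule has_sum_cong_neutral[THEN iffD1, rotated -1]) (auto simp: multi_index_def)
qed

lemma entire_add:
  assumes "entire n f" "entire n g"
  shows "entire n (\<lambda>z. f z + g z)"
  unfolding entire_def
proof
  fix p assume "p \<in> Rn n"
  then obtain c d where c: "\<And>z. z \<in> Rn n \<Longrightarrow> ((\<lambda>m. c m * monom_at n p m z) has_sum f z) (multi_index n)"
    and d: "\<And>z. z \<in> Rn n \<Longrightarrow> ((\<lambda>m. d m * monom_at n p m z) has_sum g z) (multi_index n)"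
    using assms unfolding entire_def by blast
  have "((\<lambda>m. (c m + d m) * monom_at n p m z) has_sum (f z + g z)) (multi_index n)" if "z \<in> Rn n" for z
    using has_sum_add[OF c[OF that] d[OF that]] by (simp add: distrib_right)
  then show "\<exists>c. \<forall>z\<in>Rn n. ((\<lambda>m. c m * monom_at n p m z) has_sum (f z + g z)) (multi_index n)"
    by (intro exI[of _ "\<lambda>m. c m + d m"]) blast
qed

lemma entire_cmult:
  assumes "entire n f"
  shows "entire n (\<lambda>z. a * f z)"
  unfolding entire_def
proof
  fix p assume "p \<in> Rn n"
  then obtain c where c: "\<And>z. z \<in> Rn n \<Longrightarrow> ((\<lambda>m. c m * monom_at n p m z) has_sum f z) (multi_index n)"
    using assms unfolding entire_def by blast
  have "((\<lambda>m. (a * c m) * monom_at n p m z) has_sum (a * f z)) (multi_index n)" if "z \<in> Rn n" for z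
    using has_sum_cmult_right[OF c[OF that], of a] by (simp add: mult.assoc)
  then show "\<exists>c. \<forall>z\<in>Rn n. ((\<lambda>m. c m * monom_at n p m z) has_sum (a * f z)) (multi_index n)"
    by (intro exI[of _ "\<lambda>m. a * c m"]) blast
qed

text \<open>Multiplication by \<open>z\<^sub>i = p\<^sub>i + (z\<^sub>i - p\<^sub>i)\<close>: the second summand shifts the exponent of the \<open>i\<close>-th factor.\<close>

lemma entire_var_mult:
  assumes f: "entire n f" and i: "i < n"
  shows "entire n (\<lambda>z. z i * f z)"
  unfolding entire_def
proof
  fix p assume p: "p \<in> Rn n"
  then obtain c where c: "\<And>z. z \<in> Rn n \<Longrightarrow> ((\<lambda>m. c m * monom_at n p m z) has_sum f z) (multi_index n)"
    using f unfolding entire_def by blast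
  define up where "up m = m(i := Suc (m i))" for m :: "nat \<Rightarrow> nat"
  define d where "d m = (if m i = 0 then 0 else c (m(i := m i - 1)))" for m
  have up: "d (up m) = c m" "up m i \<noteq> 0" for m
    by (auto simp: up_def d_def)
  have inj: "inj_on up (multi_index n)"
    by (rule inj_onI) (metis diff_Suc_1 fun_upd_same fun_upd_triv fun_upd_upd up_def)
  have mono: "monom_at n p (up m) z = (z i - p i) * monom_at n p m z" for m z
    using i unfolding monom_at_def up_def
    by (simp add: prod.remove[of "{..<n}" i] mult.assoc)
  have img: "up ` multi_index n \<subseteq> multi_index n"
    using i by (auto simp: up_def multi_index_def)
  have out: "d m = 0" if "m \<in> multi_index n - up ` multi_index n" for m
  proof (rule ccontr)
    assume "d m \<noteq> 0"
    then have "m i \<noteq> 0" by (auto simp: d_def split: if_splits)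
    then have "m = up (m(i := m i - 1))" by (simp add: up_def)
    moreover have "m(i := m i - 1) \<in> multi_index n" using that i by (auto simp: multi_index_def)
    ultimately show False using that by blast
  qed
  have "((\<lambda>m. (d m + p i * c m) * monom_at n p m z) has_sum (z i * f z)) (multi_index n)"
    if z: "z \<in> Rn n" for z
  proof -
    have "((\<lambda>m. (z i - p i) * (c m * monom_at n p m z)) has_sum ((z i - p i) * f z)) (multi_index n)"
      by (rule has_sum_cmult_right[OF c[OF z]])
    then have "(((\<lambda>m. d m * monom_at n p m z) \<circ> up) has_sum ((z i - p i) * f z)) (multi_index n)"
      by (simp add: o_def mono up mult_ac)
    then have "((\<lambda>m. d m * monom_at n p m z) has_sum ((z i - p i) * f z)) (up ` multi_index n)"
      by (simp add: has_sum_reindex[OF inj])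
    then have "((\<lambda>m. d m * monom_at n p m z) has_sum ((z i - p i) * f z)) (multi_index n)"
      by (rule has_sum_cong_neutral[THEN iffD1, rotated -1]) (use out img in auto)
    from has_sum_add[OF this has_sum_cmult_right[OF c[OF z], of "p i"]]
    show ?thesis by (simp add: algebra_simps)
  qed
  then show "\<exists>c. \<forall>z\<in>Rn n. ((\<lambda>m. c m * monom_at n p m z) has_sum (z i * f z)) (multi_index n)"
    by (intro exI[of _ "\<lambda>m. d m + p i * c m"]) blast
qed

text \<open>
  The coefficient of the \<open>k\<close>-th power of \<open>z\<^sub>0 - p\<^sub>0\<close> is that of the exponential series, times the
  value at \<open>p\<close>; multi-indices of length one are identified with numbers.
\<close>

lemma entire_exp: "entire 1 (\<lambda>z. exp (a * z 0))"
  unfolding entire_def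
proof
  fix p :: "nat \<Rightarrow> real" assume "p \<in> Rn 1"
  define c where "c m = exp (a * p 0) * (a ^ m (0::nat) / fact (m 0))" for m :: "nat \<Rightarrow> nat"
  define e where "e k = (\<lambda>i::nat. if i = 0 then k else 0)" for k :: nat
  have bij: "multi_index 1 = range e" and inj: "inj e"
  proof -
    have "m = e (m 0)" if "m \<in> multi_index 1" for m
      using that by (auto simp: e_def multi_index_def fun_eq_iff)
    then show "multi_index 1 = range e" by (auto simp: e_def multi_index_def)
    show "inj e" by (rule injI) (metis e_def)
  qed
  have "((\<lambda>m. c m * monom_at 1 p m z) has_sum exp (a * z 0)) (multi_index 1)" for z
  proof -
    define t where "t = a * (z 0 - p 0)"
    have "(\<lambda>k. t ^ k /\<^sub>R fact k) sums exp t" by (rule exp_converges)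
    moreover have "summable (\<lambda>k. norm (t ^ k /\<^sub>R fact k))" by (rule summable_norm_exp)
    ultimately have "((\<lambda>k. t ^ k /\<^sub>R fact k) has_sum exp t) UNIV"
      by (intro norm_summable_imp_has_sum)
    from has_sum_cmult_right[OF this, of "exp (a * p 0)"]
    have "((\<lambda>k. c (e k) * monom_at 1 p (e k) z) has_sum exp (a * z 0)) UNIV"
      by (simp add: c_def e_def monom_at_def t_def power_mult_distrib divide_inverse mult_ac
          flip: exp_add, simp add: algebra_simps)
    then show ?thesis unfolding bij by (simp add: has_sum_reindex[OF inj] o_def)
  qed
  then show "\<exists>c. \<forall>z\<in>Rn 1. ((\<lambda>m. c m * monom_at 1 p m z) has_sum exp (a * z 0)) (multi_index 1)"
    by blast
qed

section \<open>The integrability conditions\<close>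

text \<open>
  An alternating 3-form in six dimensions has 20 independent components.
\<close>

lemma alternating_zero:
  fixes T :: "6 \<Rightarrow> 6 \<Rightarrow> 6 \<Rightarrow> real"
  assumes cyc: "\<And>l j k. T l j k = T j k l" and alt: "\<And>l j k. T l k j = - T l j k"
    and "T 1 2 3 = 0" "T 1 2 4 = 0" "T 1 2 5 = 0" "T 1 2 6 = 0" "T 1 3 4 = 0" "T 1 3 5 = 0"
      "T 1 3 6 = 0" "T 1 4 5 = 0" "T 1 4 6 = 0" "T 1 5 6 = 0" "T 2 3 4 = 0" "T 2 3 5 = 0"
      "T 2 3 6 = 0" "T 2 4 5 = 0" "T 2 4 6 = 0" "T 2 5 6 = 0" "T 3 4 5 = 0" "T 3 4 6 = 0"
      "T 3 5 6 = 0" "T 4 5 6 = 0"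
  shows "T l j k = 0"
proof -
  have diag: "T a a b = 0" "T a b a = 0" "T b a a = 0" for a b
    using cyc[of a a b] cyc[of a b a] alt[of a a b] by simp_all
  have perm: "T b c a = 0" "T c a b = 0" "T a c b = 0" "T c b a = 0" "T b a c = 0"
    if "T a b c = 0" for a b c
    using that cyc[of a b c] cyc[of b c a] alt[of a b c] alt[of b c a] alt[of c a b] by simp_all
  show ?thesis
    by (cases l rule: exhaust_6; cases j rule: exhaust_6; cases k rule: exhaust_6)
      (simp_all only: diag assms(3-) assms(3-)[THEN perm(1)] assms(3-)[THEN perm(2)]
        assms(3-)[THEN perm(3)] assms(3-)[THEN perm(4)] assms(3-)[THEN perm(5)])
qed

lemma redc_skew: "redc \<epsilon> p q r \<tau> a b i k j = - redc \<epsilon> p q r \<tau> a b i j k"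
  unfolding redc_def struct_def conn_def tors_def wdg_def by (simp add: algebra_simps)

text \<open>
  The left side of the Bianchi identity is alternating in \<open>l, j, k\<close>, which leaves 120 of its 1296
  instances.
\<close>

lemma bianchi_at_alternating:
  assumes skew: "\<And>i j k. c i k j = - c i j k" "\<And>l i j k. c' l i k j = - c' l i j k"
  assumes "bianchi_at c c' i 1 2 3" "bianchi_at c c' i 1 2 4" "bianchi_at c c' i 1 2 5"
    "bianchi_at c c' i 1 2 6" "bianchi_at c c' i 1 3 4" "bianchi_at c c' i 1 3 5"
    "bianchi_at c c' i 1 3 6" "bianchi_at c c' i 1 4 5" "bianchi_at c c' i 1 4 6"
    "bianchi_at c c' i 1 5 6" "bianchi_at c c' i 2 3 4" "bianchi_at c c' i 2 3 5"
    "bianchi_at c c' i 2 3 6" "bianchi_at c c' i 2 4 5" "bianchi_at c c' i 2 4 6"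
    "bianchi_at c c' i 2 5 6" "bianchi_at c c' i 3 4 5" "bianchi_at c c' i 3 4 6"
    "bianchi_at c c' i 3 5 6" "bianchi_at c c' i 4 5 6"
  shows "bianchi_at c c' i l j k"
proof -
  define T where "T l j k = c' l i j k + c' j i k l + c' k i l j
     + (\<Sum>m\<in>UNIV. c m l j * c i m k + c m j k * c i m l + c m k l * c i m j)" for l j k
  have cyc: "T l j k = T j k l" for l j k by (simp add: T_def add_ac)
  have alt: "T l k j = - T l j k" for l j k
  proof -
    have "(\<Sum>m\<in>UNIV. c m l k * c i m j + c m k j * c i m l + c m j l * c i m k)
      = - (\<Sum>m\<in>UNIV. c m l j * c i m k + c m j k * c i m l + c m k l * c i m j)"
      unfolding sum_negf[symmetric]
      by (intro sum.cong refl) (simp add: skew(1)[of _ l j] skew(1)[of _ k l] skew(1)[of _ j k])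
    then show ?thesis
      using skew(2)[of l i k j] skew(2)[of k i l j] skew(2)[of j i k l] by (simp add: T_def)
  qed
  have "bianchi_at c c' i l j k \<longleftrightarrow> T l j k = 0" for l j k by (simp add: T_def bianchi_at_def)
  then show ?thesis using alternating_zero[of T, OF cyc alt] assms(3-) by simp
qed

text \<open>
  The converse of \<open>invariants_derivatives\<close>: the derivatives found there satisfy the whole Bianchi
  identity for every choice of \<open>X\<^sub>4 r\<close> and \<open>X\<^sub>6 r\<close>. The case distinction turns \<open>s p = s q = 0\<close>
  into substitutions, so that only polynomial identities have to be checked.
\<close>

lemma integrability:
  assumes sp: "s * p = 0" "s * q = 0"
    and P: "p' 1 = 1 - p * q / 2 - p * p / 2 - r * s" "p' 2 = - 1 - p * q / 2 + p * p / 2 + r * s"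
      "p' 3 = q" "p' 4 = p * p / 2 - 1 + r * s" "p' 5 = q" "p' 6 = p * q / 2"
    and Q: "q' 1 = - 1 - p * q / 2 - q * q / 2 + r * s" "q' 2 = - 1 + p * q / 2 - q * q / 2 + r * s"
      "q' 3 = p" "q' 4 = p * q / 2" "q' 5 = p" "q' 6 = 1 + q * q / 2 - r * s"
    and R: "r' 1 = p - q - p * r - q * r" "r' 2 = - p - q + p * r - q * r"
      "r' 3 = 2 * (p * q)" "r' 5 = 2 * (p * q)"
  shows "bianchi_at (redc 1 p q r 0 s s) (\<lambda>l. redc 0 (p' l) (q' l) (r' l) 0 0 0) i l j k"
proof -
  have "s = 0 \<or> p = 0 \<and> q = 0" using sp by auto
  then show ?thesis
  proof
    assume s: "s = 0"
    show ?thesis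
      by (cases i rule: exhaust_6; rule bianchi_at_alternating)
        ((rule redc_skew)
         | (simp add: redc_simps s P Q R; (simp add: expand_simps; fail)?))+
  next
    assume pq: "p = 0 \<and> q = 0"
    show ?thesis
      by (cases i rule: exhaust_6; rule bianchi_at_alternating)
        ((rule redc_skew)
         | (simp add: redc_simps pq P Q R; (simp add: expand_simps; fail)?))+
  qed
qed

section \<open>The systems of structure equations\<close>

text \<open>
  The invariants \<open>a 0, a 1, a 2\<close> are \<open>p, q, r\<close>, and the free derivatives \<open>b 0, b 1\<close> are the
  coefficients of \<open>\<omega>\<^sup>4\<close> and \<open>\<omega>\<^sup>6\<close> in \<open>dr\<close>.
\<close>

definition gen_F :: "(nat \<Rightarrow> real) \<Rightarrow> (nat \<Rightarrow> real) \<Rightarrow> nat \<Rightarrow> 6 \<Rightarrow> real" where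
  "gen_F a b \<alpha> =
    (if \<alpha> = 0 then vec6 (1 - a 0 * a 1 / 2 - a 0 * a 0 / 2) (- 1 - a 0 * a 1 / 2 + a 0 * a 0 / 2) (a 1)
        (a 0 * a 0 / 2 - 1) (a 1) (a 0 * a 1 / 2)
     else if \<alpha> = 1 then vec6 (- 1 - a 0 * a 1 / 2 - a 1 * a 1 / 2) (- 1 + a 0 * a 1 / 2 - a 1 * a 1 / 2)
        (a 0) (a 0 * a 1 / 2) (a 0) (1 + a 1 * a 1 / 2)
     else vec6 (a 0 - a 1 - a 0 * a 2 - a 1 * a 2) (- a 0 - a 1 + a 0 * a 2 - a 1 * a 2)
        (2 * (a 0 * a 1)) (b 0) (2 * (a 0 * a 1)) (b 1))"

text \<open>
  The sign reflects that \<open>Tor\<close> enters \<open>d\<omega>\<^sup>i\<close> negatively.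
\<close>

definition gen_sys :: str_eqs where
  "gen_sys = \<lparr>ninv = 3, nfree = 2,
     Tor = \<lambda>a i j k. - redc 1 (a 0) (a 1) (a 2) 0 0 0 i j k, Fun = gen_F\<rparr>"

text \<open>
  The coframings with \<open>s \<noteq> 0\<close>, where \<open>c\<close> is the sign of \<open>s\<close>. The invariants of a system range over
  a full vector space, hence the half-line of values of \<open>s\<close> is parametrised by the exponential
  function.
\<close>

definition exc_sys :: "real \<Rightarrow> str_eqs" where
  "exc_sys c = \<lparr>ninv = 1, nfree = 0,
     Tor = \<lambda>a i j k. - redc 1 0 0 (c * exp (- a 0)) 0 (c * exp (a 0)) (c * exp (a 0)) i j k,
     Fun = \<lambda>_ _ _ _. 0\<rparr>"

lemma entire_var: "i < n \<Longrightarrow> entire n (\<lambda>z. z i)"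
  using entire_var_mult[OF entire_const[of n 1]] by simp

lemma entire_minus: "entire n f \<Longrightarrow> entire n (\<lambda>z. - f z)"
  using entire_cmult[of n f "-1"] by simp

lemma entire_diff: "entire n f \<Longrightarrow> entire n g \<Longrightarrow> entire n (\<lambda>z. f z - g z)"
  using entire_add[OF _ entire_minus] by simp

lemma entire_divide: "entire n f \<Longrightarrow> entire n (\<lambda>z. f z / c)"
  using entire_cmult[of n f "1 / c"] by simp

lemma gen_analytic: "analytic_eqs gen_sys"
  unfolding analytic_eqs_def
proof (intro conjI allI impI)
  show "real_analytic (ninv gen_sys) (\<lambda>a. Tor gen_sys a i j k)" for i j k
  proof (rule entire_imp_real_analytic)
    have "Tor gen_sys a i j k = - (1 * redc 1 0 0 0 0 0 0 i j k + (a 0 * redc 0 1 0 0 0 0 0 i j k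
       + (a 1 * redc 0 0 1 0 0 0 0 i j k + a 2 * redc 0 0 0 1 0 0 0 i j k)))" for a
      unfolding gen_sys_def by (simp add: redc_linear[of 1 "a 0" "a 1"] del: One_nat_def)
    then show "entire (ninv gen_sys) (\<lambda>a. Tor gen_sys a i j k)"
      by (simp only:) (intro entire_minus entire_add entire_const entire_var_mult; simp add: gen_sys_def)
  qed
  fix \<alpha> i assume "\<alpha> < ninv gen_sys"
  then have "\<alpha> < 3" by (simp add: gen_sys_def)
  have "entire 5 (\<lambda>z. gen_F (\<lambda>n. if n < 3 then z n else 0) (\<lambda>n. z (3 + n)) \<alpha> i)"
    by (cases "\<alpha> = 0"; cases "\<alpha> = 1"; cases i rule: exhaust_6)
      (simp_all add: gen_F_def del: One_nat_def,
       (intro entire_diff entire_add entire_minus entire_cmult entire_divide entire_const entire_var_mult entire_var; simp)+)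
  then show "real_analytic (ninv gen_sys + nfree gen_sys)
        (\<lambda>z. Fun gen_sys (\<lambda>n. if n < ninv gen_sys then z n else 0) (\<lambda>n. z (ninv gen_sys + n)) \<alpha> i)"
    by (intro entire_imp_real_analytic) (simp add: gen_sys_def)
qed

lemma exc_analytic: "analytic_eqs (exc_sys c)"
  unfolding analytic_eqs_def
proof (intro conjI allI impI)
  show "real_analytic (ninv (exc_sys c)) (\<lambda>a. Tor (exc_sys c) a i j k)" for i j k
  proof (rule entire_imp_real_analytic)
    have eq: "Tor (exc_sys c) a i j k = - (redc 1 0 0 0 0 0 0 i j k
       + ((c * redc 0 0 0 1 0 0 0 i j k) * exp (- 1 * a 0)
       + (c * (redc 0 0 0 0 0 1 0 i j k + redc 0 0 0 0 0 0 1 i j k)) * exp (1 * a 0)))" for a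
      unfolding exc_sys_def
      by (simp add: redc_linear[of 1 0 0 "c * exp (- a 0)"] algebra_simps)
    have n: "ninv (exc_sys c) = 1" by (simp add: exc_sys_def)
    show "entire (ninv (exc_sys c)) (\<lambda>a. Tor (exc_sys c) a i j k)"
      unfolding eq n by (intro entire_minus entire_add entire_const entire_cmult entire_exp)
  qed
qed (auto simp: exc_sys_def intro!: entire_imp_real_analytic entire_const)

lemma gen_skew: "skew_eqs gen_sys"
  by (simp add: skew_eqs_def gen_sys_def, intro ballI allI, rule redc_skew[symmetric])

lemma exc_skew: "skew_eqs (exc_sys c)"
  by (simp add: skew_eqs_def exc_sys_def, intro ballI allI, rule redc_skew[symmetric])

lemma pderiv_at_eqI:
  assumes "((\<lambda>t. f (z(i := t))) has_real_derivative D) (at (z i))"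
  shows "pderiv_at f i z = D"
  unfolding pderiv_at_def by (rule DERIV_imp_deriv[OF assms])

lemma gen_Tor_pderiv:
  "pderiv_at (\<lambda>a. Tor gen_sys a i j k) 0 a = - redc 0 1 0 0 0 0 0 i j k"
  "pderiv_at (\<lambda>a. Tor gen_sys a i j k) 1 a = - redc 0 0 1 0 0 0 0 i j k"
  "pderiv_at (\<lambda>a. Tor gen_sys a i j k) 2 a = - redc 0 0 0 1 0 0 0 i j k"
  by (rule pderiv_at_eqI, simp add: gen_sys_def del: One_nat_def, subst redc_linear,
      (rule derivative_eq_intros refl)+, simp)+

text \<open>
  The condition \<open>d\<^sup>2\<omega> = 0\<close> on a system is the Bianchi identity for \<open>- Tor\<close>, with derivatives
  computed by the chain rule.
\<close>

lemma ddomega_from_bianchi: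
  assumes "\<And>i j k. Tor \<Sigma> a i j k = - c i j k"
    and "\<And>i j k l. (\<Sum>\<alpha><ninv \<Sigma>. pderiv_at (\<lambda>a. Tor \<Sigma> a i j k) \<alpha> a * Fun \<Sigma> a b \<alpha> l) = - c' l i j k"
    and "bianchi_at c c' i l j k"
  shows "ddomega_term \<Sigma> a b i l j k + ddomega_term \<Sigma> a b i j k l + ddomega_term \<Sigma> a b i k l j = 0"
proof -
  have "ddomega_term \<Sigma> a b i l j k = - (c' l i j k + (\<Sum>m\<in>UNIV. c m l j * c i m k))" for l j k
    unfolding ddomega_term_def assms(2) by (simp add: assms(1) mult.commute)
  then show ?thesis
    using assms(3) unfolding bianchi_at_def sum.distrib by simp
qed

lemma gen_ddomega: "ddomega_vanishes gen_sys"
  unfolding ddomega_vanishes_def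
proof (intro ballI allI)
  fix a b :: "nat \<Rightarrow> real" and i l j k
  let ?c' = "\<lambda>l. redc 0 (gen_F a b 0 l) (gen_F a b 1 l) (gen_F a b 2 l) 0 0 0"
  show "ddomega_term gen_sys a b i l j k + ddomega_term gen_sys a b i j k l
      + ddomega_term gen_sys a b i k l j = 0"
  proof (rule ddomega_from_bianchi[where c = "redc 1 (a 0) (a 1) (a 2) 0 0 0" and c' = ?c'])
    show "bianchi_at (redc 1 (a 0) (a 1) (a 2) 0 0 0) ?c' i l j k"
      by (rule integrability) (simp_all add: gen_F_def)
    show "(\<Sum>\<alpha><ninv gen_sys. pderiv_at (\<lambda>a. Tor gen_sys a i j k) \<alpha> a * Fun gen_sys a b \<alpha> l) = - ?c' l i j k"
      for i j k l
    proof -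
      have [simp]: "ninv gen_sys = Suc (Suc (Suc 0))" "Fun gen_sys = gen_F" by (simp_all add: gen_sys_def)
      show ?thesis
        using gen_Tor_pderiv[of i j k a] redc_linear[of 0 "gen_F a b 0 l" "gen_F a b 1 l" "gen_F a b 2 l" 0 0 0 i j k]
        by (simp add: numeral_2_eq_2 algebra_simps)
    qed
  qed (simp add: gen_sys_def)
qed

lemma exc_ddomega:
  assumes "c * c = 1"
  shows "ddomega_vanishes (exc_sys c)"
  unfolding ddomega_vanishes_def
proof (intro ballI allI)
  fix a b :: "nat \<Rightarrow> real" and i l j k
  let ?r = "c * exp (- a 0)" and ?s = "c * exp (a 0)"
  have "?r * ?s = (c * c) * (exp (- a 0) * exp (a 0))" by (simp only: mult_ac)
  then have rs: "?r * ?s = 1" using assms by (simp add: exp_minus_inverse flip: exp_add)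
  show "ddomega_term (exc_sys c) a b i l j k + ddomega_term (exc_sys c) a b i j k l
      + ddomega_term (exc_sys c) a b i k l j = 0"
  proof (rule ddomega_from_bianchi[where c = "redc 1 0 0 ?r 0 ?s ?s" and c' = "\<lambda>l. redc 0 0 0 0 0 0 0"])
    show "bianchi_at (redc 1 0 0 ?r 0 ?s ?s) (\<lambda>l. redc 0 0 0 0 0 0 0) i l j k"
      by (rule integrability; (unfold rs)?; simp)
    show "(\<Sum>\<alpha><ninv (exc_sys c). pderiv_at (\<lambda>a. Tor (exc_sys c) a i j k) \<alpha> a * Fun (exc_sys c) a b \<alpha> l)
        = - redc 0 0 0 0 0 0 0 i j k" for i j k l
      using redc_linear[of 0 0 0 0 0 0 0 i j k] by (simp add: exc_sys_def)
  qed (simp add: exc_sys_def)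
qed

lemma DERIV_vec6:
  assumes "(a has_real_derivative a') (at x)" "(b has_real_derivative b') (at x)"
    "(c has_real_derivative c') (at x)"
    "(d has_real_derivative d') (at x)" "(e has_real_derivative e') (at x)"
    "(f has_real_derivative f') (at x)"
  shows "((\<lambda>t. vec6 (a t) (b t) (c t) (d t) (e t) (f t) k) has_real_derivative vec6 a' b' c' d' e' f' k) (at x)"
  unfolding vec6_def by (intro DERIV_add DERIV_cmult_right assms)

lemma gen_F_pderiv:
  "pderiv_at (\<lambda>a. gen_F a b 0 k) 0 a = vec6 (- a 1 / 2 - a 0) (- a 1 / 2 + a 0) 0 (a 0) 0 (a 1 / 2) k"
  "pderiv_at (\<lambda>a. gen_F a b 0 k) 1 a = vec6 (- a 0 / 2) (- a 0 / 2) 1 0 1 (a 0 / 2) k"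
  "pderiv_at (\<lambda>a. gen_F a b 0 k) 2 a = vec6 0 0 0 0 0 0 k"
  "pderiv_at (\<lambda>a. gen_F a b 1 k) 0 a = vec6 (- a 1 / 2) (a 1 / 2) 1 (a 1 / 2) 1 0 k"
  "pderiv_at (\<lambda>a. gen_F a b 1 k) 1 a = vec6 (- a 0 / 2 - a 1) (a 0 / 2 - a 1) 0 (a 0 / 2) 0 (a 1) k"
  "pderiv_at (\<lambda>a. gen_F a b 1 k) 2 a = vec6 0 0 0 0 0 0 k"
  "pderiv_at (\<lambda>a. gen_F a b 2 k) 0 a = vec6 (1 - a 2) (- 1 + a 2) (2 * a 1) 0 (2 * a 1) 0 k"
  "pderiv_at (\<lambda>a. gen_F a b 2 k) 1 a = vec6 (- 1 - a 2) (- 1 - a 2) (2 * a 0) 0 (2 * a 0) 0 k"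
  "pderiv_at (\<lambda>a. gen_F a b 2 k) 2 a = vec6 (- a 0 - a 1) (a 0 - a 1) 0 0 0 0 k"
  by (rule pderiv_at_eqI, simp add: gen_F_def del: One_nat_def, rule DERIV_vec6;
      rule DERIV_cong, (rule DERIV_add DERIV_diff DERIV_minus DERIV_mult DERIV_cdivide DERIV_ident DERIV_const)+,
      simp add: add_divide_distrib)+

lemma gen_F_pderiv_free:
  "pderiv_at (\<lambda>b. gen_F a b 0 k) \<rho> b = 0"
  "pderiv_at (\<lambda>b. gen_F a b 1 k) \<rho> b = 0"
  "pderiv_at (\<lambda>b. gen_F a b 2 k) 0 b = vec6 0 0 0 1 0 0 k"
  "pderiv_at (\<lambda>b. gen_F a b 2 k) 1 b = vec6 0 0 0 0 0 1 k"
proof -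
  show "pderiv_at (\<lambda>b. gen_F a b 0 k) \<rho> b = 0" "pderiv_at (\<lambda>b. gen_F a b 1 k) \<rho> b = 0"
    by (rule pderiv_at_eqI, simp add: gen_F_def)+
  show "pderiv_at (\<lambda>b. gen_F a b 2 k) 0 b = vec6 0 0 0 1 0 0 k"
    "pderiv_at (\<lambda>b. gen_F a b 2 k) 1 b = vec6 0 0 0 0 0 1 k"
    by (rule pderiv_at_eqI, simp add: gen_F_def del: One_nat_def, rule DERIV_vec6;
      ((rule derivative_eq_intros refl)+)?; simp del: One_nat_def)+
qed

lemma antisymmetric_zero:
  fixes E :: "6 \<Rightarrow> 6 \<Rightarrow> real"
  assumes alt: "\<And>j k. E k j = - E j k"
    and "E 1 2 = 0" "E 1 3 = 0" "E 1 4 = 0" "E 1 5 = 0" "E 1 6 = 0" "E 2 3 = 0" "E 2 4 = 0"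
      "E 2 5 = 0" "E 2 6 = 0" "E 3 4 = 0" "E 3 5 = 0" "E 3 6 = 0" "E 4 5 = 0" "E 4 6 = 0" "E 5 6 = 0"
  shows "E j k = 0"
proof -
  have diag: "E j j = 0" for j using alt[of j j] by simp
  have swap: "E k j = 0" if "E j k = 0" for j k using alt[of k j] that by simp
  show ?thesis
    by (cases j rule: exhaust_6; cases k rule: exhaust_6)
      (simp_all only: diag assms(2-) assms(2-)[THEN swap])
qed

text \<open>
  The components of \<open>du\<close> and \<open>dv\<close>. The equation \<open>d\<^sup>2r = 0\<close> is linear in them and determines all
  but \<open>u\<^sub>4\<close>, \<open>v\<^sub>6\<close> and one of \<open>u\<^sub>6\<close> and \<open>v\<^sub>4\<close>; these three are set to zero, in the last case
  \<open>u\<^sub>6\<close>.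
\<close>

definition gen_G :: "(nat \<Rightarrow> real) \<Rightarrow> (nat \<Rightarrow> real) \<Rightarrow> nat \<Rightarrow> 6 \<Rightarrow> real" where
  "gen_G a b \<rho> = (let p = a 0; q = a 1; r = a 2; u = b 0; v = b 1 in
     if \<rho> = 0 then vec6 (- 1 + r - 2 * (p * q) - 3 / 2 * (p * u) - 3 / 2 * (q * u))
         (1 - r - 2 * (p * q) + 3 / 2 * (p * u) - 3 / 2 * (q * u)) (- v + 2 * (q * r) + 2 * (p * p * q))
         0 (- 2 * q + v + 2 * (p * p * q)) 0
     else vec6 (- 1 - r + 2 * (p * q) - 3 / 2 * (p * v) - 3 / 2 * (q * v))
         (- 1 - r - 2 * (p * q) + 3 / 2 * (p * v) - 3 / 2 * (q * v)) (2 * p + u + 2 * (p * q * q))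
         (q * u / 2 - p * v / 2) (- u + 2 * (p * r) + 2 * (p * q * q)) 0)"

lemma gen_dda: "dda_vanishes gen_sys"
  unfolding dda_vanishes_def
proof (intro exI[of _ gen_G] ballI allI impI)
  fix a b :: "nat \<Rightarrow> real" and \<alpha> j k
  assume "\<alpha> < ninv gen_sys"
  then have \<alpha>: "\<alpha> = 0 \<or> \<alpha> = 1 \<or> \<alpha> = 2" by (auto simp: gen_sys_def)
  define E where "E \<alpha> j k = total_deriv gen_sys (gen_G a b) a b \<alpha> k j - total_deriv gen_sys (gen_G a b) a b \<alpha> j k
        - (\<Sum>m\<in>UNIV. Fun gen_sys a b \<alpha> m * Tor gen_sys a m j k)" for \<alpha> j k
  have td: "total_deriv gen_sys g a b \<alpha> k j =
      pderiv_at (\<lambda>a. gen_F a b \<alpha> k) 0 a * gen_F a b 0 j + pderiv_at (\<lambda>a. gen_F a b \<alpha> k) 1 a * gen_F a b 1 j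
      + pderiv_at (\<lambda>a. gen_F a b \<alpha> k) 2 a * gen_F a b 2 j
      + (pderiv_at (\<lambda>b. gen_F a b \<alpha> k) 0 b * g 0 j + pderiv_at (\<lambda>b. gen_F a b \<alpha> k) 1 b * g 1 j)"
    for g \<alpha> j k
    unfolding total_deriv_def by (simp add: gen_sys_def numeral_3_eq_3 numeral_2_eq_2)
  have E: "E \<alpha> j k = total_deriv gen_sys (gen_G a b) a b \<alpha> k j - total_deriv gen_sys (gen_G a b) a b \<alpha> j k
        + (\<Sum>m\<in>UNIV. gen_F a b \<alpha> m * redc 1 (a 0) (a 1) (a 2) 0 0 0 m j k)" for \<alpha> j k
    unfolding E_def by (simp add: gen_sys_def sum_negf)
  have alt: "E \<alpha> k j = - E \<alpha> j k" for \<alpha> j k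
    unfolding E by (simp add: redc_skew[where j = j and k = k] sum_negf)
  define p q r u v where "p = a 0" and "q = a 1" and "r = a 2" and "u = b 0" and "v = b 1"
  note abs = p_def[symmetric] q_def[symmetric] r_def[symmetric] u_def[symmetric] v_def[symmetric]
  \<comment> \<open>Partial derivatives are evaluated before the coefficients are unfolded underneath them.\<close>
  note E' = E[of 0, unfolded td gen_F_pderiv gen_F_pderiv_free] E[of 1, unfolded td gen_F_pderiv gen_F_pderiv_free]
    E[of 2, unfolded td gen_F_pderiv gen_F_pderiv_free]
  note simps = E' gen_F_def gen_G_def Let_def sum_6 redc_simps abs
  have "E 0 j k = 0"
    by (rule antisymmetric_zero[of "E 0", OF alt])
      (simp add: simps del: One_nat_def; (simp add: expand_simps)?)+
  moreover have "E 1 j k = 0"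
    by (rule antisymmetric_zero[of "E 1", OF alt])
      (simp add: simps del: One_nat_def; (simp add: expand_simps)?)+
  moreover have "E 2 j k = 0"
    by (rule antisymmetric_zero[of "E 2", OF alt])
      (simp add: simps del: One_nat_def; (simp add: expand_simps)?)+
  ultimately show "total_deriv gen_sys (gen_G a b) a b \<alpha> k j - total_deriv gen_sys (gen_G a b) a b \<alpha> j k
        - (\<Sum>m\<in>UNIV. Fun gen_sys a b \<alpha> m * Tor gen_sys a m j k) = 0"
    using \<alpha> by (auto simp: E_def)
qed

lemma exc_dda: "dda_vanishes (exc_sys c)"
  unfolding dda_vanishes_def by (simp add: total_deriv_def exc_sys_def pderiv_at_def)

section \<open>Solutions in terms of the dual frame\<close>

text \<open>
  The factor \<open>1/2\<close> is compensated by the two orders of each pair of indices.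
\<close>

lemma torsion_form_iff:
  assumes cof: "coframing U \<omega>" and x: "x \<in> U" and skew: "\<And>j k. C j k = - C k j"
  shows "d1 (\<omega> i) x = - ((1/2) *\<^sub>R (\<Sum>j\<in>UNIV. \<Sum>k\<in>UNIV. C j k *\<^sub>R (\<omega> j x \<^bold>\<and> \<omega> k x)))
    \<longleftrightarrow> (\<forall>j k. strf \<omega> i j k x = - C j k)" (is "?l = ?r \<longleftrightarrow> _")
proof -
  have ev: "ev2 ?r (dual \<omega> a x) (dual \<omega> b x) = - C a b" for a b
  proof -
    have "ev2 ?r (dual \<omega> a x) (dual \<omega> b x)
      = - (1/2 * (\<Sum>j\<in>UNIV. \<Sum>k\<in>UNIV. C j k * ((if j = a then 1 else 0) * (if k = b then 1 else 0)
          - (if j = b then 1 else 0) * (if k = a then 1 else 0))))"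
      by (simp only: ev2_linear ev2_sum ev2_wedge coframe_inner_dual[OF cof x])
    also have "(\<Sum>j\<in>UNIV. \<Sum>k\<in>UNIV. C j k * ((if j = a then 1 else 0) * (if k = b then 1 else 0)
          - (if j = b then 1 else 0) * (if k = a then 1 else 0)))
        = (\<Sum>j\<in>UNIV. (if j = a then C j b else 0) - (if j = b then C j a else 0))"
    proof (rule sum.cong[OF refl])
      fix j
      have "(\<Sum>k\<in>UNIV. C j k * ((if j = a then 1 else 0) * (if k = b then 1 else 0)
          - (if j = b then 1 else 0) * (if k = a then 1 else 0)))
        = (\<Sum>k\<in>UNIV. (if k = b then (if j = a then C j k else 0) else 0)
            - (if k = a then (if j = b then C j k else 0) else 0))"
        by (rule sum.cong) auto
      then show "(\<Sum>k\<in>UNIV. C j k * ((if j = a then 1 else 0) * (if k = b then 1 else 0)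
          - (if j = b then 1 else 0) * (if k = a then 1 else 0)))
        = (if j = a then C j b else 0) - (if j = b then C j a else 0)"
        by (simp add: sum_subtractf)
    qed
    also have "\<dots> = C a b - C b a" by (simp add: sum_subtractf)
    finally show ?thesis using skew[of a b] by simp
  qed
  show ?thesis
  proof
    assume eq: "?l = ?r"
    show "\<forall>j k. strf \<omega> i j k x = - C j k"
      unfolding strf_def eq by (simp only: ev simp_thms)
  next
    assume "\<forall>j k. strf \<omega> i j k x = - C j k"
    then show "?l = ?r"
      by (intro ev2_eqI[OF cof x]) (simp only: ev strf_def)
  qed
qed

lemma differential_iff:
  assumes cof: "coframing U \<omega>" and x: "x \<in> U"
  shows "d0 f x = (\<Sum>i\<in>UNIV. F i *\<^sub>R \<omega> i x) \<longleftrightarrow> (\<forall>l. fder \<omega> l f x = F l)"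
proof -
  have F: "(\<Sum>i\<in>UNIV. F i *\<^sub>R \<omega> i x) \<bullet> dual \<omega> l x = F l" for l
    unfolding inner_sum_left inner_scaleR_left coframe_inner_dual[OF cof x]
    by (simp add: if_distrib cong: if_cong)
  show ?thesis
  proof
    assume eq: "d0 f x = (\<Sum>i\<in>UNIV. F i *\<^sub>R \<omega> i x)"
    show "\<forall>l. fder \<omega> l f x = F l" unfolding fder_eq_inner eq F by simp
  next
    assume "\<forall>l. fder \<omega> l f x = F l"
    then show "d0 f x = (\<Sum>i\<in>UNIV. F i *\<^sub>R \<omega> i x)"
      by (intro covector_eqI[OF cof x]) (simp only: F fder_eq_inner)
  qed
qed

text \<open>
  Solutions are characterised by structure functions and frame derivatives, so that no
  differential forms are needed any more.
\<close>

lemma solution_iff: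
  assumes "skew_eqs \<Sigma>"
  shows "solution \<Sigma> U \<omega> a b \<longleftrightarrow> coframing U \<omega> \<and>
     (\<forall>n. smooth_on U (\<lambda>x. a x n) \<and> smooth_on U (\<lambda>x. b x n)) \<and>
     (\<forall>x\<in>U. a x \<in> Rn (ninv \<Sigma>) \<and> b x \<in> Rn (nfree \<Sigma>) \<and>
        (\<forall>i j k. strf \<omega> i j k x = - Tor \<Sigma> (a x) i j k) \<and>
        (\<forall>\<alpha><ninv \<Sigma>. \<forall>l. fder \<omega> l (\<lambda>y. a y \<alpha>) x = Fun \<Sigma> (a x) (b x) \<alpha> l))"
proof -
  have "(\<forall>i. d1 (\<omega> i) x =
           - ((1/2) *\<^sub>R (\<Sum>j\<in>UNIV. \<Sum>k\<in>UNIV. Tor \<Sigma> (a x) i j k *\<^sub>R (\<omega> j x \<^bold>\<and> \<omega> k x))))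
      \<longleftrightarrow> (\<forall>i j k. strf \<omega> i j k x = - Tor \<Sigma> (a x) i j k)"
    if "coframing U \<omega>" "x \<in> U" "a x \<in> Rn (ninv \<Sigma>)" for x
  proof -
    have "Tor \<Sigma> (a x) i j k = - Tor \<Sigma> (a x) i k j" for i j k
      using assms that(3) unfolding skew_eqs_def by blast
    then show ?thesis using torsion_form_iff[OF that(1,2), of "Tor \<Sigma> (a x) i" i for i] by blast
  qed
  then show ?thesis
    unfolding solution_def by (auto simp: differential_iff[of U \<omega>])
qed

text \<open>
  Since \<open>p, q, r, s\<close> are themselves structure functions up to sign, they are smooth and determined
  by the coframing.
\<close>

lemma redc_entries:
  "redc 1 p q r 0 s s 5 4 5 = - p" "redc 1 p q r 0 s s 5 3 6 = - q"
  "redc 1 p q r 0 s s 5 4 6 = - r" "redc 1 p q r 0 s s 4 2 3 = - s"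
  by (simp_all add: redc_simps)

lemma Rn_eqI: "a \<in> Rn n \<Longrightarrow> a' \<in> Rn n \<Longrightarrow> (\<And>i. i < n \<Longrightarrow> a i = a' i) \<Longrightarrow> a = a'"
  unfolding Rn_def by (rule ext) (metis (mono_tags, lifting) mem_Collect_eq not_le)

text \<open>
  The structure functions determine \<open>a\<close>, and then the derivatives of \<open>a 2\<close> along \<open>X\<^sub>4\<close> and \<open>X\<^sub>6\<close>
  determine \<open>b\<close>.
\<close>

lemma gen_invariants: "invariants_determined gen_sys"
  unfolding invariants_determined_def
proof (intro allI impI ballI)
  fix U \<omega> a b a' b' x
  assume sol: "solution gen_sys U \<omega> a b" "solution gen_sys U \<omega> a' b'" and x: "x \<in> U"
  have U: "open U" using sol coframing_open by (auto simp: solution_def)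
  have S: "redc 1 (a y 0) (a y 1) (a y 2) 0 0 0 i j k = redc 1 (a' y 0) (a' y 1) (a' y 2) 0 0 0 i j k"
    if "y \<in> U" for y i j k
    using sol that unfolding solution_iff[OF gen_skew] by (simp add: gen_sys_def)
  have a: "a y = a' y" if y: "y \<in> U" for y
  proof (rule Rn_eqI)
    show "a y \<in> Rn 3" "a' y \<in> Rn 3" using sol y by (simp_all add: solution_def gen_sys_def)
    have "a y 0 = a' y 0" "a y 1 = a' y 1" "a y 2 = a' y 2"
      using S[OF y, of 5 4 5] S[OF y, of 5 3 6] S[OF y, of 5 4 6] by (simp_all only: redc_entries)
    then show "a y i = a' y i" if "i < 3" for i
      using that by (auto simp: less_Suc_eq numeral_3_eq_3 numeral_2_eq_2)
  qed
  have F: "gen_F (a x) (b x) 2 l = gen_F (a' x) (b' x) 2 l" for l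
  proof -
    have "fder \<omega> l (\<lambda>y. a y 2) x = fder \<omega> l (\<lambda>y. a' y 2) x"
      by (rule fder_local_cong[OF U x]) (simp add: a)
    then show ?thesis
      using sol x unfolding solution_iff[OF gen_skew] by (simp add: gen_sys_def)
  qed
  have "b x = b' x"
  proof (rule Rn_eqI)
    show "b x \<in> Rn 2" "b' x \<in> Rn 2" using sol x by (simp_all add: solution_def gen_sys_def)
    have "b x 0 = b' x 0" "b x 1 = b' x 1" using F[of 4] F[of 6] by (simp_all add: gen_F_def del: One_nat_def)
    then show "b x i = b' x i" if "i < 2" for i
      using that by (auto simp: less_Suc_eq numeral_2_eq_2)
  qed
  then show "a x = a' x \<and> b x = b' x" using a[OF x] by simp
qed

lemma exc_invariants:
  assumes "c \<noteq> 0"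
  shows "invariants_determined (exc_sys c)"
  unfolding invariants_determined_def
proof (intro allI impI ballI)
  fix U \<omega> a b a' b' x
  assume sol: "solution (exc_sys c) U \<omega> a b" "solution (exc_sys c) U \<omega> a' b'" and x: "x \<in> U"
  have "redc 1 0 0 (c * exp (- a x 0)) 0 (c * exp (a x 0)) (c * exp (a x 0)) 4 2 3
      = redc 1 0 0 (c * exp (- a' x 0)) 0 (c * exp (a' x 0)) (c * exp (a' x 0)) 4 2 3"
    using sol x unfolding solution_iff[OF exc_skew] by (simp add: exc_sys_def)
  then have "a x 0 = a' x 0" using assms unfolding redc_entries by simp
  moreover have "a x \<in> Rn 1" "a' x \<in> Rn 1" "b x \<in> Rn 0" "b' x \<in> Rn 0"
    using sol x by (simp_all add: solution_def exc_sys_def)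
  ultimately show "a x = a' x \<and> b x = b' x"
    by (auto intro!: Rn_eqI[of "a x" 1] Rn_eqI[of "b x" 0])
qed

section \<open>The tableau and its Cartan characters\<close>

lemma sum_fun_apply: "(\<Sum>i\<in>A. f i) y = (\<Sum>i\<in>A. f i y)" for f :: "'a \<Rightarrow> 'b \<Rightarrow> real"
  by (induction A rule: infinite_finite_induct) auto

text \<open>
  Evaluation at \<open>y j\<close> isolates the coefficient of \<open>f j\<close>, so the functions \<open>f j\<close> form a basis.
\<close>

lemma dim_dual_points:
  fixes f :: "nat \<Rightarrow> 'i \<Rightarrow> real"
  assumes f: "\<And>i j. i < n \<Longrightarrow> j < n \<Longrightarrow> f i (y j) = (if i = j then 1 else 0)"
    and V: "\<And>g. g \<in> V \<longleftrightarrow> (\<exists>c. g = (\<lambda>x. \<Sum>i<n. c i * f i x))"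
  shows "fun_space.dim V = n"
proof -
  let ?B = "f ` {..<n}"
  have inj: "inj_on f {..<n}"
    by (rule inj_onI) (metis f lessThan_iff one_neq_zero)
  show ?thesis
  proof (rule fun_space.dim_unique)
    show "?B \<subseteq> V"
    proof clarify
      fix j assume "j < n"
      then have "f j = (\<lambda>x. \<Sum>i<n. (if i = j then 1 else 0) * f i x)"
        by (simp add: if_distrib[of "\<lambda>c. c * _"] cong: if_cong)
      then show "f j \<in> V" unfolding V by (intro exI[of _ "\<lambda>i. if i = j then 1 else 0"])
    qed
    show "V \<subseteq> fun_space.span ?B"
    proof
      fix g assume "g \<in> V"
      then obtain c where "g = (\<lambda>x. \<Sum>i<n. c i * f i x)" using V by blast
      then have "g = (\<Sum>i<n. (\<lambda>x. c i * f i x))" by (simp add: fun_eq_iff sum_fun_apply)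
      also have "\<dots> \<in> fun_space.span ?B"
        by (intro fun_space.span_sum fun_space.span_scale fun_space.span_base) simp
      finally show "g \<in> fun_space.span ?B" .
    qed
    show "fun_space.independent ?B"
    proof
      assume "fun_space.dependent ?B"
      then obtain u v where u: "v \<in> ?B" "u v \<noteq> 0" "(\<Sum>v\<in>?B. (\<lambda>i. u v * v i)) = 0"
        using fun_space.dependent_finite[of ?B] by auto
      then obtain j where j: "j < n" "v = f j" by auto
      have "0 = (\<Sum>v\<in>?B. (\<lambda>i. u v * v i)) (y j)" using u(3) by simp
      also have "\<dots> = (\<Sum>i<n. u (f i) * f i (y j))"
        by (simp add: sum_fun_apply sum.reindex[OF inj])
      also have "\<dots> = (\<Sum>i<n. if i = j then u (f i) else 0)"
        by (rule sum.cong) (use f j in auto)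
      also have "\<dots> = u v" using j by simp
      finally show False using u(2) by simp
    qed
    show "card ?B = n" by (simp add: card_image[OF inj])
  qed
qed

lemma dim_le_generators:
  assumes "\<And>g. g \<in> V \<Longrightarrow> \<exists>c. g = (\<lambda>x. \<Sum>i<n. c i * f i x)"
  shows "fun_space.dim V \<le> n"
proof -
  have "V \<subseteq> fun_space.span (f ` {..<n})"
  proof
    fix g assume "g \<in> V"
    then obtain c where "g = (\<lambda>x. \<Sum>i<n. c i * f i x)" using assms by blast
    then have "g = (\<Sum>i<n. (\<lambda>x. c i * f i x))" by (simp add: fun_eq_iff sum_fun_apply)
    also have "\<dots> \<in> fun_space.span (f ` {..<n})"
      by (intro fun_space.span_sum fun_space.span_scale fun_space.span_base) simp
    finally show "g \<in> fun_space.span (f ` {..<n})" .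
  qed
  then have "fun_space.dim V \<le> card (f ` {..<n})" by (intro fun_space.dim_le_card) auto
  also have "\<dots> \<le> n" using card_image_le[of "{..<n}" f] by simp
  finally show ?thesis .
qed

text \<open>
  The homomorphism with third component \<open>u \<omega>\<^sup>4 + v \<omega>\<^sup>6\<close> and all others zero.
\<close>

definition gen_el :: "real \<Rightarrow> real \<Rightarrow> nat \<times> 6 \<Rightarrow> real" where
  "gen_el u v = (\<lambda>(\<alpha>, i). if \<alpha> = 2 then vec6 0 0 0 u 0 v i else 0)"

lemma gen_tableau: "tableau gen_sys a b = {gen_el u v | u v. True}"
proof -
  let ?g = "\<lambda>\<rho>. (\<lambda>(\<alpha>, i). if \<alpha> < ninv gen_sys then pderiv_at (\<lambda>b. Fun gen_sys a b \<alpha> i) \<rho> b else 0)"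
  have g: "?g \<rho> = (if \<rho> = 0 then gen_el 1 0 else gen_el 0 1)" if "\<rho> = 0 \<or> \<rho> = 1" for \<rho>
  proof (intro ext, clarify)
    fix \<alpha> :: nat and i :: 6
    have "\<alpha> = 0 \<or> \<alpha> = 1 \<or> \<alpha> = 2 \<or> \<alpha> \<ge> 3" by arith
    then show "(if \<alpha> < ninv gen_sys then pderiv_at (\<lambda>b. Fun gen_sys a b \<alpha> i) \<rho> b else 0)
        = (if \<rho> = 0 then gen_el 1 0 else gen_el 0 1) (\<alpha>, i)"
      using that by (elim disjE) (simp_all add: gen_sys_def gen_F_pderiv_free gen_el_def del: One_nat_def)
  qed
  have free: "\<rho> < nfree gen_sys \<longleftrightarrow> \<rho> = 0 \<or> \<rho> = 1" for \<rho>
    by (auto simp: gen_sys_def)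
  have "{h \<rho> | \<rho>. \<rho> < nfree gen_sys} = {h 0, h 1}" for h :: "nat \<Rightarrow> nat \<times> 6 \<Rightarrow> real"
    unfolding free by blast
  then have "{?g \<rho> | \<rho>. \<rho> < nfree gen_sys} = {?g 0, ?g 1}" .
  also have "\<dots> = {gen_el 1 0, gen_el 0 1}"
    using g[of 0] g[of 1] by (simp only: simp_thms if_True if_False zero_neq_one[symmetric] one_neq_zero)
  finally have "tableau gen_sys a b = fun_space.span {gen_el 1 0, gen_el 0 1}"
    unfolding tableau_def by simp
  also have "\<dots> = {gen_el u v | u v. True}"
  proof -
    have "gen_el u v \<in> fun_space.span {gen_el 1 0, gen_el 0 1}" for u v
    proof -
      have "gen_el u v = (\<lambda>i. u * gen_el 1 0 i) + (\<lambda>i. v * gen_el 0 1 i)"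
        by (auto simp: gen_el_def vec6_def fun_eq_iff)
      then show ?thesis
        by (simp only:) (intro fun_space.span_add fun_space.span_scale fun_space.span_base; simp)
    qed
    moreover have "fun_space.subspace {gen_el u v | u v. True}"
    proof (rule fun_space.subspaceI)
      show "0 \<in> {gen_el u v | u v. True}"
        by (intro CollectI exI[of _ 0]) (auto simp: gen_el_def vec6_def fun_eq_iff)
    next
      fix x y assume "x \<in> {gen_el u v | u v. True}" "y \<in> {gen_el u v | u v. True}"
      then obtain u v u' v' where "x = gen_el u v" "y = gen_el u' v'" by auto
      then have "x + y = gen_el (u + u') (v + v')"
        by (auto simp: gen_el_def vec6_def fun_eq_iff distrib_right)
      then show "x + y \<in> {gen_el u v | u v. True}" by blast
    next
      fix c x assume "x \<in> {gen_el u v | u v. True}"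
      then obtain u v where "x = gen_el u v" by auto
      then have "(\<lambda>i. c * x i) = gen_el (c * u) (c * v)"
        by (auto simp: gen_el_def vec6_def fun_eq_iff distrib_left)
      then show "(\<lambda>i. c * x i) \<in> {gen_el u v | u v. True}" by blast
    qed
    moreover have "{gen_el 1 0, gen_el 0 1} \<subseteq> {gen_el u v | u v. True}" by blast
    ultimately show ?thesis by (intro equalityI fun_space.span_minimal) auto
  qed
  finally show ?thesis .
qed

lemma char_sum_eqI:
  assumes "\<And>v. fun_space.dim (restrict_hom k v ` T) \<le> n" "fun_space.dim (restrict_hom k w ` T) = n"
  shows "char_sum T k = n"
  unfolding char_sum_def
proof (rule Max_eqI)
  have "{fun_space.dim (restrict_hom k v ` T) | v. True} \<subseteq> {..n}" using assms(1) by auto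
  then show "finite {fun_space.dim (restrict_hom k v ` T) | v. True}" by (rule finite_subset) simp
qed (use assms in auto)

lemma restrict_gen_el:
  "restrict_hom k w (gen_el u v) = (\<lambda>(\<alpha>, m). if m < k \<and> \<alpha> = 2 then u * w m $ 4 + v * w m $ 6 else 0)"
  by (auto simp: restrict_hom_def gen_el_def sum_6 fun_eq_iff)

text \<open>
  An element of the tableau restricts to the numbers \<open>u w\<^sup>4 + v w\<^sup>6\<close>, one for each vector \<open>w\<close> of
  the flag. There are at most \<open>k\<close> of them and two parameters; vectors dual to \<open>\<omega>\<^sup>4\<close> and \<open>\<omega>\<^sup>6\<close>
  attain the bound.
\<close>

lemma gen_char_sum: "char_sum {gen_el u v | u v. True} k = min k 2"
proof -
  let ?T = "{gen_el u v | u v. True}"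
  let ?e = "\<lambda>n. (\<lambda>(\<alpha>::nat, m::nat). if m = n \<and> \<alpha> = 2 then 1 else 0 :: real)"
  define w :: "nat \<Rightarrow> real^6" where "w m = (if m = 0 then axis 4 1 else axis 6 1)" for m
  define k' where "k' = min k 2"
  have upper: "fun_space.dim (restrict_hom k w ` ?T) \<le> k'" for w
  proof (cases "k \<le> 2")
    case True
    have "\<exists>c. g = (\<lambda>x. \<Sum>i<k. c i * ?e i x)" if mem: "g \<in> restrict_hom k w ` ?T" for g
    proof -
      obtain u v where g: "g = restrict_hom k w (gen_el u v)" using mem by auto
      have "g = (\<lambda>x. \<Sum>i<k. (u * w i $ 4 + v * w i $ 6) * ?e i x)"
        unfolding g restrict_gen_el
        by (auto simp: fun_eq_iff if_distrib[of "\<lambda>c. _ * c"] cong: if_cong)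
      then show ?thesis by (rule exI[where P = "\<lambda>c. g = (\<lambda>x. \<Sum>i<k. c i * ?e i x)"])
    qed
    then show ?thesis using True dim_le_generators[where V = "restrict_hom k w ` ?T" and n = k and f = ?e] by (simp add: k'_def)
  next
    case False
    let ?f = "\<lambda>n::nat. restrict_hom k w (if n = 0 then gen_el 1 0 else gen_el 0 1)"
    have "\<exists>c. g = (\<lambda>x. \<Sum>i<2. c i * ?f i x)" if mem: "g \<in> restrict_hom k w ` ?T" for g
    proof -
      obtain u v where g: "g = restrict_hom k w (gen_el u v)" using mem by auto
      have "g = (\<lambda>x. \<Sum>i<2. (if i = 0 then u else v) * ?f i x)"
        unfolding g restrict_gen_el
        by (auto simp: fun_eq_iff numeral_2_eq_2 restrict_gen_el)
      then show ?thesis by (rule exI[where P = "\<lambda>c. g = (\<lambda>x. \<Sum>i<2. c i * ?f i x)"])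
    qed
    then show ?thesis using False dim_le_generators[where V = "restrict_hom k w ` ?T" and n = 2 and f = ?f] by (simp add: k'_def)
  qed
  have "fun_space.dim (restrict_hom k w ` ?T) = k'"
  proof (rule dim_dual_points[where f = "\<lambda>n. if n = 0 then restrict_hom k w (gen_el 1 0) else restrict_hom k w (gen_el 0 1)" and y = "\<lambda>n. (2, n)"])
    show "(if i = 0 then restrict_hom k w (gen_el 1 0) else restrict_hom k w (gen_el 0 1)) (2, j) = (if i = j then 1 else 0)"
      if "i < k'" "j < k'" for i j
      using that by (auto simp: restrict_gen_el w_def axis_def k'_def)
    show "g \<in> restrict_hom k w ` ?T \<longleftrightarrow> (\<exists>c. g = (\<lambda>x. \<Sum>i<k'. c i *
        (if i = 0 then restrict_hom k w (gen_el 1 0) else restrict_hom k w (gen_el 0 1)) x))" for g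
    proof -
      have eq: "(\<lambda>x. \<Sum>i<k'. c i * (if i = 0 then restrict_hom k w (gen_el 1 0) else restrict_hom k w (gen_el 0 1)) x)
          = restrict_hom k w (gen_el (c 0) (c 1))" for c :: "nat \<Rightarrow> real"
      proof -
        have "k = 0 \<or> k = 1 \<or> k' = 2" by (auto simp: k'_def)
        then show ?thesis
          unfolding restrict_gen_el
          by (elim disjE) (auto simp: fun_eq_iff k'_def w_def axis_def numeral_2_eq_2)
      qed
      show ?thesis
      proof
        assume "g \<in> restrict_hom k w ` ?T"
        then obtain u v where "g = restrict_hom k w (gen_el u v)" by auto
        then have "g = restrict_hom k w (gen_el ((\<lambda>n. if n = 0 then u else v) (0::nat)) ((\<lambda>n. if n = 0 then u else v) (1::nat)))"
          by simp
        then show "\<exists>c. g = (\<lambda>x. \<Sum>i<k'. c i *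
          (if i = 0 then restrict_hom k w (gen_el 1 0) else restrict_hom k w (gen_el 0 1)) x)"
          unfolding eq by (rule exI[where P = "\<lambda>c. g = restrict_hom k w (gen_el (c 0) (c 1))"])
      qed (auto simp: eq)
    qed
  qed
  then show ?thesis using upper char_sum_eqI unfolding k'_def by blast
qed

lemma gen_cartan_char:
  "cartan_char {gen_el u v | u v. True} k = (if k = 1 \<or> k = 2 then 1 else 0)"
  unfolding cartan_char_def gen_char_sum by auto

text \<open>
  The prolongation consists of the quadratic forms in \<open>\<omega>\<^sup>4, \<omega>\<^sup>6\<close>, with basis
  \<open>(\<omega>\<^sup>4)\<^sup>2, 2 \<omega>\<^sup>4 \<omega>\<^sup>6, (\<omega>\<^sup>6)\<^sup>2\<close>.
\<close>

lemma gen_prolongation_dim: "fun_space.dim (prolongation {gen_el u v | u v. True}) = 3"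
proof -
  define f :: "nat \<Rightarrow> nat \<times> 6 \<times> 6 \<Rightarrow> real" where "f n = (\<lambda>(\<alpha>, i, j). if \<alpha> = 2 then
      (if n = 0 then cov 4 i * cov 4 j else if n = 1 then cov 4 i * cov 6 j + cov 6 i * cov 4 j
       else cov 6 i * cov 6 j) else 0)" for n
  define y :: "nat \<Rightarrow> nat \<times> 6 \<times> 6" where
    "y n = (if n = 0 then (2, 4, 4) else if n = 1 then (2, 4, 6) else (2, 6, 6))" for n
  have less3: "n < 3 \<longleftrightarrow> n = 0 \<or> n = 1 \<or> n = 2" for n :: nat by auto
  have sum3: "(\<Sum>n<3. g n) = g 0 + g 1 + g 2" for g :: "nat \<Rightarrow> real"
    by (simp add: numeral_3_eq_3 numeral_2_eq_2)
  show ?thesis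
  proof (rule dim_dual_points[where f = f and y = y])
    show "f i (y j) = (if i = j then 1 else 0)" if "i < 3" "j < 3" for i j
      using that unfolding less3 by (elim disjE) (simp_all add: f_def y_def cov_table)
    show "P \<in> prolongation {gen_el u v | u v. True} \<longleftrightarrow> (\<exists>c. P = (\<lambda>x. \<Sum>n<3. c n * f n x))" for P
    proof
      assume "P \<in> prolongation {gen_el u v | u v. True}"
      then have sym: "\<And>\<alpha> i j. P (\<alpha>, i, j) = P (\<alpha>, j, i)"
        and "\<And>j. \<exists>u v. (\<lambda>(\<alpha>, i). P (\<alpha>, i, j)) = gen_el u v"
        by (auto simp: prolongation_def)
      then obtain u v where uv0: "\<And>j. (\<lambda>(\<alpha>, i). P (\<alpha>, i, j)) = gen_el (u j) (v j)" by metis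
      have P: "P (\<alpha>, i, j) = (if \<alpha> = 2 then u j * cov 4 i + v j * cov 6 i else 0)" for \<alpha> i j
        using fun_cong[OF uv0, of j "(\<alpha>, i)"] by (simp add: gen_el_def vec6_def)
      have uv: "u j * cov 4 i + v j * cov 6 i = u i * cov 4 j + v i * cov 6 j" for i j
        using sym[of 2 i j] unfolding P by simp
      have u: "u j = u 4 * cov 4 j + v 4 * cov 6 j" and v: "v j = u 6 * cov 4 j + v 6 * cov 6 j" for j
        using uv[of j 4] uv[of j 6] by (simp_all add: cov_table)
      have u6: "u 6 = v 4" using u[of 6] by (simp add: cov_table)
      have "P = (\<lambda>x. \<Sum>n<3. (if n = 0 then u 4 else if n = 1 then v 4 else v 6) * f n x)"
      proof (intro ext, clarify)
        fix \<alpha> i j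
        show "P (\<alpha>, i, j) = (\<Sum>n<3. (if n = 0 then u 4 else if n = 1 then v 4 else v 6) * f n (\<alpha>, i, j))"
          unfolding P sum3 by (subst u, subst v) (simp add: f_def u6 algebra_simps)
      qed
      then show "\<exists>c. P = (\<lambda>x. \<Sum>n<3. c n * f n x)"
        by (rule exI[where P = "\<lambda>c. P = (\<lambda>x. \<Sum>n<3. c n * f n x)"])
    next
      assume "\<exists>c. P = (\<lambda>x. \<Sum>n<3. c n * f n x)"
      then obtain c where P: "P = (\<lambda>x. \<Sum>n<3. c n * f n x)" by blast
      have "(\<lambda>(\<alpha>, i). P (\<alpha>, i, j)) = gen_el (c 0 * cov 4 j + c 1 * cov 6 j) (c 1 * cov 4 j + c 2 * cov 6 j)" for j
        by (auto simp: fun_eq_iff P sum3 f_def gen_el_def vec6_def algebra_simps)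
      moreover have "P (\<alpha>, i, j) = P (\<alpha>, j, i)" for \<alpha> i j
        by (simp add: P sum3 f_def algebra_simps)
      ultimately show "P \<in> prolongation {gen_el u v | u v. True}"
        unfolding prolongation_def by blast
    qed
  qed
qed

lemma gen_involutive: "involutive (tableau gen_sys a b)"
  unfolding involutive_def gen_tableau gen_prolongation_dim gen_cartan_char
  by (simp add: numeral_eq_Suc atLeastAtMostSuc_conv)

lemma gen_generality: "generality gen_sys 1 2"
  unfolding generality_def gen_tableau gen_cartan_char by auto

lemma exc_tableau: "tableau (exc_sys c) a b = {\<lambda>_. 0}"
  by (simp add: tableau_def exc_sys_def zero_fun_def)

lemma dim_zero_space: "fun_space.dim {\<lambda>_. 0} = 0"
  by (rule dim_dual_points[where f = "\<lambda>_ _. 0" and y = undefined]) auto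

lemma exc_cartan_char: "cartan_char {\<lambda>_. 0} k = 0"
proof -
  have "restrict_hom k v ` {\<lambda>_. 0} = {\<lambda>_. 0}" for k v
    by (auto simp: restrict_hom_def fun_eq_iff)
  then have "char_sum {\<lambda>_. 0} k = 0" for k
    by (intro char_sum_eqI) (simp_all only: dim_zero_space)
  then show ?thesis by (simp add: cartan_char_def)
qed

lemma exc_involutive: "involutive (tableau (exc_sys c) a b)"
proof -
  have "prolongation {\<lambda>_. 0} = {\<lambda>_. 0}"
    by (auto simp: prolongation_def fun_eq_iff)
  then show ?thesis
    unfolding involutive_def exc_tableau exc_cartan_char by (simp only: dim_zero_space) simp
qed

lemma exc_lower_generality: "lower_generality (exc_sys c) 1 2"
  unfolding lower_generality_def exc_tableau exc_cartan_char by simp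

lemma gen_involutive_eqs: "involutive_eqs gen_sys"
  unfolding involutive_eqs_def cartan_eqs_def
  using gen_analytic gen_skew gen_ddomega gen_dda gen_invariants gen_involutive by blast

lemma exc_involutive_eqs: "c * c = 1 \<Longrightarrow> involutive_eqs (exc_sys c)"
  unfolding involutive_eqs_def cartan_eqs_def
  using exc_analytic exc_skew exc_ddomega exc_dda exc_invariants[of c] exc_involutive by fastforce

section \<open>The generality of the class\<close>

lemma generic_backlund_iff:
  "(\<exists>\<B>. generic_backlund U \<B> \<omega> \<epsilon>1 \<epsilon>2 A1 A4) \<longleftrightarrow> one_adapted U \<omega> \<epsilon>1 \<epsilon>2 A1 A4"
  by (simp add: generic_backlund_def)

lemma constant_if_partials_vanish:
  assumes "open V" "convex V" "smooth_on V f" "\<And>x j. x \<in> V \<Longrightarrow> partial j f x = 0"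
    and "x \<in> V" "y \<in> V"
  shows "f x = f y"
proof -
  have "(f has_derivative (\<lambda>h. 0)) (at x within V)" if x: "x \<in> V" for x
  proof -
    let ?D = "frechet_derivative f (at x)"
    have d: "(f has_derivative ?D) (at x)"
      by (rule has_derivative_frechet[OF smooth_on_differentiable[OF assms(3) x]])
    have "?D h = 0" for h
    proof -
      have lin: "linear ?D" using has_derivative_linear[OF d] .
      have h: "h = (\<Sum>j\<in>UNIV. h $ j *\<^sub>R axis j 1)"
        by (simp add: vec_eq_iff axis_def if_distrib cong: if_cong)
      have "?D h = ?D (\<Sum>j\<in>UNIV. h $ j *\<^sub>R axis j 1)" by (rule arg_cong[OF h])
      also have "\<dots> = (\<Sum>j\<in>UNIV. h $ j * ?D (axis j 1))"
        by (simp only: linear_sum[OF lin] linear_scale[OF lin] real_scaleR_def)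
      finally show ?thesis using assms(4)[OF x] by (simp add: partial_def)
    qed
    then have "?D = (\<lambda>h. 0)" by blast
    then show ?thesis using d has_derivative_at_withinI by metis
  qed
  then obtain c where "\<And>x. x \<in> V \<Longrightarrow> f x = c"
    using has_derivative_zero_constant[OF assms(2)] by blast
  then show ?thesis using assms(5,6) by simp
qed

lemma coframing_subset: "coframing U \<omega> \<Longrightarrow> open V \<Longrightarrow> V \<subseteq> U \<Longrightarrow> coframing V \<omega>"
  unfolding coframing_def smooth_form_def using smooth_on_subset by blast

text \<open>
  On a ball around \<open>x\<close> the function \<open>s\<close> is constant, and its value selects the system. If it is
  not zero, then \<open>p\<close> vanishes on the ball and the formula for \<open>X\<^sub>1 p\<close> yields \<open>r s = 1\<close>.
\<close>

lemma adapted_imp_solution: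
  assumes ad: "one_adapted U \<omega> 1 1 (\<lambda>_. 1) (\<lambda>_. -1)" and x: "x \<in> U"
  shows "\<exists>V. open V \<and> x \<in> V \<and> V \<subseteq> U \<and>
    (\<exists>\<Sigma>\<in>{gen_sys, exc_sys 1, exc_sys (-1)}. \<exists>a b. solution \<Sigma> V \<omega> a b)"
proof -
  have cof: "coframing U \<omega>" using ad by (simp add: one_adapted_def)
  note U = coframing_open[OF cof]
  obtain p q r s where sm: "smooth_on U p" "smooth_on U q" "smooth_on U r" "smooth_on U s"
    and S: "\<And>x i j k. x \<in> U \<Longrightarrow> strf \<omega> i j k x = redc 1 (p x) (q x) (r x) 0 (s x) (s x) i j k"
    and bi: "\<And>x i l j k. x \<in> U \<Longrightarrow> bianchi_at (redc 1 (p x) (q x) (r x) 0 (s x) (s x))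
       (\<lambda>l. redc 0 (fder \<omega> l p x) (fder \<omega> l q x) (fder \<omega> l r x) 0 (fder \<omega> l s x) (fder \<omega> l s x)) i l j k"
    using adapted_structure[OF ad] by blast
  note D = invariants_derivatives[OF bi]
  obtain e where e: "0 < e" "ball x e \<subseteq> U" using U x openE by blast
  define V where "V = ball x e"
  have V: "open V" "x \<in> V" "V \<subseteq> U" "convex V" using e by (auto simp: V_def)
  have cofV: "coframing V \<omega>" by (rule coframing_subset[OF cof V(1,3)])
  have smV: "smooth_on V p" "smooth_on V q" "smooth_on V r" "smooth_on V s"
    using sm smooth_on_subset[OF V(3)] by auto
  have ds: "fder \<omega> l s y = 0" if "y \<in> U" for l y
    using D(19-24)[OF that] by (cases l rule: exhaust_6) simp_all
  have s: "s y = s x" if "y \<in> V" for y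
  proof (rule constant_if_partials_vanish[OF V(1,4) smV(4) _ that V(2)])
    show "partial j s z = 0" if "z \<in> V" for j z
      using partial_eq_fder[OF cofV that, of j s] ds V(3) that by auto
  qed
  have "\<exists>\<Sigma>\<in>{gen_sys, exc_sys 1, exc_sys (-1)}. \<exists>a b. solution \<Sigma> V \<omega> a b"
  proof (cases "s x = 0")
    case True
    define a where "a y n = (if n = 0 then p y else if n = 1 then q y else if n = 2 then r y else 0)" for y and n :: nat
    define b where "b y n = (if n = 0 then fder \<omega> 4 r y else if n = 1 then fder \<omega> 6 r y else 0)" for y and n :: nat
    have "solution gen_sys V \<omega> a b"
      unfolding solution_iff[OF gen_skew]
    proof (intro conjI allI ballI impI cofV)
      show "smooth_on V (\<lambda>y. a y n)" "smooth_on V (\<lambda>y. b y n)" for n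
        unfolding a_def b_def using smV smooth_on_fder[OF cofV smV(3)]
        by (cases "n = 0"; cases "n = 1"; cases "n = 2"; simp add: smooth_on_const)+
      fix y assume y: "y \<in> V"
      then have yU: "y \<in> U" and s0: "s y = 0" using V s[OF y] True by auto
      show "a y \<in> Rn (ninv gen_sys)" "b y \<in> Rn (nfree gen_sys)"
        by (auto simp: Rn_def a_def b_def gen_sys_def)
      show "strf \<omega> i j k y = - Tor gen_sys (a y) i j k" for i j k
        using S[OF yU] s0 by (simp add: gen_sys_def a_def)
      fix \<alpha> l assume "\<alpha> < ninv gen_sys"
      then consider "\<alpha> = 0" | "\<alpha> = 1" | "\<alpha> = 2" by (auto simp: gen_sys_def numeral_3_eq_3 less_Suc_eq)
      then show "fder \<omega> l (\<lambda>y. a y \<alpha>) y = Fun gen_sys (a y) (b y) \<alpha> l"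
        using D(3-18)[OF yU] s0
        by cases (cases l rule: exhaust_6; simp add: a_def b_def gen_sys_def gen_F_def del: One_nat_def)+
    qed
    then show ?thesis by blast
  next
    case False
    define c where "c = sgn (s x)"
    have c: "c = 1 \<or> c = -1" using False by (auto simp: c_def sgn_if)
    define t where "t = ln \<bar>s x\<bar>"
    have st: "s x = c * exp t" using False by (simp add: t_def c_def sgn_mult_abs)
    define a where "a y n = (if n = 0 then t else 0)" for y :: pt and n :: nat
    define b where "b y n = (0::real)" for y :: pt and n :: nat
    have pq: "p y = 0" "q y = 0" if "y \<in> V" for y
      using D(1,2)[of y] V(3) s[OF that] False that by auto
    have r: "r y = c * exp (- t)" if y: "y \<in> V" for y
    proof -
      have "fder \<omega> 1 p y = fder \<omega> 1 (\<lambda>_. 0) y"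
        by (rule fder_local_cong[OF V(1) y]) (rule pq)
      then have "r y * s y = 1"
        using D(3)[of y] V(3) y pq[OF y] by (auto simp: fder_const)
      then have "r y * (c * exp t) = 1" using s[OF y] st by simp
      then have "r y * (c * c) * (exp t * exp (- t)) = c * exp (- t)"
        by (simp add: algebra_simps)
      then show ?thesis using c by (auto simp: exp_minus_inverse)
    qed
    have "solution (exc_sys c) V \<omega> a b"
      unfolding solution_iff[OF exc_skew]
    proof (intro conjI allI ballI impI cofV)
      show "smooth_on V (\<lambda>y. a y n)" "smooth_on V (\<lambda>y. b y n)" for n
        unfolding a_def b_def by (rule smooth_on_const)+
      fix y assume y: "y \<in> V"
      show "a y \<in> Rn (ninv (exc_sys c))" "b y \<in> Rn (nfree (exc_sys c))"
        by (auto simp: Rn_def a_def b_def exc_sys_def)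
      show "strf \<omega> i j k y = - Tor (exc_sys c) (a y) i j k" for i j k
        using S[of y] V(3) y pq[OF y] r[OF y] s[OF y] st by (auto simp: exc_sys_def a_def)
      show "fder \<omega> l (\<lambda>y. a y \<alpha>) y = Fun (exc_sys c) (a y) (b y) \<alpha> l" for \<alpha> l
        by (simp add: a_def exc_sys_def fder_const)
    qed
    then show ?thesis using c by blast
  qed
  then show ?thesis using V by blast
qed

text \<open>
  The local solutions may belong to different systems. As \<open>p, q, r, s\<close> are read off from the
  structure functions, they are nevertheless defined and smooth on all of \<open>U\<close>.
\<close>

lemma solution_imp_adapted:
  assumes loc: "\<And>x. x \<in> U \<Longrightarrow> \<exists>V. open V \<and> x \<in> V \<and> V \<subseteq> U \<and>
    (\<exists>\<Sigma>\<in>{gen_sys, exc_sys 1, exc_sys (-1)}. \<exists>a b. solution \<Sigma> V \<omega> a b)"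
  shows "one_adapted U \<omega> 1 1 (\<lambda>_. 1) (\<lambda>_. -1)"
proof -
  have local_cof: "\<exists>V. open V \<and> x \<in> V \<and> V \<subseteq> U \<and> coframing V \<omega>" if "x \<in> U" for x
    using loc[OF that] by (auto simp: solution_def)
  have cof: "coframing U \<omega>"
    unfolding coframing_def smooth_form_def
  proof (intro conjI allI ballI)
    show "open U" using local_cof by (subst open_subopen) blast
    show "smooth_on U (\<lambda>x. \<omega> i x $ j)" for i j
    proof (rule smooth_on_locally)
      show "\<exists>V. open V \<and> x \<in> V \<and> smooth_on V (\<lambda>x. \<omega> i x $ j)" if "x \<in> U" for x
        using local_cof[OF that] coframing_smooth by blast
    qed
    show "det (\<chi> i. \<omega> i x) \<noteq> 0" if "x \<in> U" for x
      using local_cof[OF that] coframing_det by blast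
  qed
  note U = coframing_open[OF cof]
  define p where "p x = - strf \<omega> 5 4 5 x" for x
  define q where "q x = - strf \<omega> 5 3 6 x" for x
  define r where "r x = - strf \<omega> 5 4 6 x" for x
  define s where "s x = - strf \<omega> 4 2 3 x" for x
  show ?thesis
  proof (rule adapted_from_structure[OF cof])
    show "smooth_on U p" "smooth_on U q" "smooth_on U r" "smooth_on U s"
      unfolding p_def q_def r_def s_def by (intro smooth_on_minus U smooth_on_strf cof)+
    fix x i j k assume "x \<in> U"
    from loc[OF this] obtain V \<Sigma> a b where V: "x \<in> V"
      and \<Sigma>: "\<Sigma> \<in> {gen_sys, exc_sys 1, exc_sys (-1)}" and sol: "solution \<Sigma> V \<omega> a b"
      by (elim exE conjE bexE) (rule that)
    have "\<exists>p q r s. \<forall>i j k. strf \<omega> i j k x = redc 1 p q r 0 s s i j k"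
    proof (cases "\<Sigma> = gen_sys")
      case True
      then have "strf \<omega> i j k x = redc 1 (a x 0) (a x 1) (a x 2) 0 0 0 i j k" for i j k
        using sol V unfolding True solution_iff[OF gen_skew] by (simp add: gen_sys_def)
      then show ?thesis by blast
    next
      case False
      then obtain c where c: "\<Sigma> = exc_sys c" using \<Sigma> by blast
      have "strf \<omega> i j k x
          = redc 1 0 0 (c * exp (- a x 0)) 0 (c * exp (a x 0)) (c * exp (a x 0)) i j k" for i j k
        using sol V unfolding c solution_iff[OF exc_skew] by (simp add: exc_sys_def)
      then show ?thesis by blast
    qed
    then obtain p' q' r' s' where S: "\<And>i j k. strf \<omega> i j k x = redc 1 p' q' r' 0 s' s' i j k" by blast
    have "p x = p'" "q x = q'" "r x = r'" "s x = s'"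
      unfolding p_def q_def r_def s_def S redc_entries by simp_all
    then show "strf \<omega> i j k x = redc 1 (p x) (q x) (r x) 0 (s x) (s x) i j k" using S by simp
  qed
qed

theorem theorem6p1:
  shows "locally_determined_by
           (\<lambda>U \<omega>. \<exists>\<B>. generic_backlund U \<B> \<omega> 1 1 (\<lambda>_. 1) (\<lambda>_. -1))
           1 2"
  unfolding locally_determined_by_def generic_backlund_iff
proof (intro exI[of _ gen_sys] exI[of _ "{exc_sys 1, exc_sys (-1)}"] conjI allI)
  show "involutive_eqs gen_sys" "generality gen_sys 1 2"
    by (rule gen_involutive_eqs gen_generality)+
  show "\<forall>\<Sigma>'\<in>{exc_sys 1, exc_sys (-1)}. involutive_eqs \<Sigma>' \<and> lower_generality \<Sigma>' 1 2"
    using exc_involutive_eqs[of 1] exc_involutive_eqs[of "-1"] exc_lower_generality[of 1]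
      exc_lower_generality[of "-1"] by (simp del: One_nat_def)
  show "one_adapted U \<omega> 1 1 (\<lambda>_. 1) (\<lambda>_. -1) \<longleftrightarrow>
    (\<forall>x\<in>U. \<exists>V. open V \<and> x \<in> V \<and> V \<subseteq> U \<and>
      (\<exists>\<Sigma>'\<in>insert gen_sys {exc_sys 1, exc_sys (-1)}. \<exists>a b. solution \<Sigma>' V \<omega> a b))"
    (is "?A \<longleftrightarrow> (\<forall>x\<in>U. ?L x)") for U \<omega>
  proof
    assume ?A
    then show "\<forall>x\<in>U. ?L x" by (intro ballI) (rule adapted_imp_solution)
  next
    assume L: "\<forall>x\<in>U. ?L x"
    show ?A by (rule solution_imp_adapted) (rule bspec[OF L])
  qed
qed simp

end
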